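(* Let $(\mathcal{M},\otimes,\mathbf{1},\sigma)$ be an abelian symmetric monoidal category that satisfies the faithful coflatness condition and the faithful flatness condition, and such that the category $\mathsf{Hopf}_{\mathrm{coc}}(\mathcal{M})$ of cocommutative Hopf monoids in $\mathcal{M}$ has binary coproducts. Then the category $\mathsf{Ab}(\mathsf{Hopf}_{\mathrm{coc}}(\mathcal{M}))$ of abelian objects in $\mathsf{Hopf}_{\mathrm{coc}}(\mathcal{M})$ is exactly the category $\mathsf{Hopf}_{\mathrm{coc,com}}(\mathcal{M})$ of commutative and cocommutative Hopf monoids in $\mathcal{M}$.
   Context: Associativity and unit constraints are suppressed. An abelian symmetric monoidal category is a symmetric monoidal category $(\mathcal{M},\otimes,\mathbf{1},\sigma)$ such that $\mathcal{M}$ is abelian and, for every object $M$, the functors $M\otimes(-)$ and $(-)\otimes M$ are additive and exact. $\mathsf{Hopf}_{\mathrm{coc}}(\mathcal{M})$: objects are Hopf monoids $(A,m_A,u_A,\Delta_A,\varepsilon_A,S_A)$ in $\mathcal{M}$ with $\sigma_{A,A}\Delta_A=\Delta_A$; morphisms are morphisms of Hopf monoids. $\mathsf{Hopf}_{\mathrm{coc,com}}(\mathcal{M})$ is its full subcategory of objects with $m_A\sigma_{A,A}=m_A$. Under the hypotheses $\mathsf{Hopf}_{\mathrm{coc}}(\mathcal{M})$ is semi-abelian. For a semi-abelian category $\mathcal{C}$, an abelian object is an internal abelian group in $\mathcal{C}$; equivalently, an object $C$ such that the diagonal $\langle\mathrm{Id}_C,\mathrm{Id}_C\rangle:C\to C\times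 C$ is a kernel in $\mathcal{C}$. $\mathsf{Ab}(\mathcal{C})$ is the full subcategory of abelian objects. (In $\mathsf{Hopf}_{\mathrm{coc}}(\mathcal{M})$ the binary product of $A$ and $B$ is $A\otimes B$ with projections $\mathrm{Id}_A\otimes\varepsilon_B$, $\varepsilon_A\otimes\mathrm{Id}_B$, and the diagonal of $H$ is $\Delta_H$.) For $A$ in $\mathsf{Hopf}_{\mathrm{coc}}(\mathcal{M})$, the category $\mathsf{Comon}_{\mathrm{coc}}({}_A\mathcal{M})$ has as objects the cocommutative comonoids $Q$ in $\mathcal{M}$ with a left $A$-action $\mu_Q:A\otimes Q\to Q$ such that $\Delta_Q,\varepsilon_Q$ are left $A$-linear, where $Q\otimes Q$ has action $(\mu_Q\otimes\mu_Q)(\mathrm{Id}_A\otimes\sigma_{A,Q}\otimes\mathrm{Id}_Q)(\Delta_A\otimes\mathrm{Id}_{Q\otimes Q})$ and $\mathbf{1}$ has action $\varepsilon_A$; morphisms are the left $A$-linear comonoid morphisms. $A$ is an object of it via $m_A$. For a right $Q$-comodule $(V,\rho_V)$ and a left $Q$-comodule $(W,\lambda_W)$, $V\square_Q W$ is the equalizer in $\mathcal{M}$ of $\rho_V\otimes\mathrm{Id}_W,\ \mathrm{Id}_V\otimes\lambda_W: V\otimes W\to V\otimes Q\otimes W$. For a monoid $K$, a right $K$-module $(M,\nu_M)$ and a left $K$-module $(X,\mu_X)$, $M\otimes_K X$ is the coequalizer in $\mathcal{M}$ of $\nu_M\otimes\mathrm{Id}_X,\ \mathrm{Id}_M\otimes\mu_X:M\otimes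 K\otimes X\to M\otimes X$. These give functors $(-)\square_Q W:\mathcal{M}^Q\to\mathcal{M}$ (from right $Q$-comodules) and $(-)\otimes_K X:\mathcal{M}_K\to\mathcal{M}$ (from right $K$-modules). Faithful coflatness condition: for any $A$ in $\mathsf{Hopf}_{\mathrm{coc}}(\mathcal{M})$ and any morphism $\pi:A\to Q$ in $\mathsf{Comon}_{\mathrm{coc}}({}_A\mathcal{M})$ which is an epimorphism in $\mathcal{M}$, the functor $(-)\square_Q A$ preserves and reflects epimorphisms, where $A$ is a left $Q$-comodule via $(\pi\otimes\mathrm{Id}_A)\Delta_A$. Faithful flatness condition: for any $A$ in $\mathsf{Hopf}_{\mathrm{coc}}(\mathcal{M})$ and any morphism $i:K\to A$ in $\mathsf{Hopf}_{\mathrm{coc}}(\mathcal{M})$ which is a monomorphism in $\mathcal{M}$, the functor $(-)\otimes_K A$ preserves and reflects monomorphisms, where $A$ is a left $K$-module via $m_A(i\otimes\mathrm{Id}_A)$. *)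

theory Defs
  imports "HOL-Algebra.Group"
begin

no_notation monoid.mult (infixl "\<otimes>\<index>" 70)
no_notation monoid.one ("\<one>\<index>")

section \<open>Categories\<close>

text \<open>A category has a set of objects and a set of arrows; every arrow carries its domain and
  codomain, and \<open>g \<cdot> f\<close> is the composite "first f, then g". The record operations are only meaningful
  on \<open>Obj\<close>, \<open>Arr\<close> and composable pairs.\<close>

record ('o, 'm) cat =
  Obj :: "'o set"
  Arr :: "'m set"
  Dom :: "'m \<Rightarrow> 'o"
  Cod :: "'m \<Rightarrow> 'o"
  Id :: "'o \<Rightarrow> 'm"
  Comp :: "'m \<Rightarrow> 'm \<Rightarrow> 'm" (infixr "\<cdot>\<index>" 55)

definition Hom :: "('o, 'm, 'x) cat_scheme \<Rightarrow> 'o \<Rightarrow> 'o \<Rightarrow> 'm set" where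
  "Hom C X Y = {f \<in> Arr C. Dom C f = X \<and> Cod C f = Y}"

locale category =
  fixes C :: "('o, 'm, 'x) cat_scheme" (structure)
  assumes Dom_Obj: "f \<in> Arr C \<Longrightarrow> Dom C f \<in> Obj C"
    and Cod_Obj: "f \<in> Arr C \<Longrightarrow> Cod C f \<in> Obj C"
    and Id_Hom: "X \<in> Obj C \<Longrightarrow> Id C X \<in> Hom C X X"
    and Comp_Hom: "\<lbrakk>f \<in> Hom C X Y; g \<in> Hom C Y Z\<rbrakk> \<Longrightarrow> g \<cdot> f \<in> Hom C X Z"
    and Id_left: "f \<in> Hom C X Y \<Longrightarrow> Id C Y \<cdot> f = f"
    and Id_right: "f \<in> Hom C X Y \<Longrightarrow> f \<cdot> Id C X = f"
    and Comp_assoc: "\<lbrakk>f \<in> Hom C W X; g \<in> Hom C X Y; h \<in> Hom C Y Z\<rbrakk>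
      \<Longrightarrow> (h \<cdot> g) \<cdot> f = h \<cdot> (g \<cdot> f)"

definition full_subcategory :: "('o, 'm, 'x) cat_scheme \<Rightarrow> 'o set \<Rightarrow> ('o, 'm, 'x) cat_scheme" where
  "full_subcategory C S = C\<lparr>Obj := Obj C \<inter> S, Arr := {f \<in> Arr C. Dom C f \<in> S \<and> Cod C f \<in> S}\<rparr>"

text \<open>The category whose objects are structures \<open>A\<close> (ranging over \<open>S\<close>) on an object \<open>U A\<close> of \<open>C\<close>,
  and whose arrows \<open>A \<rightarrow> B\<close> are the arrows \<open>f : U A \<rightarrow> U B\<close> of \<open>C\<close> with \<open>P A B f\<close>. An arrow is the triple
  \<open>(A, B, f)\<close>.\<close>

definition structured_category ::
  "('o, 'm, 'x) cat_scheme \<Rightarrow> 's set \<Rightarrow> ('s \<Rightarrow> 'o) \<Rightarrow> ('s \<Rightarrow> 's \<Rightarrow> 'm \<Rightarrow> bool)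
    \<Rightarrow> ('s, 's \<times> 's \<times> 'm) cat" where
  "structured_category C S U P =
    \<lparr>Obj = S,
     Arr = {(A, B, f). A \<in> S \<and> B \<in> S \<and> f \<in> Hom C (U A) (U B) \<and> P A B f},
     Dom = (\<lambda>(A, B, f). A),
     Cod = (\<lambda>(A, B, f). B),
     Id = (\<lambda>A. (A, A, Id C (U A))),
     Comp = (\<lambda>(B', D, g) (A, B, f). (A, D, Comp C g f))\<rparr>"

definition monic :: "('o, 'm, 'x) cat_scheme \<Rightarrow> 'm \<Rightarrow> bool" where
  "monic C f \<longleftrightarrow> f \<in> Arr C \<and>
    (\<forall>W. \<forall>g \<in> Hom C W (Dom C f). \<forall>h \<in> Hom C W (Dom C f). f \<cdot> g = f \<cdot> h \<longrightarrow> g = h)"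
  for C (structure)

definition epic :: "('o, 'm, 'x) cat_scheme \<Rightarrow> 'm \<Rightarrow> bool" where
  "epic C f \<longleftrightarrow> f \<in> Arr C \<and>
    (\<forall>W. \<forall>g \<in> Hom C (Cod C f) W. \<forall>h \<in> Hom C (Cod C f) W. g \<cdot> f = h \<cdot> f \<longrightarrow> g = h)"
  for C (structure)

definition inverse_pair :: "('o, 'm, 'x) cat_scheme \<Rightarrow> 'm \<Rightarrow> 'm \<Rightarrow> bool" where
  "inverse_pair C f g \<longleftrightarrow> f \<in> Arr C \<and> g \<in> Hom C (Cod C f) (Dom C f) \<and>
    g \<cdot> f = Id C (Dom C f) \<and> f \<cdot> g = Id C (Cod C f)"
  for C (structure)

definition isomorphism :: "('o, 'm, 'x) cat_scheme \<Rightarrow> 'm \<Rightarrow> bool" where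
  "isomorphism C f \<longleftrightarrow> (\<exists>g. inverse_pair C f g)"

definition inverse_arrow :: "('o, 'm, 'x) cat_scheme \<Rightarrow> 'm \<Rightarrow> 'm" where
  "inverse_arrow C f = (THE g. inverse_pair C f g)"

definition terminal :: "('o, 'm, 'x) cat_scheme \<Rightarrow> 'o \<Rightarrow> bool" where
  "terminal C T \<longleftrightarrow> T \<in> Obj C \<and> (\<forall>X \<in> Obj C. \<exists>!f. f \<in> Hom C X T)"

definition initial :: "('o, 'm, 'x) cat_scheme \<Rightarrow> 'o \<Rightarrow> bool" where
  "initial C I \<longleftrightarrow> I \<in> Obj C \<and> (\<forall>X \<in> Obj C. \<exists>!f. f \<in> Hom C I X)"

definition is_product :: "('o, 'm, 'x) cat_scheme \<Rightarrow> 'o \<Rightarrow> 'o \<Rightarrow> 'o \<Rightarrow> 'm \<Rightarrow> 'm \<Rightarrow> bool" where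
  "is_product C X Y P p q \<longleftrightarrow> p \<in> Hom C P X \<and> q \<in> Hom C P Y \<and>
    (\<forall>Z. \<forall>f \<in> Hom C Z X. \<forall>g \<in> Hom C Z Y. \<exists>!h. h \<in> Hom C Z P \<and> p \<cdot> h = f \<and> q \<cdot> h = g)"
  for C (structure)

definition is_coproduct :: "('o, 'm, 'x) cat_scheme \<Rightarrow> 'o \<Rightarrow> 'o \<Rightarrow> 'o \<Rightarrow> 'm \<Rightarrow> 'm \<Rightarrow> bool" where
  "is_coproduct C X Y S i j \<longleftrightarrow> i \<in> Hom C X S \<and> j \<in> Hom C Y S \<and>
    (\<forall>Z. \<forall>f \<in> Hom C X Z. \<forall>g \<in> Hom C Y Z. \<exists>!h. h \<in> Hom C S Z \<and> h \<cdot> i = f \<and> h \<cdot> j = g)"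
  for C (structure)

definition has_binary_coproducts :: "('o, 'm, 'x) cat_scheme \<Rightarrow> bool" where
  "has_binary_coproducts C \<longleftrightarrow> (\<forall>X \<in> Obj C. \<forall>Y \<in> Obj C. \<exists>S i j. is_coproduct C X Y S i j)"

definition is_equalizer :: "('o, 'm, 'x) cat_scheme \<Rightarrow> 'm \<Rightarrow> 'm \<Rightarrow> 'm \<Rightarrow> bool" where
  "is_equalizer C f g e \<longleftrightarrow> e \<in> Arr C \<and> Cod C e = Dom C f \<and> f \<cdot> e = g \<cdot> e \<and>
    (\<forall>Z. \<forall>h \<in> Hom C Z (Dom C f). f \<cdot> h = g \<cdot> h \<longrightarrow> (\<exists>!k. k \<in> Hom C Z (Dom C e) \<and> e \<cdot> k = h))"
  for C (structure)

definition is_coequalizer :: "('o, 'm, 'x) cat_scheme \<Rightarrow> 'm \<Rightarrow> 'm \<Rightarrow> 'm \<Rightarrow> bool" where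
  "is_coequalizer C f g c \<longleftrightarrow> c \<in> Arr C \<and> Dom C c = Cod C f \<and> c \<cdot> f = c \<cdot> g \<and>
    (\<forall>Z. \<forall>h \<in> Hom C (Cod C f) Z. h \<cdot> f = h \<cdot> g \<longrightarrow> (\<exists>!k. k \<in> Hom C (Cod C c) Z \<and> k \<cdot> c = h))"
  for C (structure)

text \<open>Functors enter through their arrow maps, which determine the object maps.\<close>

definition preserves_epis :: "('o, 'm, 'x) cat_scheme \<Rightarrow> ('p, 'n, 'y) cat_scheme \<Rightarrow> ('m \<Rightarrow> 'n) \<Rightarrow> bool" where
  "preserves_epis C D F \<longleftrightarrow> (\<forall>f \<in> Arr C. epic C f \<longrightarrow> epic D (F f))"

definition reflects_epis :: "('o, 'm, 'x) cat_scheme \<Rightarrow> ('p, 'n, 'y) cat_scheme \<Rightarrow> ('m \<Rightarrow> 'n) \<Rightarrow> bool" where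
  "reflects_epis C D F \<longleftrightarrow> (\<forall>f \<in> Arr C. epic D (F f) \<longrightarrow> epic C f)"

definition preserves_monos :: "('o, 'm, 'x) cat_scheme \<Rightarrow> ('p, 'n, 'y) cat_scheme \<Rightarrow> ('m \<Rightarrow> 'n) \<Rightarrow> bool" where
  "preserves_monos C D F \<longleftrightarrow> (\<forall>f \<in> Arr C. monic C f \<longrightarrow> monic D (F f))"

definition reflects_monos :: "('o, 'm, 'x) cat_scheme \<Rightarrow> ('p, 'n, 'y) cat_scheme \<Rightarrow> ('m \<Rightarrow> 'n) \<Rightarrow> bool" where
  "reflects_monos C D F \<longleftrightarrow> (\<forall>f \<in> Arr C. monic D (F f) \<longrightarrow> monic C f)"


section \<open>Abelian objects\<close>

definition to_terminal :: "('o, 'm, 'x) cat_scheme \<Rightarrow> 'o \<Rightarrow> 'o \<Rightarrow> 'm" where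
  "to_terminal C T X = (THE f. f \<in> Hom C X T)"

text \<open>\<open>pairing C P p q f g\<close> is the arrow \<open>\<langle>f, g\<rangle>\<close> into the product \<open>P\<close> with projections \<open>p\<close>, \<open>q\<close>.\<close>

definition pairing :: "('o, 'm, 'x) cat_scheme \<Rightarrow> 'o \<Rightarrow> 'm \<Rightarrow> 'm \<Rightarrow> 'm \<Rightarrow> 'm \<Rightarrow> 'm" where
  "pairing C P p q f g = (THE h. h \<in> Hom C (Dom C f) P \<and> p \<cdot> h = f \<and> q \<cdot> h = g)"
  for C (structure)

text \<open>\<open>T\<close> is a terminal object, \<open>P\<close> is a product \<open>X \<times> X\<close> with projections \<open>p\<close>, \<open>q\<close>, and \<open>R\<close> is a product
  \<open>P \<times> X\<close> with projections \<open>r\<close>, \<open>s\<close>; thus \<open>p \<cdot> r\<close>, \<open>q \<cdot> r\<close>, \<open>s\<close> are the three projections of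
  \<open>X \<times> X \<times> X\<close>.\<close>

definition internal_abelian_group ::
  "('o, 'm, 'x) cat_scheme \<Rightarrow> 'o \<Rightarrow> 'o \<Rightarrow> 'o \<Rightarrow> 'm \<Rightarrow> 'm \<Rightarrow> 'o \<Rightarrow> 'm \<Rightarrow> 'm \<Rightarrow> 'm \<Rightarrow> 'm \<Rightarrow> 'm \<Rightarrow> bool" where
  "internal_abelian_group C X T P p q R r s mul e neg \<longleftrightarrow>
    X \<in> Obj C \<and> terminal C T \<and> is_product C X X P p q \<and> is_product C P X R r s \<and>
    mul \<in> Hom C P X \<and> e \<in> Hom C T X \<and> neg \<in> Hom C X X \<and>
    (let pr = pairing C P p q; e' = e \<cdot> to_terminal C T X in
      mul \<cdot> pr (mul \<cdot> r) s = mul \<cdot> pr (p \<cdot> r) (mul \<cdot> pr (q \<cdot> r) s) \<and>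
      mul \<cdot> pr e' (Id C X) = Id C X \<and> mul \<cdot> pr (Id C X) e' = Id C X \<and>
      mul \<cdot> pr neg (Id C X) = e' \<and> mul \<cdot> pr (Id C X) neg = e' \<and>
      mul \<cdot> pr q p = mul)"
  for C (structure)

definition abelian_object :: "('o, 'm, 'x) cat_scheme \<Rightarrow> 'o \<Rightarrow> bool" where
  "abelian_object C X \<longleftrightarrow>
    (\<exists>T P p q R r s mul e neg. internal_abelian_group C X T P p q R r s mul e neg)"

definition Ab :: "('o, 'm, 'x) cat_scheme \<Rightarrow> ('o, 'm, 'x) cat_scheme" where
  "Ab C = full_subcategory C {X. abelian_object C X}"


section \<open>Abelian categories\<close>

record ('o, 'm) preadditive_cat = "('o, 'm) cat" +
  Plus :: "'m \<Rightarrow> 'm \<Rightarrow> 'm" (infixl "\<oplus>\<index>" 60)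
  Zero :: "'o \<Rightarrow> 'o \<Rightarrow> 'm"

definition is_kernel :: "('o, 'm, 'x) preadditive_cat_scheme \<Rightarrow> 'm \<Rightarrow> 'm \<Rightarrow> bool" where
  "is_kernel C f k \<longleftrightarrow> is_equalizer C f (Zero C (Dom C f) (Cod C f)) k"

definition is_cokernel :: "('o, 'm, 'x) preadditive_cat_scheme \<Rightarrow> 'm \<Rightarrow> 'm \<Rightarrow> bool" where
  "is_cokernel C f c \<longleftrightarrow> is_coequalizer C f (Zero C (Dom C f) (Cod C f)) c"

definition is_biproduct ::
  "('o, 'm, 'x) preadditive_cat_scheme \<Rightarrow> 'o \<Rightarrow> 'o \<Rightarrow> 'o \<Rightarrow> 'm \<Rightarrow> 'm \<Rightarrow> 'm \<Rightarrow> 'm \<Rightarrow> bool" where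
  "is_biproduct C X Y B i j p q \<longleftrightarrow>
    i \<in> Hom C X B \<and> j \<in> Hom C Y B \<and> p \<in> Hom C B X \<and> q \<in> Hom C B Y \<and>
    p \<cdot> i = Id C X \<and> q \<cdot> j = Id C Y \<and> (i \<cdot> p) \<oplus> (j \<cdot> q) = Id C B"
  for C (structure)

locale abelian_category = category C for C :: "('o, 'm, 'x) preadditive_cat_scheme" (structure) +
  assumes Hom_comm_group: "\<lbrakk>X \<in> Obj C; Y \<in> Obj C\<rbrakk>
      \<Longrightarrow> comm_group \<lparr>carrier = Hom C X Y, monoid.mult = Plus C, one = Zero C X Y\<rparr>"
    and Comp_Plus_left: "\<lbrakk>f \<in> Hom C X Y; g \<in> Hom C Y Z; g' \<in> Hom C Y Z\<rbrakk>
      \<Longrightarrow> (g \<oplus> g') \<cdot> f = (g \<cdot> f) \<oplus> (g' \<cdot> f)"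
    and Comp_Plus_right: "\<lbrakk>f \<in> Hom C X Y; f' \<in> Hom C X Y; g \<in> Hom C Y Z\<rbrakk>
      \<Longrightarrow> g \<cdot> (f \<oplus> f') = (g \<cdot> f) \<oplus> (g \<cdot> f')"
    and zero_object: "\<exists>Z. terminal C Z \<and> initial C Z"
    and biproducts: "\<lbrakk>X \<in> Obj C; Y \<in> Obj C\<rbrakk> \<Longrightarrow> \<exists>B i j p q. is_biproduct C X Y B i j p q"
    and kernels: "f \<in> Arr C \<Longrightarrow> \<exists>k. is_kernel C f k"
    and cokernels: "f \<in> Arr C \<Longrightarrow> \<exists>c. is_cokernel C f c"
    and monic_kernel: "monic C f \<Longrightarrow> \<exists>g \<in> Arr C. is_kernel C g f"
    and epic_cokernel: "epic C f \<Longrightarrow> \<exists>g \<in> Arr C. is_cokernel C g f"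

definition additive ::
  "('o, 'm, 'x) preadditive_cat_scheme \<Rightarrow> ('p, 'n, 'y) preadditive_cat_scheme \<Rightarrow> ('m \<Rightarrow> 'n) \<Rightarrow> bool" where
  "additive C D F \<longleftrightarrow>
    (\<forall>X Y. \<forall>f \<in> Hom C X Y. \<forall>g \<in> Hom C X Y. F (Plus C f g) = Plus D (F f) (F g))"

definition short_exact :: "('o, 'm, 'x) preadditive_cat_scheme \<Rightarrow> 'm \<Rightarrow> 'm \<Rightarrow> bool" where
  "short_exact C f g \<longleftrightarrow> f \<in> Arr C \<and> g \<in> Arr C \<and> is_kernel C g f \<and> is_cokernel C f g"

definition exact ::
  "('o, 'm, 'x) preadditive_cat_scheme \<Rightarrow> ('p, 'n, 'y) preadditive_cat_scheme \<Rightarrow> ('m \<Rightarrow> 'n) \<Rightarrow> bool" where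
  "exact C D F \<longleftrightarrow> (\<forall>f g. short_exact C f g \<longrightarrow> short_exact D (F f) (F g))"


section \<open>Symmetric monoidal categories\<close>

text \<open>The associativity and unit constraints, usually suppressed by coherence, are explicit here:
  \<open>\<alpha> X Y Z : (X \<boxtimes> Y) \<boxtimes> Z \<rightarrow> X \<boxtimes> (Y \<boxtimes> Z)\<close>, \<open>Lunit M X : \<I> \<boxtimes> X \<rightarrow> X\<close>, \<open>Runit M X : X \<boxtimes> \<I> \<rightarrow> X\<close>.
  The tensor product is written \<open>\<boxtimes>\<close> on objects and \<open>\<otimes>\<close> on arrows.\<close>

record ('o, 'm) symmetric_monoidal_cat = "('o, 'm) preadditive_cat" +
  tensor_obj :: "'o \<Rightarrow> 'o \<Rightarrow> 'o" (infixl "\<boxtimes>\<index>" 70)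
  tensor_arr :: "'m \<Rightarrow> 'm \<Rightarrow> 'm" (infixl "\<otimes>\<index>" 70)
  unit_obj :: "'o" ("\<I>\<index>")
  Assoc :: "'o \<Rightarrow> 'o \<Rightarrow> 'o \<Rightarrow> 'm" ("\<alpha>\<index>")
  Lunit :: "'o \<Rightarrow> 'm"
  Runit :: "'o \<Rightarrow> 'm"
  Braid :: "'o \<Rightarrow> 'o \<Rightarrow> 'm" ("\<sigma>\<index>")

locale symmetric_monoidal_category = category M
  for M :: "('o, 'm, 'x) symmetric_monoidal_cat_scheme" (structure) +
  assumes unit_Obj: "\<I> \<in> Obj M"
    and tensor_Obj: "\<lbrakk>X \<in> Obj M; Y \<in> Obj M\<rbrakk> \<Longrightarrow> X \<boxtimes> Y \<in> Obj M"
    and tensor_Hom: "\<lbrakk>f \<in> Hom M X X'; g \<in> Hom M Y Y'\<rbrakk> \<Longrightarrow> f \<otimes> g \<in> Hom M (X \<boxtimes> Y) (X' \<boxtimes> Y')"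
    and tensor_Id: "\<lbrakk>X \<in> Obj M; Y \<in> Obj M\<rbrakk> \<Longrightarrow> Id M X \<otimes> Id M Y = Id M (X \<boxtimes> Y)"
    and tensor_Comp: "\<lbrakk>f \<in> Hom M X X'; f' \<in> Hom M X' X''; g \<in> Hom M Y Y'; g' \<in> Hom M Y' Y''\<rbrakk>
      \<Longrightarrow> (f' \<cdot> f) \<otimes> (g' \<cdot> g) = (f' \<otimes> g') \<cdot> (f \<otimes> g)"
    and Assoc_Hom: "\<lbrakk>X \<in> Obj M; Y \<in> Obj M; Z \<in> Obj M\<rbrakk>
      \<Longrightarrow> \<alpha> X Y Z \<in> Hom M ((X \<boxtimes> Y) \<boxtimes> Z) (X \<boxtimes> (Y \<boxtimes> Z))"
    and Assoc_iso: "\<lbrakk>X \<in> Obj M; Y \<in> Obj M; Z \<in> Obj M\<rbrakk> \<Longrightarrow> isomorphism M (\<alpha> X Y Z)"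
    and Assoc_natural: "\<lbrakk>f \<in> Hom M X X'; g \<in> Hom M Y Y'; h \<in> Hom M Z Z'\<rbrakk>
      \<Longrightarrow> \<alpha> X' Y' Z' \<cdot> ((f \<otimes> g) \<otimes> h) = (f \<otimes> (g \<otimes> h)) \<cdot> \<alpha> X Y Z"
    and Lunit_Hom: "X \<in> Obj M \<Longrightarrow> Lunit M X \<in> Hom M (\<I> \<boxtimes> X) X"
    and Lunit_iso: "X \<in> Obj M \<Longrightarrow> isomorphism M (Lunit M X)"
    and Lunit_natural: "f \<in> Hom M X X' \<Longrightarrow> Lunit M X' \<cdot> (Id M \<I> \<otimes> f) = f \<cdot> Lunit M X"
    and Runit_Hom: "X \<in> Obj M \<Longrightarrow> Runit M X \<in> Hom M (X \<boxtimes> \<I>) X"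
    and Runit_iso: "X \<in> Obj M \<Longrightarrow> isomorphism M (Runit M X)"
    and Runit_natural: "f \<in> Hom M X X' \<Longrightarrow> Runit M X' \<cdot> (f \<otimes> Id M \<I>) = f \<cdot> Runit M X"
    and pentagon: "\<lbrakk>W \<in> Obj M; X \<in> Obj M; Y \<in> Obj M; Z \<in> Obj M\<rbrakk>
      \<Longrightarrow> \<alpha> W X (Y \<boxtimes> Z) \<cdot> \<alpha> (W \<boxtimes> X) Y Z
        = (Id M W \<otimes> \<alpha> X Y Z) \<cdot> \<alpha> W (X \<boxtimes> Y) Z \<cdot> (\<alpha> W X Y \<otimes> Id M Z)"
    and triangle: "\<lbrakk>X \<in> Obj M; Y \<in> Obj M\<rbrakk>
      \<Longrightarrow> (Id M X \<otimes> Lunit M Y) \<cdot> \<alpha> X \<I> Y = Runit M X \<otimes> Id M Y"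
    and Braid_Hom: "\<lbrakk>X \<in> Obj M; Y \<in> Obj M\<rbrakk> \<Longrightarrow> \<sigma> X Y \<in> Hom M (X \<boxtimes> Y) (Y \<boxtimes> X)"
    and Braid_natural: "\<lbrakk>f \<in> Hom M X X'; g \<in> Hom M Y Y'\<rbrakk>
      \<Longrightarrow> \<sigma> X' Y' \<cdot> (f \<otimes> g) = (g \<otimes> f) \<cdot> \<sigma> X Y"
    and symmetry: "\<lbrakk>X \<in> Obj M; Y \<in> Obj M\<rbrakk> \<Longrightarrow> \<sigma> Y X \<cdot> \<sigma> X Y = Id M (X \<boxtimes> Y)"
    and hexagon: "\<lbrakk>X \<in> Obj M; Y \<in> Obj M; Z \<in> Obj M\<rbrakk>
      \<Longrightarrow> \<alpha> Y Z X \<cdot> \<sigma> X (Y \<boxtimes> Z) \<cdot> \<alpha> X Y Z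
        = (Id M Y \<otimes> \<sigma> X Z) \<cdot> \<alpha> Y X Z \<cdot> (\<sigma> X Y \<otimes> Id M Z)"

locale abelian_symmetric_monoidal_category =
  symmetric_monoidal_category M + abelian_category M
  for M :: "('o, 'm, 'x) symmetric_monoidal_cat_scheme" (structure) +
  assumes tensor_left_additive: "X \<in> Obj M \<Longrightarrow> additive M M (\<lambda>f. Id M X \<otimes> f)"
    and tensor_left_exact: "X \<in> Obj M \<Longrightarrow> exact M M (\<lambda>f. Id M X \<otimes> f)"
    and tensor_right_additive: "X \<in> Obj M \<Longrightarrow> additive M M (\<lambda>f. f \<otimes> Id M X)"
    and tensor_right_exact: "X \<in> Obj M \<Longrightarrow> exact M M (\<lambda>f. f \<otimes> Id M X)"

text \<open>\<open>Id \<otimes> \<sigma> \<otimes> Id : (W \<boxtimes> X) \<boxtimes> (Y \<boxtimes> Z) \<rightarrow> (W \<boxtimes> Y) \<boxtimes> (X \<boxtimes> Z)\<close> with its associators.\<close>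

definition interchange ::
  "('o, 'm, 'x) symmetric_monoidal_cat_scheme \<Rightarrow> 'o \<Rightarrow> 'o \<Rightarrow> 'o \<Rightarrow> 'o \<Rightarrow> 'm" where
  "interchange M W X Y Z =
    inverse_arrow M (\<alpha> W Y (X \<boxtimes> Z))
      \<cdot> (Id M W \<otimes> (\<alpha> Y X Z \<cdot> (\<sigma> X Y \<otimes> Id M Z) \<cdot> inverse_arrow M (\<alpha> X Y Z)))
      \<cdot> \<alpha> W X (Y \<boxtimes> Z)"
  for M (structure)


section \<open>Hopf monoids\<close>

record ('o, 'm) comonoid_data =
  Car :: 'o
  Comul :: 'm
  Counit :: 'm

record ('o, 'm) hopf_data = "('o, 'm) comonoid_data" +
  Mul :: 'm
  Unt :: 'm
  Antipode :: 'm

definition is_comonoid ::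
  "('o, 'm, 'x) symmetric_monoidal_cat_scheme \<Rightarrow> ('o, 'm, 'y) comonoid_data_scheme \<Rightarrow> bool" where
  "is_comonoid M A \<longleftrightarrow>
    (let X = Car A; \<Delta> = Comul A; \<epsilon> = Counit A in
      X \<in> Obj M \<and> \<Delta> \<in> Hom M X (X \<boxtimes> X) \<and> \<epsilon> \<in> Hom M X \<I> \<and>
      \<alpha> X X X \<cdot> (\<Delta> \<otimes> Id M X) \<cdot> \<Delta> = (Id M X \<otimes> \<Delta>) \<cdot> \<Delta> \<and>
      Lunit M X \<cdot> (\<epsilon> \<otimes> Id M X) \<cdot> \<Delta> = Id M X \<and>
      Runit M X \<cdot> (Id M X \<otimes> \<epsilon>) \<cdot> \<Delta> = Id M X)"
  for M (structure)

definition cocommutative ::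
  "('o, 'm, 'x) symmetric_monoidal_cat_scheme \<Rightarrow> ('o, 'm, 'y) comonoid_data_scheme \<Rightarrow> bool" where
  "cocommutative M A \<longleftrightarrow> \<sigma> (Car A) (Car A) \<cdot> Comul A = Comul A"
  for M (structure)

definition comonoid_morphism ::
  "('o, 'm, 'x) symmetric_monoidal_cat_scheme \<Rightarrow> ('o, 'm, 'y) comonoid_data_scheme
    \<Rightarrow> ('o, 'm, 'z) comonoid_data_scheme \<Rightarrow> 'm \<Rightarrow> bool" where
  "comonoid_morphism M A B f \<longleftrightarrow> f \<in> Hom M (Car A) (Car B) \<and>
    Comul B \<cdot> f = (f \<otimes> f) \<cdot> Comul A \<and> Counit B \<cdot> f = Counit A"
  for M (structure)

definition is_monoid ::
  "('o, 'm, 'x) symmetric_monoidal_cat_scheme \<Rightarrow> ('o, 'm, 'y) hopf_data_scheme \<Rightarrow> bool" where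
  "is_monoid M A \<longleftrightarrow>
    (let X = Car A; m = Mul A; u = Unt A in
      X \<in> Obj M \<and> m \<in> Hom M (X \<boxtimes> X) X \<and> u \<in> Hom M \<I> X \<and>
      m \<cdot> (m \<otimes> Id M X) = m \<cdot> (Id M X \<otimes> m) \<cdot> \<alpha> X X X \<and>
      m \<cdot> (u \<otimes> Id M X) = Lunit M X \<and>
      m \<cdot> (Id M X \<otimes> u) = Runit M X)"
  for M (structure)

definition commutative ::
  "('o, 'm, 'x) symmetric_monoidal_cat_scheme \<Rightarrow> ('o, 'm, 'y) hopf_data_scheme \<Rightarrow> bool" where
  "commutative M A \<longleftrightarrow> Mul A \<cdot> \<sigma> (Car A) (Car A) = Mul A"
  for M (structure)

definition monoid_morphism ::
  "('o, 'm, 'x) symmetric_monoidal_cat_scheme \<Rightarrow> ('o, 'm, 'y) hopf_data_scheme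
    \<Rightarrow> ('o, 'm, 'z) hopf_data_scheme \<Rightarrow> 'm \<Rightarrow> bool" where
  "monoid_morphism M A B f \<longleftrightarrow> f \<in> Hom M (Car A) (Car B) \<and>
    f \<cdot> Mul A = Mul B \<cdot> (f \<otimes> f) \<and> f \<cdot> Unt A = Unt B"
  for M (structure)

definition is_bimonoid ::
  "('o, 'm, 'x) symmetric_monoidal_cat_scheme \<Rightarrow> ('o, 'm, 'y) hopf_data_scheme \<Rightarrow> bool" where
  "is_bimonoid M A \<longleftrightarrow> is_monoid M A \<and> is_comonoid M A \<and>
    (let X = Car A; m = Mul A; u = Unt A; \<Delta> = Comul A; \<epsilon> = Counit A in
      \<Delta> \<cdot> m = (m \<otimes> m) \<cdot> interchange M X X X X \<cdot> (\<Delta> \<otimes> \<Delta>) \<and>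
      \<Delta> \<cdot> u = (u \<otimes> u) \<cdot> inverse_arrow M (Lunit M \<I>) \<and>
      \<epsilon> \<cdot> m = Lunit M \<I> \<cdot> (\<epsilon> \<otimes> \<epsilon>) \<and>
      \<epsilon> \<cdot> u = Id M \<I>)"
  for M (structure)

definition is_hopf_monoid ::
  "('o, 'm, 'x) symmetric_monoidal_cat_scheme \<Rightarrow> ('o, 'm, 'y) hopf_data_scheme \<Rightarrow> bool" where
  "is_hopf_monoid M A \<longleftrightarrow> is_bimonoid M A \<and> Antipode A \<in> Hom M (Car A) (Car A) \<and>
    Mul A \<cdot> (Antipode A \<otimes> Id M (Car A)) \<cdot> Comul A = Unt A \<cdot> Counit A \<and>
    Mul A \<cdot> (Id M (Car A) \<otimes> Antipode A) \<cdot> Comul A = Unt A \<cdot> Counit A"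
  for M (structure)

text \<open>As usual, morphisms of Hopf monoids are the morphisms of the underlying bimonoids; these
  commute with the antipodes automatically.\<close>

definition Hopf_coc ::
  "('o, 'm, 'x) symmetric_monoidal_cat_scheme
    \<Rightarrow> (('o, 'm) hopf_data, ('o, 'm) hopf_data \<times> ('o, 'm) hopf_data \<times> 'm) cat" where
  "Hopf_coc M = structured_category M {A. is_hopf_monoid M A \<and> cocommutative M A} Car
    (\<lambda>A B f. monoid_morphism M A B f \<and> comonoid_morphism M A B f)"

definition Hopf_coc_com ::
  "('o, 'm, 'x) symmetric_monoidal_cat_scheme
    \<Rightarrow> (('o, 'm) hopf_data, ('o, 'm) hopf_data \<times> ('o, 'm) hopf_data \<times> 'm) cat" where
  "Hopf_coc_com M = full_subcategory (Hopf_coc M) {A. commutative M A}"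


section \<open>The faithful coflatness condition\<close>

record ('o, 'm) module_comonoid_data = "('o, 'm) comonoid_data" +
  Act :: 'm

definition is_left_action ::
  "('o, 'm, 'x) symmetric_monoidal_cat_scheme \<Rightarrow> ('o, 'm) hopf_data \<Rightarrow> 'o \<Rightarrow> 'm \<Rightarrow> bool" where
  "is_left_action M A Q \<mu> \<longleftrightarrow> Q \<in> Obj M \<and> \<mu> \<in> Hom M (Car A \<boxtimes> Q) Q \<and>
    \<mu> \<cdot> (Mul A \<otimes> Id M Q) = \<mu> \<cdot> (Id M (Car A) \<otimes> \<mu>) \<cdot> \<alpha> (Car A) (Car A) Q \<and>
    \<mu> \<cdot> (Unt A \<otimes> Id M Q) = Lunit M Q"
  for M (structure)

definition left_linear ::
  "('o, 'm, 'x) symmetric_monoidal_cat_scheme \<Rightarrow> ('o, 'm) hopf_data \<Rightarrow> 'm \<Rightarrow> 'm \<Rightarrow> 'm \<Rightarrow> bool" where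
  "left_linear M A \<mu> \<mu>' f \<longleftrightarrow> f \<cdot> \<mu> = \<mu>' \<cdot> (Id M (Car A) \<otimes> f)"
  for M (structure)

definition is_module_comonoid ::
  "('o, 'm, 'x) symmetric_monoidal_cat_scheme \<Rightarrow> ('o, 'm) hopf_data
    \<Rightarrow> ('o, 'm) module_comonoid_data \<Rightarrow> bool" where
  "is_module_comonoid M A Q \<longleftrightarrow> is_comonoid M Q \<and> is_left_action M A (Car Q) (Act Q) \<and>
    left_linear M A (Act Q)
      ((Act Q \<otimes> Act Q) \<cdot> interchange M (Car A) (Car A) (Car Q) (Car Q)
        \<cdot> (Comul A \<otimes> Id M (Car Q \<boxtimes> Car Q)))
      (Comul Q) \<and>
    left_linear M A (Act Q) (Counit A \<cdot> Runit M (Car A)) (Counit Q)"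
  for M (structure)

definition Comon_coc ::
  "('o, 'm, 'x) symmetric_monoidal_cat_scheme \<Rightarrow> ('o, 'm) hopf_data
    \<Rightarrow> (('o, 'm) module_comonoid_data,
         ('o, 'm) module_comonoid_data \<times> ('o, 'm) module_comonoid_data \<times> 'm) cat" where
  "Comon_coc M A = structured_category M {Q. is_module_comonoid M A Q \<and> cocommutative M Q} Car
    (\<lambda>Q Q' f. comonoid_morphism M Q Q' f \<and> left_linear M A (Act Q) (Act Q') f)"

definition regular_module_comonoid :: "('o, 'm) hopf_data \<Rightarrow> ('o, 'm) module_comonoid_data" where
  "regular_module_comonoid A = \<lparr>Car = Car A, Comul = Comul A, Counit = Counit A, Act = Mul A\<rparr>"

definition right_comodules ::
  "('o, 'm, 'x) symmetric_monoidal_cat_scheme \<Rightarrow> ('o, 'm, 'y) comonoid_data_scheme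
    \<Rightarrow> ('o \<times> 'm, ('o \<times> 'm) \<times> ('o \<times> 'm) \<times> 'm) cat" where
  "right_comodules M Q = structured_category M
    {(V, \<rho>). V \<in> Obj M \<and> \<rho> \<in> Hom M V (V \<boxtimes> Car Q) \<and>
      \<alpha> V (Car Q) (Car Q) \<cdot> (\<rho> \<otimes> Id M (Car Q)) \<cdot> \<rho> = (Id M V \<otimes> Comul Q) \<cdot> \<rho> \<and>
      Runit M V \<cdot> (Id M V \<otimes> Counit Q) \<cdot> \<rho> = Id M V}
    fst
    (\<lambda>V V' f. snd V' \<cdot> f = (f \<otimes> Id M (Car Q)) \<cdot> snd V)"
  for M (structure)

text \<open>A chosen equalizer \<open>V \<box>\<^sub>Q W \<rightarrow> V \<boxtimes> W\<close>, and the arrow map of the functor \<open>(-) \<box>\<^sub>Q W\<close> it induces.\<close>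

definition cotensor_arrow ::
  "('o, 'm, 'x) symmetric_monoidal_cat_scheme \<Rightarrow> ('o, 'm, 'y) comonoid_data_scheme
    \<Rightarrow> 'o \<Rightarrow> 'm \<Rightarrow> 'o \<times> 'm \<Rightarrow> 'm" where
  "cotensor_arrow M Q W l V =
    (SOME e. is_equalizer M
      (\<alpha> (fst V) (Car Q) W \<cdot> (snd V \<otimes> Id M W)) (Id M (fst V) \<otimes> l) e)"
  for M (structure)

definition cotensor_functor ::
  "('o, 'm, 'x) symmetric_monoidal_cat_scheme \<Rightarrow> ('o, 'm, 'y) comonoid_data_scheme
    \<Rightarrow> 'o \<Rightarrow> 'm \<Rightarrow> ('o \<times> 'm) \<times> ('o \<times> 'm) \<times> 'm \<Rightarrow> 'm" where
  "cotensor_functor M Q W l F =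
    (case F of (V, V', f) \<Rightarrow>
      (let e = cotensor_arrow M Q W l V; e' = cotensor_arrow M Q W l V' in
        THE h. h \<in> Hom M (Dom M e) (Dom M e') \<and> e' \<cdot> h = (f \<otimes> Id M W) \<cdot> e))"
  for M (structure)

definition faithful_coflatness :: "('o, 'm, 'x) symmetric_monoidal_cat_scheme \<Rightarrow> bool" where
  "faithful_coflatness M \<longleftrightarrow>
    (\<forall>A \<in> Obj (Hopf_coc M). \<forall>Q \<pi>.
      (regular_module_comonoid A, Q, \<pi>) \<in> Arr (Comon_coc M A) \<and> epic M \<pi> \<longrightarrow>
      (let F = cotensor_functor M Q (Car A) ((\<pi> \<otimes> Id M (Car A)) \<cdot> Comul A) in
        preserves_epis (right_comodules M Q) M F \<and> reflects_epis (right_comodules M Q) M F))"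
  for M (structure)


section \<open>The faithful flatness condition\<close>

definition right_modules ::
  "('o, 'm, 'x) symmetric_monoidal_cat_scheme \<Rightarrow> ('o, 'm) hopf_data
    \<Rightarrow> ('o \<times> 'm, ('o \<times> 'm) \<times> ('o \<times> 'm) \<times> 'm) cat" where
  "right_modules M K = structured_category M
    {(N, \<nu>). N \<in> Obj M \<and> \<nu> \<in> Hom M (N \<boxtimes> Car K) N \<and>
      \<nu> \<cdot> (\<nu> \<otimes> Id M (Car K)) = \<nu> \<cdot> (Id M N \<otimes> Mul K) \<cdot> \<alpha> N (Car K) (Car K) \<and>
      \<nu> \<cdot> (Id M N \<otimes> Unt K) = Runit M N}
    fst
    (\<lambda>N N' f. f \<cdot> snd N = snd N' \<cdot> (f \<otimes> Id M (Car K)))"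
  for M (structure)

text \<open>A chosen coequalizer \<open>N \<boxtimes> X \<rightarrow> N \<otimes>\<^sub>K X\<close>, and the arrow map of the functor \<open>(-) \<otimes>\<^sub>K X\<close> it induces.\<close>

definition relative_tensor_arrow ::
  "('o, 'm, 'x) symmetric_monoidal_cat_scheme \<Rightarrow> ('o, 'm) hopf_data
    \<Rightarrow> 'o \<Rightarrow> 'm \<Rightarrow> 'o \<times> 'm \<Rightarrow> 'm" where
  "relative_tensor_arrow M K X \<mu> N =
    (SOME c. is_coequalizer M
      (snd N \<otimes> Id M X) ((Id M (fst N) \<otimes> \<mu>) \<cdot> \<alpha> (fst N) (Car K) X) c)"
  for M (structure)

definition relative_tensor_functor ::
  "('o, 'm, 'x) symmetric_monoidal_cat_scheme \<Rightarrow> ('o, 'm) hopf_data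
    \<Rightarrow> 'o \<Rightarrow> 'm \<Rightarrow> ('o \<times> 'm) \<times> ('o \<times> 'm) \<times> 'm \<Rightarrow> 'm" where
  "relative_tensor_functor M K X \<mu> F =
    (case F of (N, N', f) \<Rightarrow>
      (let c = relative_tensor_arrow M K X \<mu> N; c' = relative_tensor_arrow M K X \<mu> N' in
        THE h. h \<in> Hom M (Cod M c) (Cod M c') \<and> h \<cdot> c = c' \<cdot> (f \<otimes> Id M X)))"
  for M (structure)

definition faithful_flatness :: "('o, 'm, 'x) symmetric_monoidal_cat_scheme \<Rightarrow> bool" where
  "faithful_flatness M \<longleftrightarrow>
    (\<forall>A \<in> Obj (Hopf_coc M). \<forall>K i.
      (K, A, i) \<in> Arr (Hopf_coc M) \<and> monic M i \<longrightarrow>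
      (let F = relative_tensor_functor M K (Car A) (Mul A \<cdot> (i \<otimes> Id M (Car A))) in
        preserves_monos (right_modules M K) M F \<and> reflects_monos (right_modules M K) M F))"
  for M (structure)

end

theory Submission
  imports Defs
begin

text \<open>Cocommutative comonoids in a symmetric monoidal category form a category whose finite products are given
  by the tensor product, and a cocommutative Hopf monoid is the same thing as a group object in it. So a
  cocommutative Hopf monoid \<open>H\<close> can be handled through the groups of its elements, the comonoid morphisms
  \<open>C \<rightarrow> H\<close> under convolution. An internal abelian group structure on \<open>H\<close> forces \<open>H\<close> to be commutative by the
  Eckmann--Hilton argument; conversely, if \<open>H\<close> is commutative then these groups are abelian, so that
  multiplication and antipode are morphisms of Hopf monoids and make \<open>H\<close> an internal abelian group.\<close>

section \<open>Arrows of a symmetric monoidal category\<close>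

text \<open>Associators and unitors are explicit, so coherence is the first obstacle: the diagrams
  needed are derived one by one from pentagon, triangle and hexagon. The main ones concern
  \<open>interchange\<close> and say that the tensor product is a symmetric monoidal functor of two
  variables; this is what makes a tensor product of cocommutative comonoids a cocommutative
  comonoid. Once \<open>pair\<close>, \<open>pr1\<close> and \<open>pr2\<close> form a product,
  structure arrows merely rearrange components, and an identity of arrows is recovered from one of
  elements by evaluating at the generic element, whose coordinates are projections.

  The step from Hopf monoids to group objects has a gap: the antipode is postulated as a bare arrow
  of \<open>M\<close>. Convolution is therefore defined for arbitrary arrows, and the antipode is
  shown to be a comonoid morphism by inverting a shear map. Moreover, an internal abelian group may
  use any terminal object and any product, so its operation must be carried over to the tensor
  product before the Eckmann-Hilton argument applies.\<close>

lemma Hom_iff: "f \<in> Hom C X Y \<longleftrightarrow> f \<in> Arr C \<and> Dom C f = X \<and> Cod C f = Y"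
  by (auto simp: Hom_def)

context category
begin

lemma Comp_arr [simp]:
  assumes "f \<in> Arr C" "g \<in> Arr C" "Dom C g = Cod C f"
  shows "g \<cdot> f \<in> Arr C" "Dom C (g \<cdot> f) = Dom C f" "Cod C (g \<cdot> f) = Cod C g"
  using Comp_Hom[of f "Dom C f" "Cod C f" g "Cod C g"] assms by (auto simp: Hom_iff)

lemma Id_arr [simp]:
  assumes "X \<in> Obj C"
  shows "Id C X \<in> Arr C" "Dom C (Id C X) = X" "Cod C (Id C X) = X"
  using Id_Hom[OF assms] by (auto simp: Hom_iff)

lemma Dom_Cod_Obj [simp]: "f \<in> Arr C \<Longrightarrow> Dom C f \<in> Obj C" "f \<in> Arr C \<Longrightarrow> Cod C f \<in> Obj C"
  by (auto intro: Dom_Obj Cod_Obj)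

lemma Comp_Id [simp]:
  assumes "f \<in> Arr C"
  shows "Cod C f = Y \<Longrightarrow> Id C Y \<cdot> f = f" "Dom C f = X \<Longrightarrow> f \<cdot> Id C X = f"
  using assms Id_left Id_right by (auto simp: Hom_iff)

lemma Comp_assoc' [simp]:
  assumes "f \<in> Arr C" "g \<in> Arr C" "h \<in> Arr C" "Dom C g = Cod C f" "Dom C h = Cod C g"
  shows "(h \<cdot> g) \<cdot> f = h \<cdot> (g \<cdot> f)"
  using assms Comp_assoc by (auto simp: Hom_iff)

text \<open>Composites are kept nested to the right, where \<open>a \<cdot> b\<close> is no subterm
  of \<open>a \<cdot> (b \<cdot> x)\<close>; this form lets a known equation for
  \<open>a \<cdot> b\<close> be applied there.\<close>

lemma Comp_reassoc:
  assumes "a \<cdot> b = c" "a \<in> Arr C" "b \<in> Arr C" "Dom C a = Cod C b" "x \<in> Arr C" "Cod C x = Dom C b"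
  shows "a \<cdot> (b \<cdot> x) = c \<cdot> x"
  using assms Comp_assoc' by metis

lemma inverse_arrow_props:
  assumes "isomorphism C f"
  shows "f \<in> Arr C" "inverse_arrow C f \<in> Arr C"
    "Dom C (inverse_arrow C f) = Cod C f" "Cod C (inverse_arrow C f) = Dom C f"
    "inverse_arrow C f \<cdot> f = Id C (Dom C f)" "f \<cdot> inverse_arrow C f = Id C (Cod C f)"
proof -
  obtain g where g: "inverse_pair C f g"
    using assms by (auto simp: isomorphism_def)
  have "h = g" if "inverse_pair C f h" for h
  proof -
    have "h = h \<cdot> (f \<cdot> g)"
      using g that by (auto simp: inverse_pair_def Hom_iff)
    also have "\<dots> = (h \<cdot> f) \<cdot> g"
      using g that by (intro Comp_assoc'[symmetric]) (auto simp: inverse_pair_def Hom_iff)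
    also have "\<dots> = g"
      using g that by (auto simp: inverse_pair_def Hom_iff)
    finally show ?thesis .
  qed
  then have "inverse_pair C f (inverse_arrow C f)"
    unfolding inverse_arrow_def using g by (metis theI)
  then show "f \<in> Arr C" "inverse_arrow C f \<in> Arr C"
    "Dom C (inverse_arrow C f) = Cod C f" "Cod C (inverse_arrow C f) = Dom C f"
    "inverse_arrow C f \<cdot> f = Id C (Dom C f)" "f \<cdot> inverse_arrow C f = Id C (Cod C f)"
    by (auto simp: inverse_pair_def Hom_iff)
qed

lemma iso_cancel_left:
  assumes "isomorphism C a" "a \<cdot> f = a \<cdot> g" "f \<in> Arr C" "g \<in> Arr C" "Cod C f = Dom C a" "Cod C g = Dom C a"
  shows "f = g"
proof -
  note [simp] = inverse_arrow_props[OF assms(1)]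
  have "inverse_arrow C a \<cdot> (a \<cdot> f) = f" "inverse_arrow C a \<cdot> (a \<cdot> g) = g"
    using assms(1,3-) by (simp_all flip: Comp_assoc')
  then show ?thesis
    using assms(2) by metis
qed

lemma iso_cancel_right:
  assumes "isomorphism C a" "f \<cdot> a = g \<cdot> a" "f \<in> Arr C" "g \<in> Arr C" "Dom C f = Cod C a" "Dom C g = Cod C a"
  shows "f = g"
proof -
  note [simp] = inverse_arrow_props[OF assms(1)]
  have "f = (f \<cdot> a) \<cdot> inverse_arrow C a"
    using assms(1,3-) by simp
  also have "\<dots> = g"
    unfolding assms(2) using assms(1,3-) by simp
  finally show ?thesis .
qed

end

context symmetric_monoidal_category
begin

abbreviation idt ("\<iota>") where "\<iota> X \<equiv> Id M X"
abbreviation lun ("\<ll>") where "\<ll> X \<equiv> Lunit M X"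
abbreviation run ("\<rr>") where "\<rr> X \<equiv> Runit M X"
abbreviation assoc_inv ("\<alpha>''") where "\<alpha>' X Y Z \<equiv> inverse_arrow M (\<alpha> X Y Z)"

lemma tensor_objects [simp]: "\<I> \<in> Obj M" "\<lbrakk>X \<in> Obj M; Y \<in> Obj M\<rbrakk> \<Longrightarrow> X \<boxtimes> Y \<in> Obj M"
  using unit_Obj tensor_Obj by auto

lemma tensor_arr [simp]:
  assumes "f \<in> Arr M" "g \<in> Arr M"
  shows "f \<otimes> g \<in> Arr M" "Dom M (f \<otimes> g) = Dom M f \<boxtimes> Dom M g" "Cod M (f \<otimes> g) = Cod M f \<boxtimes> Cod M g"
  using tensor_Hom[of f "Dom M f" "Cod M f" g "Dom M g" "Cod M g"] assms by (auto simp: Hom_iff)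

lemma Assoc_arr [simp]:
  assumes "X \<in> Obj M" "Y \<in> Obj M" "Z \<in> Obj M"
  shows "\<alpha> X Y Z \<in> Arr M" "Dom M (\<alpha> X Y Z) = (X \<boxtimes> Y) \<boxtimes> Z" "Cod M (\<alpha> X Y Z) = X \<boxtimes> (Y \<boxtimes> Z)"
    "\<alpha>' X Y Z \<in> Arr M" "Dom M (\<alpha>' X Y Z) = X \<boxtimes> (Y \<boxtimes> Z)" "Cod M (\<alpha>' X Y Z) = (X \<boxtimes> Y) \<boxtimes> Z"
    "\<alpha> X Y Z \<cdot> \<alpha>' X Y Z = \<iota> (X \<boxtimes> (Y \<boxtimes> Z))" "\<alpha>' X Y Z \<cdot> \<alpha> X Y Z = \<iota> ((X \<boxtimes> Y) \<boxtimes> Z)"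
  using Assoc_Hom[OF assms] inverse_arrow_props[OF Assoc_iso[OF assms]] by (auto simp: Hom_iff)

lemma unit_arr [simp]:
  assumes "X \<in> Obj M"
  shows "\<ll> X \<in> Arr M" "Dom M (\<ll> X) = \<I> \<boxtimes> X" "Cod M (\<ll> X) = X"
    "\<rr> X \<in> Arr M" "Dom M (\<rr> X) = X \<boxtimes> \<I>" "Cod M (\<rr> X) = X"
  using Lunit_Hom[OF assms] Runit_Hom[OF assms] by (auto simp: Hom_iff)

lemma Braid_arr [simp]:
  assumes "X \<in> Obj M" "Y \<in> Obj M"
  shows "\<sigma> X Y \<in> Arr M" "Dom M (\<sigma> X Y) = X \<boxtimes> Y" "Cod M (\<sigma> X Y) = Y \<boxtimes> X"
    "\<sigma> Y X \<cdot> \<sigma> X Y = \<iota> (X \<boxtimes> Y)"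
  using Braid_Hom[OF assms] symmetry[OF assms] by (auto simp: Hom_iff)

lemma tensor_Comp' [simp]:
  assumes "f \<in> Arr M" "f' \<in> Arr M" "g \<in> Arr M" "g' \<in> Arr M" "Dom M f' = Cod M f" "Dom M g' = Cod M g"
  shows "(f' \<otimes> g') \<cdot> (f \<otimes> g) = (f' \<cdot> f) \<otimes> (g' \<cdot> g)"
  using assms tensor_Comp[of f "Dom M f" "Cod M f" f' "Cod M f'" g "Dom M g" "Cod M g" g' "Cod M g'"]
  by (auto simp: Hom_iff)

lemma tensor_Comp'' [simp]:
  assumes "f \<in> Arr M" "f' \<in> Arr M" "g \<in> Arr M" "g' \<in> Arr M" "Dom M f' = Cod M f" "Dom M g' = Cod M g"
    "x \<in> Arr M" "Cod M x = Dom M f \<boxtimes> Dom M g"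
  shows "(f' \<otimes> g') \<cdot> ((f \<otimes> g) \<cdot> x) = ((f' \<cdot> f) \<otimes> (g' \<cdot> g)) \<cdot> x"
  using assms by (simp flip: tensor_Comp' Comp_assoc')

declare tensor_Id [simp]

lemma cancel_reassoc [simp]:
  assumes "X \<in> Obj M" "Y \<in> Obj M" "x \<in> Arr M"
  shows "Z \<in> Obj M \<Longrightarrow> Cod M x = X \<boxtimes> (Y \<boxtimes> Z) \<Longrightarrow> \<alpha> X Y Z \<cdot> (\<alpha>' X Y Z \<cdot> x) = x"
    "Z \<in> Obj M \<Longrightarrow> Cod M x = (X \<boxtimes> Y) \<boxtimes> Z \<Longrightarrow> \<alpha>' X Y Z \<cdot> (\<alpha> X Y Z \<cdot> x) = x"
    "Cod M x = X \<boxtimes> Y \<Longrightarrow> \<sigma> Y X \<cdot> (\<sigma> X Y \<cdot> x) = x"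
  using assms by (simp_all flip: Comp_assoc')

lemma natural:
  assumes "f \<in> Arr M" "Dom M f = X" "Cod M f = X'"
  shows "\<ll> X' \<cdot> (\<iota> \<I> \<otimes> f) = f \<cdot> \<ll> X" "\<rr> X' \<cdot> (f \<otimes> \<iota> \<I>) = f \<cdot> \<rr> X"
    "\<lbrakk>g \<in> Arr M; Dom M g = Y; Cod M g = Y'\<rbrakk> \<Longrightarrow> \<sigma> X' Y' \<cdot> (f \<otimes> g) = (g \<otimes> f) \<cdot> \<sigma> X Y"
    "\<lbrakk>g \<in> Arr M; Dom M g = Y; Cod M g = Y'; h \<in> Arr M; Dom M h = Z; Cod M h = Z'\<rbrakk>
      \<Longrightarrow> \<alpha> X' Y' Z' \<cdot> ((f \<otimes> g) \<otimes> h) = (f \<otimes> (g \<otimes> h)) \<cdot> \<alpha> X Y Z"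
  using assms Lunit_natural Runit_natural Braid_natural Assoc_natural by (auto simp: Hom_iff)

lemma Assoc_inv_natural:
  assumes "f \<in> Arr M" "Dom M f = X" "Cod M f = X'" "g \<in> Arr M" "Dom M g = Y" "Cod M g = Y'"
    "h \<in> Arr M" "Dom M h = Z" "Cod M h = Z'"
  shows "\<alpha>' X' Y' Z' \<cdot> (f \<otimes> (g \<otimes> h)) = ((f \<otimes> g) \<otimes> h) \<cdot> \<alpha>' X Y Z"
proof -
  have [simp]: "X \<in> Obj M" "Y \<in> Obj M" "Z \<in> Obj M" "X' \<in> Obj M" "Y' \<in> Obj M" "Z' \<in> Obj M"
    using assms by auto
  have "\<alpha>' X' Y' Z' \<cdot> (f \<otimes> (g \<otimes> h)) = \<alpha>' X' Y' Z' \<cdot> ((f \<otimes> (g \<otimes> h)) \<cdot> \<alpha> X Y Z) \<cdot> \<alpha>' X Y Z"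
    using assms by simp
  also have "\<dots> = ((f \<otimes> g) \<otimes> h) \<cdot> \<alpha>' X Y Z"
    using assms by (simp flip: natural)
  finally show ?thesis .
qed

text \<open>Tensoring with the unit is naturally isomorphic to the identity functor through the
  unitors, hence faithful. Identities about unitors can thus be checked after adding a unit factor,
  where pentagon, triangle and hexagon apply.\<close>

lemma unit_faithful:
  assumes "f \<in> Arr M" "g \<in> Arr M" "Dom M f = Dom M g" "Cod M f = Cod M g"
  shows "\<iota> \<I> \<otimes> f = \<iota> \<I> \<otimes> g \<Longrightarrow> f = g" "f \<otimes> \<iota> \<I> = g \<otimes> \<iota> \<I> \<Longrightarrow> f = g"
proof -
  show "f = g" if eq: "\<iota> \<I> \<otimes> f = \<iota> \<I> \<otimes> g"
  proof (rule iso_cancel_right[OF Lunit_iso[of "Dom M f"]])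
    show "f \<cdot> \<ll> (Dom M f) = g \<cdot> \<ll> (Dom M f)"
      using natural(1)[of f] natural(1)[of g] assms eq by metis
  qed (use assms in simp_all)
  show "f = g" if eq: "f \<otimes> \<iota> \<I> = g \<otimes> \<iota> \<I>"
  proof (rule iso_cancel_right[OF Runit_iso[of "Dom M f"]])
    show "f \<cdot> \<rr> (Dom M f) = g \<cdot> \<rr> (Dom M f)"
      using natural(2)[of f] natural(2)[of g] assms eq by metis
  qed (use assms in simp_all)
qed

section \<open>Coherence for units and for transpositions\<close>

text \<open>A right inverse makes \<open>a\<close> cancellable. In the uses, \<open>a\<close> is an
  invertible structure arrow or composite and \<open>b\<close> its inverse written out, which is
  easier to verify than an abstract isomorphism property.\<close>

lemma epi_cancel:
  assumes "f \<cdot> a = g \<cdot> a" "a \<cdot> b = \<iota> Y" "Y \<in> Obj M" "a \<in> Arr M" "b \<in> Arr M" "Cod M a = Y" "Dom M a = Cod M b"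
    "f \<in> Arr M" "g \<in> Arr M" "Dom M f = Y" "Dom M g = Y"
  shows "f = g"
proof -
  have "f = (f \<cdot> a) \<cdot> b"
    using assms(2-) by simp
  also have "\<dots> = g"
    unfolding assms(1) using assms(2-) by simp
  finally show ?thesis .
qed

lemma Assoc_natural_Id:
  assumes "X \<in> Obj M" "Y \<in> Obj M" "f \<in> Arr M" "Dom M f = Z" "Cod M f = Z'"
  shows "\<alpha> X Y Z' \<cdot> (\<iota> (X \<boxtimes> Y) \<otimes> f) = (\<iota> X \<otimes> (\<iota> Y \<otimes> f)) \<cdot> \<alpha> X Y Z"
    "\<alpha> Z' X Y \<cdot> ((f \<otimes> \<iota> X) \<otimes> \<iota> Y) = (f \<otimes> \<iota> (X \<boxtimes> Y)) \<cdot> \<alpha> Z X Y"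
  using assms natural(4)[of "\<iota> X" X X "\<iota> Y" Y Y f] natural(4)[of f Z Z' "\<iota> X" X X "\<iota> Y" Y Y] by auto

text \<open>The triangle axiom only treats a unit in the middle. With a further unit factor on the
  left, the pentagon for \<I>, \<I>, \<open>X\<close>, \<open>Y\<close> links two instances of the
  triangle, and the extra factor is then removed by faithfulness.\<close>

lemma Lunit_tensor:
  assumes [simp]: "X \<in> Obj M" "Y \<in> Obj M"
  shows "\<ll> (X \<boxtimes> Y) \<cdot> \<alpha> \<I> X Y = \<ll> X \<otimes> \<iota> Y"
proof (rule unit_faithful(1))
  \<comment> \<open>The first two arrows of the three-arrow side of that pentagon; composing with
    them completes this side.\<close>
  let ?a = "\<alpha> \<I> (\<I> \<boxtimes> X) Y \<cdot> (\<alpha> \<I> \<I> X \<otimes> \<iota> Y)"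
  show "\<iota> \<I> \<otimes> (\<ll> (X \<boxtimes> Y) \<cdot> \<alpha> \<I> X Y) = \<iota> \<I> \<otimes> (\<ll> X \<otimes> \<iota> Y)"
  proof (rule epi_cancel)
    have "(\<iota> \<I> \<otimes> (\<ll> (X \<boxtimes> Y) \<cdot> \<alpha> \<I> X Y)) \<cdot> ?a = (\<iota> \<I> \<otimes> \<ll> (X \<boxtimes> Y)) \<cdot> (\<alpha> \<I> \<I> (X \<boxtimes> Y) \<cdot> \<alpha> (\<I> \<boxtimes> \<I>) X Y)"
      by (simp add: pentagon)
    also have "\<dots> = (\<rr> \<I> \<otimes> \<iota> (X \<boxtimes> Y)) \<cdot> \<alpha> (\<I> \<boxtimes> \<I>) X Y"
      by (simp flip: triangle)
    also have "\<dots> = \<alpha> \<I> X Y \<cdot> ((\<rr> \<I> \<otimes> \<iota> X) \<otimes> \<iota> Y)"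
      by (simp add: Assoc_natural_Id)
    also have "\<dots> = \<alpha> \<I> X Y \<cdot> (((\<iota> \<I> \<otimes> \<ll> X) \<otimes> \<iota> Y) \<cdot> (\<alpha> \<I> \<I> X \<otimes> \<iota> Y))"
      by (simp add: triangle)
    also have "\<dots> = (\<iota> \<I> \<otimes> (\<ll> X \<otimes> \<iota> Y)) \<cdot> ?a"
      by (subst Comp_assoc'[symmetric]) (simp_all add: natural del: tensor_Comp')
    finally show "(\<iota> \<I> \<otimes> (\<ll> (X \<boxtimes> Y) \<cdot> \<alpha> \<I> X Y)) \<cdot> ?a = (\<iota> \<I> \<otimes> (\<ll> X \<otimes> \<iota> Y)) \<cdot> ?a" .
    show "?a \<cdot> ((\<alpha>' \<I> \<I> X \<otimes> \<iota> Y) \<cdot> \<alpha>' \<I> (\<I> \<boxtimes> X) Y) = \<iota> (\<I> \<boxtimes> ((\<I> \<boxtimes> X) \<boxtimes> Y))"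
      by simp
  qed simp_all
qed simp_all

text \<open>Mirror image of \<open>Lunit_tensor\<close>: the extra unit factor goes to the right,
  and the pentagon is the one for \<open>X\<close>, \<open>Y\<close>, \<I>, \<I>.\<close>

lemma Runit_tensor:
  assumes [simp]: "X \<in> Obj M" "Y \<in> Obj M"
  shows "(\<iota> X \<otimes> \<rr> Y) \<cdot> \<alpha> X Y \<I> = \<rr> (X \<boxtimes> Y)"
proof (rule unit_faithful(2))
  have "\<alpha> X Y \<I> \<cdot> (((\<iota> X \<otimes> \<rr> Y) \<cdot> \<alpha> X Y \<I>) \<otimes> \<iota> \<I>) = \<alpha> X Y \<I> \<cdot> ((\<iota> X \<otimes> \<rr> Y) \<otimes> \<iota> \<I>) \<cdot> (\<alpha> X Y \<I> \<otimes> \<iota> \<I>)"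
    by simp
  also have "\<dots> = (\<iota> X \<otimes> (\<rr> Y \<otimes> \<iota> \<I>)) \<cdot> \<alpha> X (Y \<boxtimes> \<I>) \<I> \<cdot> (\<alpha> X Y \<I> \<otimes> \<iota> \<I>)"
    by (subst Comp_assoc'[symmetric]) (simp_all add: natural del: tensor_Comp')
  also have "\<dots> = (\<iota> X \<otimes> (\<iota> Y \<otimes> \<ll> \<I>)) \<cdot> \<alpha> X Y (\<I> \<boxtimes> \<I>) \<cdot> \<alpha> (X \<boxtimes> Y) \<I> \<I>"
    by (simp add: pentagon flip: triangle)
  also have "\<dots> = \<alpha> X Y \<I> \<cdot> ((\<iota> (X \<boxtimes> Y) \<otimes> \<ll> \<I>) \<cdot> \<alpha> (X \<boxtimes> Y) \<I> \<I>)"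
    by (subst (1 2) Comp_assoc'[symmetric]) (simp_all add: Assoc_natural_Id)
  also have "\<dots> = \<alpha> X Y \<I> \<cdot> (\<rr> (X \<boxtimes> Y) \<otimes> \<iota> \<I>)"
    by (simp add: triangle)
  finally show "((\<iota> X \<otimes> \<rr> Y) \<cdot> \<alpha> X Y \<I>) \<otimes> \<iota> \<I> = \<rr> (X \<boxtimes> Y) \<otimes> \<iota> \<I>"
    by (rule iso_cancel_left[OF Assoc_iso, rotated 3]) simp_all
qed simp_all

text \<open>Naturality of the left unitor at the arrow \<open>\<ll> X\<close> itself; the common
  factor \<open>\<ll> X\<close> is then cancelled.\<close>

lemma Lunit_Lunit:
  assumes [simp]: "X \<in> Obj M"
  shows "\<iota> \<I> \<otimes> \<ll> X = \<ll> (\<I> \<boxtimes> X)"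
  by (rule iso_cancel_left[OF Lunit_iso[of X]]) (simp_all add: natural)

text \<open>After tensoring with \<I> on the right, \<open>\<rr> \<I>\<close> becomes one side of
  the triangle and \<open>\<ll> \<I>\<close> one side of \<open>Lunit_tensor\<close>;
  \<open>Lunit_Lunit\<close> identifies the other sides.\<close>

lemma Lunit_Runit_unit: "\<rr> \<I> = \<ll> \<I>"
  by (rule unit_faithful(2)) (simp_all add: Lunit_Lunit Lunit_tensor flip: triangle)

text \<open>Compatibility of the symmetry with the unit is no axiom here. It comes from the hexagon
  for \<open>X\<close>, \<I>, \<I>, whose middle arrow is controlled by naturality of the symmetry
  at \<open>\<rr> \<I>\<close>.\<close>

lemma Lunit_Braid:
  assumes [simp]: "X \<in> Obj M"
  shows "\<ll> X \<cdot> \<sigma> X \<I> = \<rr> X"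
proof (rule unit_faithful(1))
  let ?a = "\<alpha> \<I> X \<I> \<cdot> (\<sigma> X \<I> \<otimes> \<iota> \<I>)"
  show "\<iota> \<I> \<otimes> (\<ll> X \<cdot> \<sigma> X \<I>) = \<iota> \<I> \<otimes> \<rr> X"
  proof (rule epi_cancel)
    have "(\<iota> \<I> \<otimes> (\<ll> X \<cdot> \<sigma> X \<I>)) \<cdot> ?a = (\<iota> \<I> \<otimes> \<ll> X) \<cdot> (\<alpha> \<I> \<I> X \<cdot> \<sigma> X (\<I> \<boxtimes> \<I>) \<cdot> \<alpha> X \<I> \<I>)"
      by (simp add: hexagon)
    also have "\<dots> = ((\<rr> \<I> \<otimes> \<iota> X) \<cdot> \<sigma> X (\<I> \<boxtimes> \<I>)) \<cdot> \<alpha> X \<I> \<I>"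
      by (simp flip: triangle)
    also have "(\<rr> \<I> \<otimes> \<iota> X) \<cdot> \<sigma> X (\<I> \<boxtimes> \<I>) = \<sigma> X \<I> \<cdot> (\<iota> X \<otimes> \<rr> \<I>)"
      by (simp add: natural)
    also have "(\<sigma> X \<I> \<cdot> (\<iota> X \<otimes> \<rr> \<I>)) \<cdot> \<alpha> X \<I> \<I> = \<sigma> X \<I> \<cdot> \<rr> (X \<boxtimes> \<I>)"
      by (simp add: Runit_tensor)
    also have "\<dots> = \<rr> (\<I> \<boxtimes> X) \<cdot> (\<sigma> X \<I> \<otimes> \<iota> \<I>)"
      by (simp add: natural)
    also have "\<dots> = (\<iota> \<I> \<otimes> \<rr> X) \<cdot> ?a"
      by (simp flip: Runit_tensor)
    finally show "(\<iota> \<I> \<otimes> (\<ll> X \<cdot> \<sigma> X \<I>)) \<cdot> ?a = (\<iota> \<I> \<otimes> \<rr> X) \<cdot> ?a" .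
    show "?a \<cdot> ((\<sigma> \<I> X \<otimes> \<iota> \<I>) \<cdot> \<alpha>' \<I> X \<I>) = \<iota> (\<I> \<boxtimes> (X \<boxtimes> \<I>))"
      by simp
  qed simp_all
qed simp_all

lemma Braid_unit_unit: "\<sigma> \<I> \<I> = \<iota> (\<I> \<boxtimes> \<I>)"
  by (rule iso_cancel_left[OF Lunit_iso[of \<I>]]) (simp_all add: Lunit_Braid Lunit_Runit_unit)

lemma Runit_Braid:
  assumes [simp]: "X \<in> Obj M"
  shows "\<rr> X \<cdot> \<sigma> \<I> X = \<ll> X"
  by (simp flip: Lunit_Braid)

text \<open>\<open>\<alpha> W Y (X \<boxtimes> Z) \<cdot> interchange M W X Y Z = (\<iota> W \<otimes> \<beta> X Y Z) \<cdot> \<alpha> W X (Y \<boxtimes> Z)\<close>, so statements about the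
  interchange reduce to statements about transpositions of adjacent factors of right-nested products.\<close>

definition swap ("\<beta>") where
  "\<beta> X Y Z = \<alpha> Y X Z \<cdot> (\<sigma> X Y \<otimes> \<iota> Z) \<cdot> \<alpha>' X Y Z"

lemma swap_arr [simp]:
  assumes "X \<in> Obj M" "Y \<in> Obj M" "Z \<in> Obj M"
  shows "\<beta> X Y Z \<in> Arr M" "Dom M (\<beta> X Y Z) = X \<boxtimes> (Y \<boxtimes> Z)" "Cod M (\<beta> X Y Z) = Y \<boxtimes> (X \<boxtimes> Z)"
    "\<beta> Y X Z \<cdot> \<beta> X Y Z = \<iota> (X \<boxtimes> (Y \<boxtimes> Z))"
  using assms by (simp_all add: swap_def)

lemma swap_swap [simp]:
  assumes "X \<in> Obj M" "Y \<in> Obj M" "Z \<in> Obj M" "x \<in> Arr M" "Cod M x = X \<boxtimes> (Y \<boxtimes> Z)"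
  shows "\<beta> Y X Z \<cdot> (\<beta> X Y Z \<cdot> x) = x"
  using assms by (simp flip: Comp_assoc')

lemma swap_Assoc:
  assumes "X \<in> Obj M" "Y \<in> Obj M" "Z \<in> Obj M"
  shows "\<beta> X Y Z \<cdot> \<alpha> X Y Z = \<alpha> Y X Z \<cdot> (\<sigma> X Y \<otimes> \<iota> Z)"
  using assms by (simp add: swap_def)

lemma swap_natural:
  assumes "f \<in> Arr M" "Dom M f = X" "Cod M f = X'" "g \<in> Arr M" "Dom M g = Y" "Cod M g = Y'"
    "h \<in> Arr M" "Dom M h = Z" "Cod M h = Z'"
  shows "\<beta> X' Y' Z' \<cdot> (f \<otimes> (g \<otimes> h)) = (g \<otimes> (f \<otimes> h)) \<cdot> \<beta> X Y Z"
proof -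
  have [simp]: "X \<in> Obj M" "Y \<in> Obj M" "Z \<in> Obj M" "X' \<in> Obj M" "Y' \<in> Obj M" "Z' \<in> Obj M"
    using assms by auto
  have "\<beta> X' Y' Z' \<cdot> (f \<otimes> (g \<otimes> h)) = \<alpha> Y' X' Z' \<cdot> ((\<sigma> X' Y' \<cdot> (f \<otimes> g)) \<otimes> h) \<cdot> \<alpha>' X Y Z"
    using assms by (simp add: swap_def Assoc_inv_natural)
  also have "\<dots> = (\<alpha> Y' X' Z' \<cdot> ((g \<otimes> f) \<otimes> h)) \<cdot> (\<sigma> X Y \<otimes> \<iota> Z) \<cdot> \<alpha>' X Y Z"
    using assms by (simp add: natural(3))
  also have "\<dots> = (g \<otimes> (f \<otimes> h)) \<cdot> \<beta> X Y Z"
    using assms by (simp only: natural) (simp add: swap_def)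
  finally show ?thesis .
qed

text \<open>The last factor takes no part in the transposition, so splitting it off is a matter of
  two pentagons and naturality.\<close>

lemma swap_tensor_right:
  assumes [simp]: "X \<in> Obj M" "Y \<in> Obj M" "Z \<in> Obj M" "T \<in> Obj M"
  shows "\<beta> X Y (Z \<boxtimes> T) \<cdot> (\<iota> X \<otimes> \<alpha> Y Z T) \<cdot> \<alpha> X (Y \<boxtimes> Z) T = (\<iota> Y \<otimes> \<alpha> X Z T) \<cdot> \<alpha> Y (X \<boxtimes> Z) T \<cdot> (\<beta> X Y Z \<otimes> \<iota> T)"
proof (rule epi_cancel)
  have "(\<beta> X Y (Z \<boxtimes> T) \<cdot> (\<iota> X \<otimes> \<alpha> Y Z T) \<cdot> \<alpha> X (Y \<boxtimes> Z) T) \<cdot> (\<alpha> X Y Z \<otimes> \<iota> T)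
      = (\<beta> X Y (Z \<boxtimes> T) \<cdot> \<alpha> X Y (Z \<boxtimes> T)) \<cdot> \<alpha> (X \<boxtimes> Y) Z T"
    by (simp add: pentagon)
  also have "\<dots> = \<alpha> Y X (Z \<boxtimes> T) \<cdot> \<alpha> (Y \<boxtimes> X) Z T \<cdot> ((\<sigma> X Y \<otimes> \<iota> Z) \<otimes> \<iota> T)"
    by (simp add: swap_Assoc Assoc_natural_Id)
  also have "\<dots> = (\<alpha> Y X (Z \<boxtimes> T) \<cdot> \<alpha> (Y \<boxtimes> X) Z T) \<cdot> ((\<sigma> X Y \<otimes> \<iota> Z) \<otimes> \<iota> T)"
    by (subst Comp_assoc') simp_all
  also have "\<dots> = ((\<iota> Y \<otimes> \<alpha> X Z T) \<cdot> \<alpha> Y (X \<boxtimes> Z) T \<cdot> (\<beta> X Y Z \<otimes> \<iota> T)) \<cdot> (\<alpha> X Y Z \<otimes> \<iota> T)"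
    by (simp add: pentagon swap_Assoc)
  finally show "(\<beta> X Y (Z \<boxtimes> T) \<cdot> (\<iota> X \<otimes> \<alpha> Y Z T) \<cdot> \<alpha> X (Y \<boxtimes> Z) T) \<cdot> (\<alpha> X Y Z \<otimes> \<iota> T) =
    ((\<iota> Y \<otimes> \<alpha> X Z T) \<cdot> \<alpha> Y (X \<boxtimes> Z) T \<cdot> (\<beta> X Y Z \<otimes> \<iota> T)) \<cdot> (\<alpha> X Y Z \<otimes> \<iota> T)" .
  show "(\<alpha> X Y Z \<otimes> \<iota> T) \<cdot> (\<alpha>' X Y Z \<otimes> \<iota> T) = \<iota> ((X \<boxtimes> (Y \<boxtimes> Z)) \<boxtimes> T)"
    by simp
qed simp_all

text \<open>The hexagon in transposition form: \<open>X\<close> passes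
  \<open>Y \<boxtimes> Y'\<close> by passing \<open>Y\<close> and then \<open>Y'\<close>. Pentagons
  only bring the hexagon into position beside the spectator \<open>Z\<close>.\<close>

lemma swap_tensor_middle:
  assumes [simp]: "X \<in> Obj M" "Y \<in> Obj M" "Y' \<in> Obj M" "Z \<in> Obj M"
  shows "\<alpha> Y Y' (X \<boxtimes> Z) \<cdot> \<beta> X (Y \<boxtimes> Y') Z = (\<iota> Y \<otimes> \<beta> X Y' Z) \<cdot> \<beta> X Y (Y' \<boxtimes> Z) \<cdot> (\<iota> X \<otimes> \<alpha> Y Y' Z)"
proof (rule epi_cancel)
  let ?a = "\<alpha> X (Y \<boxtimes> Y') Z \<cdot> (\<alpha> X Y Y' \<otimes> \<iota> Z)"
  have "(\<alpha> Y Y' (X \<boxtimes> Z) \<cdot> \<beta> X (Y \<boxtimes> Y') Z) \<cdot> ?a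
      = \<alpha> Y Y' (X \<boxtimes> Z) \<cdot> (\<beta> X (Y \<boxtimes> Y') Z \<cdot> \<alpha> X (Y \<boxtimes> Y') Z) \<cdot> (\<alpha> X Y Y' \<otimes> \<iota> Z)"
    by simp
  also have "\<dots> = (\<alpha> Y Y' (X \<boxtimes> Z) \<cdot> \<alpha> (Y \<boxtimes> Y') X Z) \<cdot> ((\<sigma> X (Y \<boxtimes> Y') \<cdot> \<alpha> X Y Y') \<otimes> \<iota> Z)"
    unfolding swap_Assoc[OF assms(1) tensor_objects(2)[OF assms(2,3)] assms(4)] by simp
  also have "\<dots> = (\<iota> Y \<otimes> \<alpha> Y' X Z) \<cdot> \<alpha> Y (Y' \<boxtimes> X) Z \<cdot> ((\<alpha> Y Y' X \<cdot> \<sigma> X (Y \<boxtimes> Y') \<cdot> \<alpha> X Y Y') \<otimes> \<iota> Z)"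
    by (simp add: pentagon)
  also have "\<dots> = (\<iota> Y \<otimes> \<alpha> Y' X Z) \<cdot> (\<alpha> Y (Y' \<boxtimes> X) Z \<cdot> ((\<iota> Y \<otimes> \<sigma> X Y') \<otimes> \<iota> Z)) \<cdot> ((\<alpha> Y X Y' \<cdot> (\<sigma> X Y \<otimes> \<iota> Y')) \<otimes> \<iota> Z)"
    by (simp add: hexagon)
  also have "\<dots> = (\<iota> Y \<otimes> (\<alpha> Y' X Z \<cdot> (\<sigma> X Y' \<otimes> \<iota> Z))) \<cdot> \<alpha> Y (X \<boxtimes> Y') Z \<cdot> ((\<alpha> Y X Y' \<cdot> (\<sigma> X Y \<otimes> \<iota> Y')) \<otimes> \<iota> Z)"
    by (simp add: natural)
  also have "\<dots> = (\<iota> Y \<otimes> \<beta> X Y' Z) \<cdot> ((\<iota> Y \<otimes> \<alpha> X Y' Z) \<cdot> \<alpha> Y (X \<boxtimes> Y') Z \<cdot> (\<alpha> Y X Y' \<otimes> \<iota> Z)) \<cdot> ((\<sigma> X Y \<otimes> \<iota> Y') \<otimes> \<iota> Z)"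
    by (simp add: swap_Assoc)
  also have "\<dots> = (\<iota> Y \<otimes> \<beta> X Y' Z) \<cdot> \<alpha> Y X (Y' \<boxtimes> Z) \<cdot> (\<alpha> (Y \<boxtimes> X) Y' Z \<cdot> ((\<sigma> X Y \<otimes> \<iota> Y') \<otimes> \<iota> Z))"
    by (subst pentagon[symmetric]) simp_all
  also have "\<dots> = (\<iota> Y \<otimes> \<beta> X Y' Z) \<cdot> (\<beta> X Y (Y' \<boxtimes> Z) \<cdot> \<alpha> X Y (Y' \<boxtimes> Z)) \<cdot> \<alpha> (X \<boxtimes> Y) Y' Z"
    by (simp add: Assoc_natural_Id swap_Assoc)
  also have "\<dots> = (\<iota> Y \<otimes> \<beta> X Y' Z) \<cdot> \<beta> X Y (Y' \<boxtimes> Z) \<cdot> (\<alpha> X Y (Y' \<boxtimes> Z) \<cdot> \<alpha> (X \<boxtimes> Y) Y' Z)"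
    by simp
  also have "\<dots> = ((\<iota> Y \<otimes> \<beta> X Y' Z) \<cdot> \<beta> X Y (Y' \<boxtimes> Z) \<cdot> (\<iota> X \<otimes> \<alpha> Y Y' Z)) \<cdot> ?a"
    by (simp add: pentagon)
  finally show "(\<alpha> Y Y' (X \<boxtimes> Z) \<cdot> \<beta> X (Y \<boxtimes> Y') Z) \<cdot> ?a =
    ((\<iota> Y \<otimes> \<beta> X Y' Z) \<cdot> \<beta> X Y (Y' \<boxtimes> Z) \<cdot> (\<iota> X \<otimes> \<alpha> Y Y' Z)) \<cdot> ?a" .
  show "?a \<cdot> ((\<alpha>' X Y Y' \<otimes> \<iota> Z) \<cdot> \<alpha>' X (Y \<boxtimes> Y') Z) = \<iota> (X \<boxtimes> ((Y \<boxtimes> Y') \<boxtimes> Z))"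
    by simp
qed simp_all

text \<open>The second hexagon of a braided category. By symmetry,
  \<open>\<beta> Y (X \<boxtimes> X') Z\<close> is inverse to the transposition in question, so this
  is \<open>swap_tensor_middle\<close> inverted.\<close>

lemma swap_tensor_left:
  assumes [simp]: "X \<in> Obj M" "X' \<in> Obj M" "Y \<in> Obj M" "Z \<in> Obj M"
  shows "(\<iota> Y \<otimes> \<alpha> X X' Z) \<cdot> \<beta> (X \<boxtimes> X') Y Z = \<beta> X Y (X' \<boxtimes> Z) \<cdot> (\<iota> X \<otimes> \<beta> X' Y Z) \<cdot> \<alpha> X X' (Y \<boxtimes> Z)"
proof (rule epi_cancel)
  show "((\<iota> Y \<otimes> \<alpha> X X' Z) \<cdot> \<beta> (X \<boxtimes> X') Y Z) \<cdot> \<beta> Y (X \<boxtimes> X') Z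
    = (\<beta> X Y (X' \<boxtimes> Z) \<cdot> (\<iota> X \<otimes> \<beta> X' Y Z) \<cdot> \<alpha> X X' (Y \<boxtimes> Z)) \<cdot> \<beta> Y (X \<boxtimes> X') Z"
    by (simp add: swap_tensor_middle)
  show "\<beta> Y (X \<boxtimes> X') Z \<cdot> \<beta> (X \<boxtimes> X') Y Z = \<iota> ((X \<boxtimes> X') \<boxtimes> (Y \<boxtimes> Z))"
    by simp
qed simp_all

lemma Braid_tensor_right:
  assumes "X \<in> Obj M" "Y \<in> Obj M" "Z \<in> Obj M"
  shows "\<alpha> Y Z X \<cdot> \<sigma> X (Y \<boxtimes> Z) = (\<iota> Y \<otimes> \<sigma> X Z) \<cdot> \<beta> X Y Z"
proof (rule epi_cancel)
  show "(\<alpha> Y Z X \<cdot> \<sigma> X (Y \<boxtimes> Z)) \<cdot> \<alpha> X Y Z = ((\<iota> Y \<otimes> \<sigma> X Z) \<cdot> \<beta> X Y Z) \<cdot> \<alpha> X Y Z"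
    using assms by (simp add: hexagon swap_Assoc)
  show "\<alpha> X Y Z \<cdot> \<alpha>' X Y Z = \<iota> (X \<boxtimes> (Y \<boxtimes> Z))"
    using assms by simp
qed (use assms in simp_all)

lemma Braid_tensor_left:
  assumes [simp]: "X \<in> Obj M" "Y \<in> Obj M" "Z \<in> Obj M"
  shows "\<sigma> (X \<boxtimes> Y) Z = \<beta> X Z Y \<cdot> (\<iota> X \<otimes> \<sigma> Y Z) \<cdot> \<alpha> X Y Z"
proof (rule epi_cancel)
  show "\<sigma> (X \<boxtimes> Y) Z \<cdot> \<sigma> Z (X \<boxtimes> Y) = (\<beta> X Z Y \<cdot> (\<iota> X \<otimes> \<sigma> Y Z) \<cdot> \<alpha> X Y Z) \<cdot> \<sigma> Z (X \<boxtimes> Y)"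
    by (simp add: Braid_tensor_right)
  show "\<sigma> Z (X \<boxtimes> Y) \<cdot> \<sigma> (X \<boxtimes> Y) Z = \<iota> ((X \<boxtimes> Y) \<boxtimes> Z)"
    by simp
qed simp_all

lemma Lunit_swap:
  assumes [simp]: "X \<in> Obj M" "Y \<in> Obj M"
  shows "\<ll> (X \<boxtimes> Y) \<cdot> \<beta> X \<I> Y = \<iota> X \<otimes> \<ll> Y"
proof (rule epi_cancel)
  have "(\<ll> (X \<boxtimes> Y) \<cdot> \<beta> X \<I> Y) \<cdot> \<alpha> X \<I> Y = (\<ll> (X \<boxtimes> Y) \<cdot> \<alpha> \<I> X Y) \<cdot> (\<sigma> X \<I> \<otimes> \<iota> Y)"
    by (simp add: swap_Assoc)
  also have "\<dots> = (\<iota> X \<otimes> \<ll> Y) \<cdot> \<alpha> X \<I> Y"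
    unfolding Lunit_tensor[OF assms] by (simp add: Lunit_Braid triangle)
  finally show "(\<ll> (X \<boxtimes> Y) \<cdot> \<beta> X \<I> Y) \<cdot> \<alpha> X \<I> Y = (\<iota> X \<otimes> \<ll> Y) \<cdot> \<alpha> X \<I> Y" .
  show "\<alpha> X \<I> Y \<cdot> \<alpha>' X \<I> Y = \<iota> (X \<boxtimes> (\<I> \<boxtimes> Y))"
    by simp
qed simp_all

section \<open>Coherence for the interchange\<close>

lemma mono_cancel:
  assumes "a \<cdot> f = a \<cdot> g" "b \<cdot> a = \<iota> Y" "Y \<in> Obj M" "a \<in> Arr M" "b \<in> Arr M" "Dom M a = Y" "Cod M a = Dom M b"
    "f \<in> Arr M" "g \<in> Arr M" "Cod M f = Y" "Cod M g = Y"
  shows "f = g"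
proof -
  have "f = b \<cdot> (a \<cdot> f)"
    using assms(2-) by (simp flip: Comp_assoc')
  also have "\<dots> = g"
    unfolding assms(1) using assms(2-) by (simp flip: Comp_assoc')
  finally show ?thesis .
qed

abbreviation tau ("\<tau>") where "\<tau> W X Y Z \<equiv> interchange M W X Y Z"

lemma interchange_arr [simp]:
  assumes "W \<in> Obj M" "X \<in> Obj M" "Y \<in> Obj M" "Z \<in> Obj M"
  shows "\<tau> W X Y Z \<in> Arr M" "Dom M (\<tau> W X Y Z) = (W \<boxtimes> X) \<boxtimes> (Y \<boxtimes> Z)" "Cod M (\<tau> W X Y Z) = (W \<boxtimes> Y) \<boxtimes> (X \<boxtimes> Z)"
  using assms by (simp_all add: interchange_def)

lemma Assoc_interchange:
  assumes "W \<in> Obj M" "X \<in> Obj M" "Y \<in> Obj M" "Z \<in> Obj M"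
  shows "\<alpha> W Y (X \<boxtimes> Z) \<cdot> \<tau> W X Y Z = (\<iota> W \<otimes> \<beta> X Y Z) \<cdot> \<alpha> W X (Y \<boxtimes> Z)"
  using assms by (simp add: interchange_def swap_def)

lemma interchange_natural:
  assumes f: "f \<in> Arr M" "Dom M f = W" "Cod M f = W'" and g: "g \<in> Arr M" "Dom M g = X" "Cod M g = X'"
    and h: "h \<in> Arr M" "Dom M h = Y" "Cod M h = Y'" and k: "k \<in> Arr M" "Dom M k = Z" "Cod M k = Z'"
  shows "\<tau> W' X' Y' Z' \<cdot> ((f \<otimes> g) \<otimes> (h \<otimes> k)) = ((f \<otimes> h) \<otimes> (g \<otimes> k)) \<cdot> \<tau> W X Y Z"
proof -
  have [simp]: "W \<in> Obj M" "X \<in> Obj M" "Y \<in> Obj M" "Z \<in> Obj M" "W' \<in> Obj M" "X' \<in> Obj M" "Y' \<in> Obj M" "Z' \<in> Obj M"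
    using assms by auto
  note [simp] = f g h k
  have "\<alpha> W' Y' (X' \<boxtimes> Z') \<cdot> (\<tau> W' X' Y' Z' \<cdot> ((f \<otimes> g) \<otimes> (h \<otimes> k)))
    = (\<iota> W' \<otimes> \<beta> X' Y' Z') \<cdot> (\<alpha> W' X' (Y' \<boxtimes> Z') \<cdot> ((f \<otimes> g) \<otimes> (h \<otimes> k)))"
    by (subst Comp_reassoc[OF Assoc_interchange]) simp_all
  also have "\<dots> = (f \<otimes> (\<beta> X' Y' Z' \<cdot> (g \<otimes> (h \<otimes> k)))) \<cdot> \<alpha> W X (Y \<boxtimes> Z)"
    by (simp add: natural)
  also have "\<dots> = (f \<otimes> (h \<otimes> (g \<otimes> k))) \<cdot> (\<alpha> W Y (X \<boxtimes> Z) \<cdot> \<tau> W X Y Z)"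
    by (simp add: swap_natural Assoc_interchange)
  also have "\<dots> = (\<alpha> W' Y' (X' \<boxtimes> Z') \<cdot> ((f \<otimes> h) \<otimes> (g \<otimes> k))) \<cdot> \<tau> W X Y Z"
    by (simp add: natural)
  also have "\<dots> = \<alpha> W' Y' (X' \<boxtimes> Z') \<cdot> (((f \<otimes> h) \<otimes> (g \<otimes> k)) \<cdot> \<tau> W X Y Z)"
    by simp
  finally show ?thesis
    by (rule iso_cancel_left[OF Assoc_iso, rotated 3]) simp_all
qed

text \<open>The associativity coherence of the tensor product as a monoidal functor of two
  variables: there are two ways to turn three \<open>X\<close> factors followed by three
  \<open>Y\<close> factors into three pairs. Coassociativity of a tensor product of comonoids rests
  on it.\<close>

lemma Assoc_interchange_interchange:
  assumes [simp]: "X\<^sub>1 \<in> Obj M" "X\<^sub>2 \<in> Obj M" "X\<^sub>3 \<in> Obj M" "Y\<^sub>1 \<in> Obj M" "Y\<^sub>2 \<in> Obj M" "Y\<^sub>3 \<in> Obj M"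
  shows "\<alpha> (X\<^sub>1 \<boxtimes> Y\<^sub>1) (X\<^sub>2 \<boxtimes> Y\<^sub>2) (X\<^sub>3 \<boxtimes> Y\<^sub>3) \<cdot> (\<tau> X\<^sub>1 X\<^sub>2 Y\<^sub>1 Y\<^sub>2 \<otimes> \<iota> (X\<^sub>3 \<boxtimes> Y\<^sub>3)) \<cdot> \<tau> (X\<^sub>1 \<boxtimes> X\<^sub>2) X\<^sub>3 (Y\<^sub>1 \<boxtimes> Y\<^sub>2) Y\<^sub>3
    = (\<iota> (X\<^sub>1 \<boxtimes> Y\<^sub>1) \<otimes> \<tau> X\<^sub>2 X\<^sub>3 Y\<^sub>2 Y\<^sub>3) \<cdot> \<tau> X\<^sub>1 (X\<^sub>2 \<boxtimes> X\<^sub>3) Y\<^sub>1 (Y\<^sub>2 \<boxtimes> Y\<^sub>3) \<cdot> (\<alpha> X\<^sub>1 X\<^sub>2 X\<^sub>3 \<otimes> \<alpha> Y\<^sub>1 Y\<^sub>2 Y\<^sub>3)"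
proof (rule mono_cancel)
  let ?T = "X\<^sub>3 \<boxtimes> Y\<^sub>3" and ?\<alpha>\<^sub>X = "\<alpha> X\<^sub>1 X\<^sub>2 X\<^sub>3" and ?\<alpha>\<^sub>Y = "\<alpha> Y\<^sub>1 Y\<^sub>2 Y\<^sub>3"
  \<comment> \<open>Nests the target completely to the right, so that
    \<open>Assoc_interchange\<close> turns every interchange into transpositions of adjacent factors
    and both sides reach one normal form.\<close>
  let ?\<psi> = "(\<iota> X\<^sub>1 \<otimes> (\<iota> Y\<^sub>1 \<otimes> \<alpha> X\<^sub>2 Y\<^sub>2 ?T)) \<cdot> \<alpha> X\<^sub>1 Y\<^sub>1 ((X\<^sub>2 \<boxtimes> Y\<^sub>2) \<boxtimes> ?T)"
  let ?\<tau>\<^sub>1 = "\<tau> X\<^sub>1 X\<^sub>2 Y\<^sub>1 Y\<^sub>2" and ?\<tau>\<^sub>2 = "\<tau> (X\<^sub>1 \<boxtimes> X\<^sub>2) X\<^sub>3 (Y\<^sub>1 \<boxtimes> Y\<^sub>2) Y\<^sub>3"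
  let ?\<tau>\<^sub>3 = "\<tau> X\<^sub>2 X\<^sub>3 Y\<^sub>2 Y\<^sub>3" and ?\<tau>\<^sub>4 = "\<tau> X\<^sub>1 (X\<^sub>2 \<boxtimes> X\<^sub>3) Y\<^sub>1 (Y\<^sub>2 \<boxtimes> Y\<^sub>3)"
  let ?L = "\<alpha> (X\<^sub>1 \<boxtimes> Y\<^sub>1) (X\<^sub>2 \<boxtimes> Y\<^sub>2) ?T \<cdot> (?\<tau>\<^sub>1 \<otimes> \<iota> ?T) \<cdot> ?\<tau>\<^sub>2"
  let ?R = "(\<iota> (X\<^sub>1 \<boxtimes> Y\<^sub>1) \<otimes> ?\<tau>\<^sub>3) \<cdot> ?\<tau>\<^sub>4 \<cdot> (?\<alpha>\<^sub>X \<otimes> ?\<alpha>\<^sub>Y)"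
  let ?Z = "X\<^sub>3 \<boxtimes> ((Y\<^sub>1 \<boxtimes> Y\<^sub>2) \<boxtimes> Y\<^sub>3)"
  have "?\<psi> \<cdot> ?L = (\<iota> X\<^sub>1 \<otimes> (\<iota> Y\<^sub>1 \<otimes> \<alpha> X\<^sub>2 Y\<^sub>2 ?T)) \<cdot> (\<alpha> X\<^sub>1 Y\<^sub>1 ((X\<^sub>2 \<boxtimes> Y\<^sub>2) \<boxtimes> ?T) \<cdot> \<alpha> (X\<^sub>1 \<boxtimes> Y\<^sub>1) (X\<^sub>2 \<boxtimes> Y\<^sub>2) ?T) \<cdot> (?\<tau>\<^sub>1 \<otimes> \<iota> ?T) \<cdot> ?\<tau>\<^sub>2"
    by simp
  also have "\<dots> = (\<iota> X\<^sub>1 \<otimes> ((\<iota> Y\<^sub>1 \<otimes> \<alpha> X\<^sub>2 Y\<^sub>2 ?T) \<cdot> \<alpha> Y\<^sub>1 (X\<^sub>2 \<boxtimes> Y\<^sub>2) ?T)) \<cdot> \<alpha> X\<^sub>1 (Y\<^sub>1 \<boxtimes> (X\<^sub>2 \<boxtimes> Y\<^sub>2)) ?T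
      \<cdot> ((\<alpha> X\<^sub>1 Y\<^sub>1 (X\<^sub>2 \<boxtimes> Y\<^sub>2) \<cdot> ?\<tau>\<^sub>1) \<otimes> \<iota> ?T) \<cdot> ?\<tau>\<^sub>2"
    by (subst pentagon) simp_all
  also have "\<dots> = (\<iota> X\<^sub>1 \<otimes> ((\<iota> Y\<^sub>1 \<otimes> \<alpha> X\<^sub>2 Y\<^sub>2 ?T) \<cdot> \<alpha> Y\<^sub>1 (X\<^sub>2 \<boxtimes> Y\<^sub>2) ?T)) \<cdot> (\<alpha> X\<^sub>1 (Y\<^sub>1 \<boxtimes> (X\<^sub>2 \<boxtimes> Y\<^sub>2)) ?T
      \<cdot> ((\<iota> X\<^sub>1 \<otimes> \<beta> X\<^sub>2 Y\<^sub>1 Y\<^sub>2) \<otimes> \<iota> ?T)) \<cdot> (\<alpha> X\<^sub>1 X\<^sub>2 (Y\<^sub>1 \<boxtimes> Y\<^sub>2) \<otimes> \<iota> ?T) \<cdot> ?\<tau>\<^sub>2"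
    by (subst Assoc_interchange) simp_all
  also have "\<dots> = (\<iota> X\<^sub>1 \<otimes> ((\<iota> Y\<^sub>1 \<otimes> \<alpha> X\<^sub>2 Y\<^sub>2 ?T) \<cdot> \<alpha> Y\<^sub>1 (X\<^sub>2 \<boxtimes> Y\<^sub>2) ?T \<cdot> (\<beta> X\<^sub>2 Y\<^sub>1 Y\<^sub>2 \<otimes> \<iota> ?T)))
      \<cdot> \<alpha> X\<^sub>1 (X\<^sub>2 \<boxtimes> (Y\<^sub>1 \<boxtimes> Y\<^sub>2)) ?T \<cdot> (\<alpha> X\<^sub>1 X\<^sub>2 (Y\<^sub>1 \<boxtimes> Y\<^sub>2) \<otimes> \<iota> ?T) \<cdot> ?\<tau>\<^sub>2"
    by (subst natural(4)[where X = "X\<^sub>1" and Y = "X\<^sub>2 \<boxtimes> (Y\<^sub>1 \<boxtimes> Y\<^sub>2)" and Z = "X\<^sub>3 \<boxtimes> Y\<^sub>3"]) simp_all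
  also have "\<dots> = (\<iota> X\<^sub>1 \<otimes> (\<beta> X\<^sub>2 Y\<^sub>1 (Y\<^sub>2 \<boxtimes> ?T) \<cdot> (\<iota> X\<^sub>2 \<otimes> \<alpha> Y\<^sub>1 Y\<^sub>2 ?T)))
      \<cdot> ((\<iota> X\<^sub>1 \<otimes> \<alpha> X\<^sub>2 (Y\<^sub>1 \<boxtimes> Y\<^sub>2) ?T) \<cdot> \<alpha> X\<^sub>1 (X\<^sub>2 \<boxtimes> (Y\<^sub>1 \<boxtimes> Y\<^sub>2)) ?T \<cdot> (\<alpha> X\<^sub>1 X\<^sub>2 (Y\<^sub>1 \<boxtimes> Y\<^sub>2) \<otimes> \<iota> ?T)) \<cdot> ?\<tau>\<^sub>2"
    by (subst swap_tensor_right[symmetric]) simp_all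
  also have "\<dots> = (\<iota> X\<^sub>1 \<otimes> (\<beta> X\<^sub>2 Y\<^sub>1 (Y\<^sub>2 \<boxtimes> ?T) \<cdot> (\<iota> X\<^sub>2 \<otimes> \<alpha> Y\<^sub>1 Y\<^sub>2 ?T)))
      \<cdot> \<alpha> X\<^sub>1 X\<^sub>2 ((Y\<^sub>1 \<boxtimes> Y\<^sub>2) \<boxtimes> ?T) \<cdot> (\<alpha> (X\<^sub>1 \<boxtimes> X\<^sub>2) (Y\<^sub>1 \<boxtimes> Y\<^sub>2) ?T \<cdot> ?\<tau>\<^sub>2)"
    by (subst pentagon[symmetric]) simp_all
  also have "\<dots> = (\<iota> X\<^sub>1 \<otimes> (\<beta> X\<^sub>2 Y\<^sub>1 (Y\<^sub>2 \<boxtimes> ?T) \<cdot> (\<iota> X\<^sub>2 \<otimes> \<alpha> Y\<^sub>1 Y\<^sub>2 ?T)))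
      \<cdot> (\<alpha> X\<^sub>1 X\<^sub>2 ((Y\<^sub>1 \<boxtimes> Y\<^sub>2) \<boxtimes> ?T) \<cdot> (\<iota> (X\<^sub>1 \<boxtimes> X\<^sub>2) \<otimes> \<beta> X\<^sub>3 (Y\<^sub>1 \<boxtimes> Y\<^sub>2) Y\<^sub>3)) \<cdot> \<alpha> (X\<^sub>1 \<boxtimes> X\<^sub>2) X\<^sub>3 ((Y\<^sub>1 \<boxtimes> Y\<^sub>2) \<boxtimes> Y\<^sub>3)"
    by (subst Assoc_interchange) simp_all
  also have "\<dots> = (\<iota> X\<^sub>1 \<otimes> (\<beta> X\<^sub>2 Y\<^sub>1 (Y\<^sub>2 \<boxtimes> ?T) \<cdot> (\<iota> X\<^sub>2 \<otimes> (\<alpha> Y\<^sub>1 Y\<^sub>2 ?T \<cdot> \<beta> X\<^sub>3 (Y\<^sub>1 \<boxtimes> Y\<^sub>2) Y\<^sub>3))))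
      \<cdot> \<alpha> X\<^sub>1 X\<^sub>2 ?Z \<cdot> \<alpha> (X\<^sub>1 \<boxtimes> X\<^sub>2) X\<^sub>3 ((Y\<^sub>1 \<boxtimes> Y\<^sub>2) \<boxtimes> Y\<^sub>3)"
    by (simp add: Assoc_natural_Id)
  also have "\<dots> = (\<iota> X\<^sub>1 \<otimes> (\<beta> X\<^sub>2 Y\<^sub>1 (Y\<^sub>2 \<boxtimes> ?T) \<cdot> (\<iota> X\<^sub>2 \<otimes> (\<iota> Y\<^sub>1 \<otimes> \<beta> X\<^sub>3 Y\<^sub>2 Y\<^sub>3)) \<cdot> (\<iota> X\<^sub>2 \<otimes> (\<beta> X\<^sub>3 Y\<^sub>1 (Y\<^sub>2 \<boxtimes> Y\<^sub>3) \<cdot> (\<iota> X\<^sub>3 \<otimes> ?\<alpha>\<^sub>Y)))))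
      \<cdot> \<alpha> X\<^sub>1 X\<^sub>2 ?Z \<cdot> \<alpha> (X\<^sub>1 \<boxtimes> X\<^sub>2) X\<^sub>3 ((Y\<^sub>1 \<boxtimes> Y\<^sub>2) \<boxtimes> Y\<^sub>3)"
    by (subst swap_tensor_middle) simp_all
  finally have L: "?\<psi> \<cdot> ?L = \<dots>" .
  have "?\<psi> \<cdot> ?R = (\<iota> X\<^sub>1 \<otimes> (\<iota> Y\<^sub>1 \<otimes> \<alpha> X\<^sub>2 Y\<^sub>2 ?T)) \<cdot> (\<alpha> X\<^sub>1 Y\<^sub>1 ((X\<^sub>2 \<boxtimes> Y\<^sub>2) \<boxtimes> ?T) \<cdot> (\<iota> (X\<^sub>1 \<boxtimes> Y\<^sub>1) \<otimes> ?\<tau>\<^sub>3)) \<cdot> ?\<tau>\<^sub>4 \<cdot> (?\<alpha>\<^sub>X \<otimes> ?\<alpha>\<^sub>Y)"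
    by simp
  also have "\<dots> = (\<iota> X\<^sub>1 \<otimes> (\<iota> Y\<^sub>1 \<otimes> (\<alpha> X\<^sub>2 Y\<^sub>2 ?T \<cdot> ?\<tau>\<^sub>3))) \<cdot> (\<alpha> X\<^sub>1 Y\<^sub>1 ((X\<^sub>2 \<boxtimes> X\<^sub>3) \<boxtimes> (Y\<^sub>2 \<boxtimes> Y\<^sub>3)) \<cdot> ?\<tau>\<^sub>4) \<cdot> (?\<alpha>\<^sub>X \<otimes> ?\<alpha>\<^sub>Y)"
    by (simp add: Assoc_natural_Id)
  also have "\<dots> = (\<iota> X\<^sub>1 \<otimes> ((\<iota> Y\<^sub>1 \<otimes> (\<iota> X\<^sub>2 \<otimes> \<beta> X\<^sub>3 Y\<^sub>2 Y\<^sub>3)) \<cdot> ((\<iota> Y\<^sub>1 \<otimes> \<alpha> X\<^sub>2 X\<^sub>3 (Y\<^sub>2 \<boxtimes> Y\<^sub>3)) \<cdot> \<beta> (X\<^sub>2 \<boxtimes> X\<^sub>3) Y\<^sub>1 (Y\<^sub>2 \<boxtimes> Y\<^sub>3))))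
      \<cdot> \<alpha> X\<^sub>1 (X\<^sub>2 \<boxtimes> X\<^sub>3) (Y\<^sub>1 \<boxtimes> (Y\<^sub>2 \<boxtimes> Y\<^sub>3)) \<cdot> (?\<alpha>\<^sub>X \<otimes> ?\<alpha>\<^sub>Y)"
    by (subst (1 2) Assoc_interchange) simp_all
  also have "\<dots> = (\<iota> X\<^sub>1 \<otimes> ((\<iota> Y\<^sub>1 \<otimes> (\<iota> X\<^sub>2 \<otimes> \<beta> X\<^sub>3 Y\<^sub>2 Y\<^sub>3)) \<cdot> \<beta> X\<^sub>2 Y\<^sub>1 (X\<^sub>3 \<boxtimes> (Y\<^sub>2 \<boxtimes> Y\<^sub>3)) \<cdot> (\<iota> X\<^sub>2 \<otimes> \<beta> X\<^sub>3 Y\<^sub>1 (Y\<^sub>2 \<boxtimes> Y\<^sub>3))))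
      \<cdot> ((\<iota> X\<^sub>1 \<otimes> \<alpha> X\<^sub>2 X\<^sub>3 (Y\<^sub>1 \<boxtimes> (Y\<^sub>2 \<boxtimes> Y\<^sub>3))) \<cdot> \<alpha> X\<^sub>1 (X\<^sub>2 \<boxtimes> X\<^sub>3) (Y\<^sub>1 \<boxtimes> (Y\<^sub>2 \<boxtimes> Y\<^sub>3)) \<cdot> (?\<alpha>\<^sub>X \<otimes> \<iota> (Y\<^sub>1 \<boxtimes> (Y\<^sub>2 \<boxtimes> Y\<^sub>3))))
      \<cdot> (\<iota> ((X\<^sub>1 \<boxtimes> X\<^sub>2) \<boxtimes> X\<^sub>3) \<otimes> ?\<alpha>\<^sub>Y)"
    by (subst swap_tensor_left) simp_all
  also have "\<dots> = (\<iota> X\<^sub>1 \<otimes> ((\<iota> Y\<^sub>1 \<otimes> (\<iota> X\<^sub>2 \<otimes> \<beta> X\<^sub>3 Y\<^sub>2 Y\<^sub>3)) \<cdot> \<beta> X\<^sub>2 Y\<^sub>1 (X\<^sub>3 \<boxtimes> (Y\<^sub>2 \<boxtimes> Y\<^sub>3)) \<cdot> (\<iota> X\<^sub>2 \<otimes> \<beta> X\<^sub>3 Y\<^sub>1 (Y\<^sub>2 \<boxtimes> Y\<^sub>3))))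
      \<cdot> \<alpha> X\<^sub>1 X\<^sub>2 (X\<^sub>3 \<boxtimes> (Y\<^sub>1 \<boxtimes> (Y\<^sub>2 \<boxtimes> Y\<^sub>3))) \<cdot> (\<alpha> (X\<^sub>1 \<boxtimes> X\<^sub>2) X\<^sub>3 (Y\<^sub>1 \<boxtimes> (Y\<^sub>2 \<boxtimes> Y\<^sub>3)) \<cdot> (\<iota> ((X\<^sub>1 \<boxtimes> X\<^sub>2) \<boxtimes> X\<^sub>3) \<otimes> ?\<alpha>\<^sub>Y))"
    by (subst pentagon[symmetric]) simp_all
  also have "\<dots> = (\<iota> X\<^sub>1 \<otimes> ((\<iota> Y\<^sub>1 \<otimes> (\<iota> X\<^sub>2 \<otimes> \<beta> X\<^sub>3 Y\<^sub>2 Y\<^sub>3)) \<cdot> \<beta> X\<^sub>2 Y\<^sub>1 (X\<^sub>3 \<boxtimes> (Y\<^sub>2 \<boxtimes> Y\<^sub>3)) \<cdot> (\<iota> X\<^sub>2 \<otimes> \<beta> X\<^sub>3 Y\<^sub>1 (Y\<^sub>2 \<boxtimes> Y\<^sub>3))))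
      \<cdot> (\<alpha> X\<^sub>1 X\<^sub>2 (X\<^sub>3 \<boxtimes> (Y\<^sub>1 \<boxtimes> (Y\<^sub>2 \<boxtimes> Y\<^sub>3))) \<cdot> (\<iota> (X\<^sub>1 \<boxtimes> X\<^sub>2) \<otimes> (\<iota> X\<^sub>3 \<otimes> ?\<alpha>\<^sub>Y))) \<cdot> \<alpha> (X\<^sub>1 \<boxtimes> X\<^sub>2) X\<^sub>3 ((Y\<^sub>1 \<boxtimes> Y\<^sub>2) \<boxtimes> Y\<^sub>3)"
    by (simp add: Assoc_natural_Id Comp_reassoc[OF Assoc_natural_Id(1)])
  also have "\<dots> = (\<iota> X\<^sub>1 \<otimes> (((\<iota> Y\<^sub>1 \<otimes> (\<iota> X\<^sub>2 \<otimes> \<beta> X\<^sub>3 Y\<^sub>2 Y\<^sub>3)) \<cdot> \<beta> X\<^sub>2 Y\<^sub>1 (X\<^sub>3 \<boxtimes> (Y\<^sub>2 \<boxtimes> Y\<^sub>3))) \<cdot> (\<iota> X\<^sub>2 \<otimes> (\<beta> X\<^sub>3 Y\<^sub>1 (Y\<^sub>2 \<boxtimes> Y\<^sub>3) \<cdot> (\<iota> X\<^sub>3 \<otimes> ?\<alpha>\<^sub>Y)))))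
      \<cdot> \<alpha> X\<^sub>1 X\<^sub>2 ?Z \<cdot> \<alpha> (X\<^sub>1 \<boxtimes> X\<^sub>2) X\<^sub>3 ((Y\<^sub>1 \<boxtimes> Y\<^sub>2) \<boxtimes> Y\<^sub>3)"
    by (simp add: Comp_reassoc[OF Assoc_natural_Id(1)])
  \<comment> \<open>The two sides now differ only in the order of two transpositions, of
    \<open>X\<^sub>2\<close> with \<open>Y\<^sub>1\<close> and of \<open>X\<^sub>3\<close> with
    \<open>Y\<^sub>2\<close>. They act on disjoint factors, so naturality exchanges them.\<close>
  also have "\<dots> = (\<iota> X\<^sub>1 \<otimes> ((\<beta> X\<^sub>2 Y\<^sub>1 (Y\<^sub>2 \<boxtimes> ?T) \<cdot> (\<iota> X\<^sub>2 \<otimes> (\<iota> Y\<^sub>1 \<otimes> \<beta> X\<^sub>3 Y\<^sub>2 Y\<^sub>3))) \<cdot> (\<iota> X\<^sub>2 \<otimes> (\<beta> X\<^sub>3 Y\<^sub>1 (Y\<^sub>2 \<boxtimes> Y\<^sub>3) \<cdot> (\<iota> X\<^sub>3 \<otimes> ?\<alpha>\<^sub>Y)))))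
      \<cdot> \<alpha> X\<^sub>1 X\<^sub>2 ?Z \<cdot> \<alpha> (X\<^sub>1 \<boxtimes> X\<^sub>2) X\<^sub>3 ((Y\<^sub>1 \<boxtimes> Y\<^sub>2) \<boxtimes> Y\<^sub>3)"
    by (subst swap_natural[where X = "X\<^sub>2" and Y = "Y\<^sub>1" and Z = "X\<^sub>3 \<boxtimes> (Y\<^sub>2 \<boxtimes> Y\<^sub>3)"]) simp_all
  finally have R: "?\<psi> \<cdot> ?R = \<dots>" .
  show "?\<psi> \<cdot> ?L = ?\<psi> \<cdot> ?R"
    unfolding L R by simp
  show "(\<alpha>' X\<^sub>1 Y\<^sub>1 ((X\<^sub>2 \<boxtimes> Y\<^sub>2) \<boxtimes> ?T) \<cdot> (\<iota> X\<^sub>1 \<otimes> (\<iota> Y\<^sub>1 \<otimes> \<alpha>' X\<^sub>2 Y\<^sub>2 ?T))) \<cdot> ?\<psi>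
    = \<iota> ((X\<^sub>1 \<boxtimes> Y\<^sub>1) \<boxtimes> ((X\<^sub>2 \<boxtimes> Y\<^sub>2) \<boxtimes> ?T))"
    by simp
qed simp_all

text \<open>The symmetry coherence of the same monoidal functor, from which a tensor product
  inherits cocommutativity. Both braidings of pairs are resolved into adjacent
  transpositions.\<close>

lemma Braid_interchange:
  assumes [simp]: "X \<in> Obj M" "X' \<in> Obj M" "Y \<in> Obj M" "Y' \<in> Obj M"
  shows "\<sigma> (X \<boxtimes> Y) (X' \<boxtimes> Y') \<cdot> \<tau> X X' Y Y' = \<tau> X' X Y' Y \<cdot> (\<sigma> X X' \<otimes> \<sigma> Y Y')"
proof -
  let ?b = "\<iota> X' \<otimes> (\<beta> X Y' Y \<cdot> (\<iota> X \<otimes> \<sigma> Y Y'))"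
  have "\<alpha> X' Y' (X \<boxtimes> Y) \<cdot> (\<sigma> (X \<boxtimes> Y) (X' \<boxtimes> Y') \<cdot> \<tau> X X' Y Y')
      = (\<iota> X' \<otimes> \<sigma> (X \<boxtimes> Y) Y') \<cdot> \<beta> (X \<boxtimes> Y) X' Y' \<cdot> \<tau> X X' Y Y'"
    by (subst Comp_reassoc[OF Braid_tensor_right]) simp_all
  also have "\<dots> = ?b \<cdot> ((\<iota> X' \<otimes> \<alpha> X Y Y') \<cdot> \<beta> (X \<boxtimes> Y) X' Y') \<cdot> \<tau> X X' Y Y'"
    by (simp add: Braid_tensor_left)
  also have "\<dots> = ?b \<cdot> \<beta> X X' (Y \<boxtimes> Y') \<cdot> (\<iota> X \<otimes> \<beta> Y X' Y') \<cdot> (\<alpha> X Y (X' \<boxtimes> Y') \<cdot> \<tau> X X' Y Y')"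
    by (subst swap_tensor_left) simp_all
  also have "\<dots> = ?b \<cdot> (\<beta> X X' (Y \<boxtimes> Y') \<cdot> \<alpha> X X' (Y \<boxtimes> Y'))"
    by (subst Assoc_interchange) simp_all
  also have "\<dots> = ((\<iota> X' \<otimes> \<beta> X Y' Y) \<cdot> (\<iota> X' \<otimes> (\<iota> X \<otimes> \<sigma> Y Y'))) \<cdot> \<alpha> X' X (Y \<boxtimes> Y') \<cdot> (\<sigma> X X' \<otimes> \<iota> (Y \<boxtimes> Y'))"
    by (subst swap_Assoc) simp_all
  also have "\<dots> = (\<iota> X' \<otimes> \<beta> X Y' Y) \<cdot> ((\<iota> X' \<otimes> (\<iota> X \<otimes> \<sigma> Y Y')) \<cdot> \<alpha> X' X (Y \<boxtimes> Y')) \<cdot> (\<sigma> X X' \<otimes> \<iota> (Y \<boxtimes> Y'))"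
    by simp
  also have "\<dots> = ((\<iota> X' \<otimes> \<beta> X Y' Y) \<cdot> \<alpha> X' X (Y' \<boxtimes> Y)) \<cdot> (\<sigma> X X' \<otimes> \<sigma> Y Y')"
    by (subst Assoc_natural_Id(1)[symmetric, where Z' = "Y' \<boxtimes> Y"]) simp_all
  also have "\<dots> = \<alpha> X' Y' (X \<boxtimes> Y) \<cdot> (\<tau> X' X Y' Y \<cdot> (\<sigma> X X' \<otimes> \<sigma> Y Y'))"
    by (subst Assoc_interchange[symmetric]) simp_all
  finally show ?thesis
    by (rule iso_cancel_left[OF Assoc_iso, rotated 3]) simp_all
qed

lemma Lunit_interchange:
  assumes [simp]: "X \<in> Obj M" "Y \<in> Obj M"
  shows "\<ll> (X \<boxtimes> Y) \<cdot> (\<ll> \<I> \<otimes> \<iota> (X \<boxtimes> Y)) \<cdot> \<tau> \<I> X \<I> Y = \<ll> X \<otimes> \<ll> Y"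
proof -
  have "\<ll> (X \<boxtimes> Y) \<cdot> (\<ll> \<I> \<otimes> \<iota> (X \<boxtimes> Y)) \<cdot> \<tau> \<I> X \<I> Y
      = \<ll> (X \<boxtimes> Y) \<cdot> (\<iota> \<I> \<otimes> \<ll> (X \<boxtimes> Y)) \<cdot> (\<alpha> \<I> \<I> (X \<boxtimes> Y) \<cdot> \<tau> \<I> X \<I> Y)"
    by (simp add: Comp_reassoc[OF triangle] flip: Lunit_Runit_unit)
  also have "\<dots> = \<ll> (X \<boxtimes> Y) \<cdot> (\<iota> \<I> \<otimes> (\<ll> (X \<boxtimes> Y) \<cdot> \<beta> X \<I> Y)) \<cdot> \<alpha> \<I> X (\<I> \<boxtimes> Y)"
    by (subst Assoc_interchange) simp_all
  also have "\<dots> = (\<ll> (X \<boxtimes> Y) \<cdot> \<alpha> \<I> X Y) \<cdot> (\<iota> (\<I> \<boxtimes> X) \<otimes> \<ll> Y)"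
    by (simp add: Lunit_swap Assoc_natural_Id)
  also have "\<dots> = \<ll> X \<otimes> \<ll> Y"
    by (subst Lunit_tensor) simp_all
  finally show ?thesis .
qed

lemma Runit_interchange:
  assumes [simp]: "X \<in> Obj M" "Y \<in> Obj M"
  shows "(\<rr> X \<otimes> \<rr> Y) \<cdot> \<tau> X Y \<I> \<I> = \<rr> (X \<boxtimes> Y) \<cdot> (\<iota> (X \<boxtimes> Y) \<otimes> \<ll> \<I>)"
proof -
  have "(\<rr> X \<otimes> \<rr> Y) \<cdot> \<tau> X Y \<I> \<I> = (\<iota> X \<otimes> \<rr> Y) \<cdot> (\<rr> X \<otimes> \<iota> (Y \<boxtimes> \<I>)) \<cdot> \<tau> X Y \<I> \<I>"
    by simp
  also have "\<dots> = (\<iota> X \<otimes> \<rr> Y) \<cdot> ((\<iota> X \<otimes> \<ll> (Y \<boxtimes> \<I>)) \<cdot> \<alpha> X \<I> (Y \<boxtimes> \<I>)) \<cdot> \<tau> X Y \<I> \<I>"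
    by (subst triangle) simp_all
  also have "\<dots> = (\<iota> X \<otimes> (\<rr> Y \<cdot> \<ll> (Y \<boxtimes> \<I>))) \<cdot> (\<alpha> X \<I> (Y \<boxtimes> \<I>) \<cdot> \<tau> X Y \<I> \<I>)"
    by simp
  also have "\<dots> = (\<iota> X \<otimes> (\<rr> Y \<cdot> \<ll> (Y \<boxtimes> \<I>) \<cdot> \<beta> Y \<I> \<I>)) \<cdot> \<alpha> X Y (\<I> \<boxtimes> \<I>)"
    by (subst Assoc_interchange) simp_all
  also have "\<dots> = (\<iota> X \<otimes> \<rr> Y) \<cdot> (\<alpha> X Y \<I> \<cdot> (\<iota> (X \<boxtimes> Y) \<otimes> \<ll> \<I>))"
    by (simp add: Lunit_swap Assoc_natural_Id)
  also have "\<dots> = \<rr> (X \<boxtimes> Y) \<cdot> (\<iota> (X \<boxtimes> Y) \<otimes> \<ll> \<I>)"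
    by (simp flip: Runit_tensor)
  finally show ?thesis .
qed

text \<open>The two exchanged factors are both \<I>, and the symmetry of \<I> with itself is an
  identity.\<close>

lemma Runit_Lunit_interchange:
  assumes [simp]: "X \<in> Obj M" "Y \<in> Obj M"
  shows "(\<rr> X \<otimes> \<ll> Y) \<cdot> \<tau> X \<I> \<I> Y = \<rr> X \<otimes> \<ll> Y"
proof -
  have "\<beta> \<I> \<I> Y = \<iota> (\<I> \<boxtimes> (\<I> \<boxtimes> Y))"
    by (simp add: swap_def Braid_unit_unit)
  then show ?thesis
    by (simp add: interchange_def flip: swap_def)
qed

section \<open>The cartesian category of cocommutative comonoids\<close>

lemma interchange_interchange [simp]:
  assumes [simp]: "W \<in> Obj M" "X \<in> Obj M" "Y \<in> Obj M" "Z \<in> Obj M"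
  shows "\<tau> W Y X Z \<cdot> \<tau> W X Y Z = \<iota> ((W \<boxtimes> X) \<boxtimes> (Y \<boxtimes> Z))"
proof (rule iso_cancel_left[OF Assoc_iso])
  have "\<alpha> W X (Y \<boxtimes> Z) \<cdot> (\<tau> W Y X Z \<cdot> \<tau> W X Y Z) = (\<iota> W \<otimes> \<beta> Y X Z) \<cdot> (\<alpha> W Y (X \<boxtimes> Z) \<cdot> \<tau> W X Y Z)"
    by (subst Comp_reassoc[OF Assoc_interchange]) simp_all
  also have "\<dots> = \<alpha> W X (Y \<boxtimes> Z)"
    by (subst Assoc_interchange) simp_all
  finally show "\<alpha> W X (Y \<boxtimes> Z) \<cdot> (\<tau> W Y X Z \<cdot> \<tau> W X Y Z) = \<alpha> W X (Y \<boxtimes> Z) \<cdot> \<iota> ((W \<boxtimes> X) \<boxtimes> (Y \<boxtimes> Z))"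
    by simp
qed simp_all

lemma interchange_Braid:
  assumes [simp]: "X \<in> Obj M" "X' \<in> Obj M" "Y \<in> Obj M" "Y' \<in> Obj M"
  shows "\<tau> X' Y' X Y \<cdot> \<sigma> (X \<boxtimes> Y) (X' \<boxtimes> Y') = (\<sigma> X X' \<otimes> \<sigma> Y Y') \<cdot> \<tau> X Y X' Y'"
proof (rule epi_cancel)
  show "(\<tau> X' Y' X Y \<cdot> \<sigma> (X \<boxtimes> Y) (X' \<boxtimes> Y')) \<cdot> \<tau> X X' Y Y' = ((\<sigma> X X' \<otimes> \<sigma> Y Y') \<cdot> \<tau> X Y X' Y') \<cdot> \<tau> X X' Y Y'"
    by (simp add: Braid_interchange Comp_reassoc[OF interchange_interchange])
  show "\<tau> X X' Y Y' \<cdot> \<tau> X Y X' Y' = \<iota> ((X \<boxtimes> Y) \<boxtimes> (X' \<boxtimes> Y'))"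
    by simp
qed simp_all

definition coc_comonoid :: "('o, 'm, 'y) comonoid_data_scheme \<Rightarrow> bool" where
  "coc_comonoid A \<longleftrightarrow> is_comonoid M A \<and> cocommutative M A"

abbreviation "comon_hom A B f \<equiv> comonoid_morphism M A B f"

lemma coc_comonoid_arr [simp]:
  assumes "coc_comonoid A"
  shows "Car A \<in> Obj M" "Comul A \<in> Arr M" "Dom M (Comul A) = Car A" "Cod M (Comul A) = Car A \<boxtimes> Car A"
    "Counit A \<in> Arr M" "Dom M (Counit A) = Car A" "Cod M (Counit A) = \<I>"
  using assms by (auto simp: coc_comonoid_def is_comonoid_def Let_def Hom_iff)

lemma coc_comonoid_eq:
  assumes "coc_comonoid A"
  shows "\<alpha> (Car A) (Car A) (Car A) \<cdot> (Comul A \<otimes> \<iota> (Car A)) \<cdot> Comul A = (\<iota> (Car A) \<otimes> Comul A) \<cdot> Comul A"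
    "\<ll> (Car A) \<cdot> (Counit A \<otimes> \<iota> (Car A)) \<cdot> Comul A = \<iota> (Car A)"
    "\<rr> (Car A) \<cdot> (\<iota> (Car A) \<otimes> Counit A) \<cdot> Comul A = \<iota> (Car A)"
    "\<sigma> (Car A) (Car A) \<cdot> Comul A = Comul A"
  using assms by (auto simp: coc_comonoid_def is_comonoid_def cocommutative_def Let_def)

text \<open>The right counit law is obtained from the left one: the symmetry carries one to the
  other, and cocommutativity absorbs it.\<close>

lemma coc_comonoidI:
  assumes "Car A \<in> Obj M" "Comul A \<in> Arr M" "Dom M (Comul A) = Car A" "Cod M (Comul A) = Car A \<boxtimes> Car A"
    "Counit A \<in> Arr M" "Dom M (Counit A) = Car A" "Cod M (Counit A) = \<I>"
    "\<alpha> (Car A) (Car A) (Car A) \<cdot> (Comul A \<otimes> \<iota> (Car A)) \<cdot> Comul A = (\<iota> (Car A) \<otimes> Comul A) \<cdot> Comul A"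
    "\<ll> (Car A) \<cdot> (Counit A \<otimes> \<iota> (Car A)) \<cdot> Comul A = \<iota> (Car A)"
    "\<sigma> (Car A) (Car A) \<cdot> Comul A = Comul A"
  shows "coc_comonoid A"
proof -
  note [simp] = assms(1-7)
  have "\<rr> (Car A) \<cdot> (\<iota> (Car A) \<otimes> Counit A) \<cdot> Comul A = \<ll> (Car A) \<cdot> (\<sigma> (Car A) \<I> \<cdot> (\<iota> (Car A) \<otimes> Counit A)) \<cdot> Comul A"
    by (simp flip: Lunit_Braid)
  also have "\<dots> = \<ll> (Car A) \<cdot> (Counit A \<otimes> \<iota> (Car A)) \<cdot> (\<sigma> (Car A) (Car A) \<cdot> Comul A)"
    by (simp add: natural)
  also have "\<dots> = \<iota> (Car A)"
    unfolding assms(8-10) ..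
  finally show ?thesis
    using assms by (auto simp: coc_comonoid_def is_comonoid_def cocommutative_def Let_def Hom_iff)
qed

lemma comon_hom_arr:
  assumes "comon_hom A B f"
  shows "f \<in> Arr M" "Dom M f = Car A" "Cod M f = Car B"
    "Comul B \<cdot> f = (f \<otimes> f) \<cdot> Comul A" "Counit B \<cdot> f = Counit A"
  using assms by (auto simp: comonoid_morphism_def Hom_iff)

lemma comon_homI:
  assumes "f \<in> Arr M" "Dom M f = Car A" "Cod M f = Car B"
    "Comul B \<cdot> f = (f \<otimes> f) \<cdot> Comul A" "Counit B \<cdot> f = Counit A"
  shows "comon_hom A B f"
  using assms by (auto simp: comonoid_morphism_def Hom_iff)

lemma comon_hom_Id [simp]: "coc_comonoid A \<Longrightarrow> comon_hom A A (\<iota> (Car A))"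
  by (rule comon_homI) simp_all

lemma comon_hom_comp:
  assumes "coc_comonoid A" "coc_comonoid B" "coc_comonoid C" "comon_hom A B f" "comon_hom B C g"
  shows "comon_hom A C (g \<cdot> f)"
proof -
  note [simp] = assms(1-3) comon_hom_arr(1-3)[OF assms(4)] comon_hom_arr(1-3)[OF assms(5)]
  note f = comon_hom_arr(4,5)[OF assms(4)] and g = comon_hom_arr(4,5)[OF assms(5)]
  show ?thesis
    by (rule comon_homI) (simp_all add: f Comp_reassoc[OF g(1)] Comp_reassoc[OF g(2)])
qed

text \<open>Duplicating twice gives four copies, and by cocommutativity exchanging the middle two
  changes nothing. This makes the comultiplication a comonoid morphism into
  \<open>C \<odot> C\<close>, the reason why the tensor product is a cartesian product here.\<close>

lemma Comul_Comul_interchange: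
  assumes [simp]: "coc_comonoid C"
  shows "\<tau> (Car C) (Car C) (Car C) (Car C) \<cdot> (Comul C \<otimes> Comul C) \<cdot> Comul C = (Comul C \<otimes> Comul C) \<cdot> Comul C"
proof -
  let ?X = "Car C" and ?d = "Comul C"
  \<comment> \<open>Coassociativity moves the second duplication to the first two of three copies,
    where cocommutativity absorbs the transposition.\<close>
  have s: "\<beta> ?X ?X ?X \<cdot> (\<iota> ?X \<otimes> ?d) \<cdot> ?d = (\<iota> ?X \<otimes> ?d) \<cdot> ?d"
  proof -
    have "\<beta> ?X ?X ?X \<cdot> (\<iota> ?X \<otimes> ?d) \<cdot> ?d = (\<beta> ?X ?X ?X \<cdot> \<alpha> ?X ?X ?X) \<cdot> (?d \<otimes> \<iota> ?X) \<cdot> ?d"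
      by (simp flip: coc_comonoid_eq(1))
    also have "\<dots> = \<alpha> ?X ?X ?X \<cdot> ((\<sigma> ?X ?X \<cdot> ?d) \<otimes> \<iota> ?X) \<cdot> ?d"
      by (subst swap_Assoc) simp_all
    also have "\<dots> = (\<iota> ?X \<otimes> ?d) \<cdot> ?d"
      by (simp only: coc_comonoid_eq assms)
    finally show ?thesis .
  qed
  have a: "\<alpha> ?X ?X (?X \<boxtimes> ?X) \<cdot> (?d \<otimes> ?d) \<cdot> ?d = (\<iota> ?X \<otimes> ((\<iota> ?X \<otimes> ?d) \<cdot> ?d)) \<cdot> ?d"
  proof -
    have "\<alpha> ?X ?X (?X \<boxtimes> ?X) \<cdot> (?d \<otimes> ?d) \<cdot> ?d = (\<alpha> ?X ?X (?X \<boxtimes> ?X) \<cdot> (\<iota> (?X \<boxtimes> ?X) \<otimes> ?d)) \<cdot> (?d \<otimes> \<iota> ?X) \<cdot> ?d"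
      by simp
    also have "\<dots> = (\<iota> ?X \<otimes> (\<iota> ?X \<otimes> ?d)) \<cdot> (\<alpha> ?X ?X ?X \<cdot> (?d \<otimes> \<iota> ?X) \<cdot> ?d)"
      by (subst Assoc_natural_Id(1)[where Z = ?X]) simp_all
    also have "\<dots> = (\<iota> ?X \<otimes> ((\<iota> ?X \<otimes> ?d) \<cdot> ?d)) \<cdot> ?d"
      by (simp add: coc_comonoid_eq(1))
    finally show ?thesis .
  qed
  have "\<alpha> ?X ?X (?X \<boxtimes> ?X) \<cdot> (\<tau> ?X ?X ?X ?X \<cdot> (?d \<otimes> ?d) \<cdot> ?d) = (\<iota> ?X \<otimes> \<beta> ?X ?X ?X) \<cdot> (\<alpha> ?X ?X (?X \<boxtimes> ?X) \<cdot> (?d \<otimes> ?d) \<cdot> ?d)"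
    by (subst Comp_reassoc[OF Assoc_interchange]) simp_all
  also have "\<dots> = (\<iota> ?X \<otimes> (\<beta> ?X ?X ?X \<cdot> (\<iota> ?X \<otimes> ?d) \<cdot> ?d)) \<cdot> ?d"
    unfolding a by simp
  also have "\<dots> = \<alpha> ?X ?X (?X \<boxtimes> ?X) \<cdot> ((?d \<otimes> ?d) \<cdot> ?d)"
    unfolding s a ..
  finally show ?thesis
    by (rule iso_cancel_left[OF Assoc_iso, rotated 3]) simp_all
qed

lemma Counit_Counit:
  assumes [simp]: "coc_comonoid C"
  shows "\<ll> \<I> \<cdot> (Counit C \<otimes> Counit C) \<cdot> Comul C = Counit C"
proof -
  have "\<ll> \<I> \<cdot> (Counit C \<otimes> Counit C) \<cdot> Comul C = (\<ll> \<I> \<cdot> (\<iota> \<I> \<otimes> Counit C)) \<cdot> (Counit C \<otimes> \<iota> (Car C)) \<cdot> Comul C"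
    by simp
  also have "\<dots> = Counit C"
    by (simp add: natural coc_comonoid_eq)
  finally show ?thesis .
qed

section \<open>The unit comonoid and tensor products of comonoids\<close>

definition unit_comonoid :: "('o, 'm) comonoid_data" where
  "unit_comonoid = \<lparr>Car = \<I>, Comul = inverse_arrow M (\<ll> \<I>), Counit = \<iota> \<I>\<rparr>"

lemma unit_comonoid_sel [simp]:
  "Car unit_comonoid = \<I>" "Comul unit_comonoid = inverse_arrow M (\<ll> \<I>)" "Counit unit_comonoid = \<iota> \<I>"
  by (simp_all add: unit_comonoid_def)

lemma Lunit_unit_inverse [simp]:
  "inverse_arrow M (\<ll> \<I>) \<in> Arr M" "Dom M (inverse_arrow M (\<ll> \<I>)) = \<I>" "Cod M (inverse_arrow M (\<ll> \<I>)) = \<I> \<boxtimes> \<I>"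
  "\<ll> \<I> \<cdot> inverse_arrow M (\<ll> \<I>) = \<iota> \<I>" "inverse_arrow M (\<ll> \<I>) \<cdot> \<ll> \<I> = \<iota> (\<I> \<boxtimes> \<I>)"
  using inverse_arrow_props[OF Lunit_iso[of \<I>]] by simp_all

lemma coc_comonoid_unit [simp]: "coc_comonoid unit_comonoid"
proof (rule coc_comonoidI)
  let ?d = "inverse_arrow M (\<ll> \<I>)"
  have "\<alpha> \<I> \<I> \<I> \<cdot> (?d \<otimes> \<iota> \<I>) = \<iota> \<I> \<otimes> ?d"
  proof (rule mono_cancel)
    show "(\<iota> \<I> \<otimes> \<ll> \<I>) \<cdot> (\<alpha> \<I> \<I> \<I> \<cdot> (?d \<otimes> \<iota> \<I>)) = (\<iota> \<I> \<otimes> \<ll> \<I>) \<cdot> (\<iota> \<I> \<otimes> ?d)"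
      by (simp add: Comp_reassoc[OF triangle] Lunit_Runit_unit)
    show "(\<iota> \<I> \<otimes> ?d) \<cdot> (\<iota> \<I> \<otimes> \<ll> \<I>) = \<iota> (\<I> \<boxtimes> (\<I> \<boxtimes> \<I>))"
      by simp
  qed simp_all
  then show "\<alpha> (Car unit_comonoid) (Car unit_comonoid) (Car unit_comonoid) \<cdot> (Comul unit_comonoid \<otimes> \<iota> (Car unit_comonoid)) \<cdot> Comul unit_comonoid
    = (\<iota> (Car unit_comonoid) \<otimes> Comul unit_comonoid) \<cdot> Comul unit_comonoid"
    by (simp flip: Comp_assoc')
qed (simp_all add: Braid_unit_unit)

definition tensor_comonoid :: "('o, 'm, 'y) comonoid_data_scheme \<Rightarrow> ('o, 'm, 'z) comonoid_data_scheme \<Rightarrow> ('o, 'm) comonoid_data"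
    (infixl "\<odot>" 70) where
  "A \<odot> B = \<lparr>Car = Car A \<boxtimes> Car B, Comul = \<tau> (Car A) (Car A) (Car B) (Car B) \<cdot> (Comul A \<otimes> Comul B),
    Counit = \<ll> \<I> \<cdot> (Counit A \<otimes> Counit B)\<rparr>"

lemma tensor_comonoid_sel [simp]:
  "Car (A \<odot> B) = Car A \<boxtimes> Car B" "Comul (A \<odot> B) = \<tau> (Car A) (Car A) (Car B) (Car B) \<cdot> (Comul A \<otimes> Comul B)"
  "Counit (A \<odot> B) = \<ll> \<I> \<cdot> (Counit A \<otimes> Counit B)"
  by (simp_all add: tensor_comonoid_def)

lemma coc_comonoid_tensor [simp]:
  assumes [simp]: "coc_comonoid A" "coc_comonoid B"
  shows "coc_comonoid (A \<odot> B)"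
proof (rule coc_comonoidI)
  let ?X = "Car A" and ?Y = "Car B" and ?d = "Comul A" and ?e = "Comul B" and ?u = "Counit A" and ?v = "Counit B"
  let ?t = "\<tau> ?X ?X ?Y ?Y"
  have "\<alpha> (?X \<boxtimes> ?Y) (?X \<boxtimes> ?Y) (?X \<boxtimes> ?Y) \<cdot> ((?t \<cdot> (?d \<otimes> ?e)) \<otimes> \<iota> (?X \<boxtimes> ?Y)) \<cdot> (?t \<cdot> (?d \<otimes> ?e))
    = \<alpha> (?X \<boxtimes> ?Y) (?X \<boxtimes> ?Y) (?X \<boxtimes> ?Y) \<cdot> (?t \<otimes> \<iota> (?X \<boxtimes> ?Y)) \<cdot> (((?d \<otimes> ?e) \<otimes> (\<iota> ?X \<otimes> \<iota> ?Y)) \<cdot> ?t) \<cdot> (?d \<otimes> ?e)"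
    by simp
  also have "\<dots> = (\<alpha> (?X \<boxtimes> ?Y) (?X \<boxtimes> ?Y) (?X \<boxtimes> ?Y) \<cdot> (?t \<otimes> \<iota> (?X \<boxtimes> ?Y)) \<cdot> \<tau> (?X \<boxtimes> ?X) ?X (?Y \<boxtimes> ?Y) ?Y) \<cdot> (((?d \<otimes> \<iota> ?X) \<cdot> ?d) \<otimes> ((?e \<otimes> \<iota> ?Y) \<cdot> ?e))"
    by (subst interchange_natural[symmetric, where W' = "?X \<boxtimes> ?X" and X' = ?X and Y' = "?Y \<boxtimes> ?Y" and Z' = ?Y]) simp_all
  also have "\<dots> = (\<iota> (?X \<boxtimes> ?Y) \<otimes> ?t) \<cdot> \<tau> ?X (?X \<boxtimes> ?X) ?Y (?Y \<boxtimes> ?Y) \<cdot> ((\<alpha> ?X ?X ?X \<cdot> (?d \<otimes> \<iota> ?X) \<cdot> ?d) \<otimes> (\<alpha> ?Y ?Y ?Y \<cdot> (?e \<otimes> \<iota> ?Y) \<cdot> ?e))"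
    by (subst Assoc_interchange_interchange) simp_all
  also have "\<dots> = (\<iota> (?X \<boxtimes> ?Y) \<otimes> ?t) \<cdot> (\<tau> ?X (?X \<boxtimes> ?X) ?Y (?Y \<boxtimes> ?Y) \<cdot> ((\<iota> ?X \<otimes> ?d) \<otimes> (\<iota> ?Y \<otimes> ?e))) \<cdot> (?d \<otimes> ?e)"
    by (simp add: coc_comonoid_eq)
  also have "\<dots> = (\<iota> (?X \<boxtimes> ?Y) \<otimes> (?t \<cdot> (?d \<otimes> ?e))) \<cdot> (?t \<cdot> (?d \<otimes> ?e))"
    by (subst interchange_natural[where W = ?X and X = ?X and Y = ?Y and Z = ?Y]) simp_all
  finally show "\<alpha> (Car (A \<odot> B)) (Car (A \<odot> B)) (Car (A \<odot> B)) \<cdot> (Comul (A \<odot> B) \<otimes> \<iota> (Car (A \<odot> B))) \<cdot> Comul (A \<odot> B)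
    = (\<iota> (Car (A \<odot> B)) \<otimes> Comul (A \<odot> B)) \<cdot> Comul (A \<odot> B)"
    by (simp only: tensor_comonoid_sel)
  have "\<ll> (?X \<boxtimes> ?Y) \<cdot> ((\<ll> \<I> \<cdot> (?u \<otimes> ?v)) \<otimes> \<iota> (?X \<boxtimes> ?Y)) \<cdot> (?t \<cdot> (?d \<otimes> ?e))
    = \<ll> (?X \<boxtimes> ?Y) \<cdot> (\<ll> \<I> \<otimes> \<iota> (?X \<boxtimes> ?Y)) \<cdot> (((?u \<otimes> ?v) \<otimes> (\<iota> ?X \<otimes> \<iota> ?Y)) \<cdot> ?t) \<cdot> (?d \<otimes> ?e)"
    by simp
  also have "\<dots> = (\<ll> (?X \<boxtimes> ?Y) \<cdot> (\<ll> \<I> \<otimes> \<iota> (?X \<boxtimes> ?Y)) \<cdot> \<tau> \<I> ?X \<I> ?Y) \<cdot> (((?u \<otimes> \<iota> ?X) \<cdot> ?d) \<otimes> ((?v \<otimes> \<iota> ?Y) \<cdot> ?e))"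
    by (subst interchange_natural[symmetric, where W' = "\<I>" and X' = ?X and Y' = "\<I>" and Z' = ?Y]) simp_all
  also have "\<dots> = \<iota> (?X \<boxtimes> ?Y)"
    by (subst Lunit_interchange) (simp_all add: coc_comonoid_eq)
  finally show "\<ll> (Car (A \<odot> B)) \<cdot> (Counit (A \<odot> B) \<otimes> \<iota> (Car (A \<odot> B))) \<cdot> Comul (A \<odot> B) = \<iota> (Car (A \<odot> B))"
    by (simp only: tensor_comonoid_sel)
  show "\<sigma> (Car (A \<odot> B)) (Car (A \<odot> B)) \<cdot> Comul (A \<odot> B) = Comul (A \<odot> B)"
    by (simp add: Comp_reassoc[OF Braid_interchange] coc_comonoid_eq)
qed simp_all

lemma Braid_comon_hom:
  assumes [simp]: "coc_comonoid A" "coc_comonoid B"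
  shows "comon_hom (A \<odot> B) (B \<odot> A) (\<sigma> (Car A) (Car B))"
proof (rule comon_homI)
  show "Comul (B \<odot> A) \<cdot> \<sigma> (Car A) (Car B) = (\<sigma> (Car A) (Car B) \<otimes> \<sigma> (Car A) (Car B)) \<cdot> Comul (A \<odot> B)"
    by (simp add: natural(3)[symmetric] Comp_reassoc[OF interchange_Braid])
  show "Counit (B \<odot> A) \<cdot> \<sigma> (Car A) (Car B) = Counit (A \<odot> B)"
    by (simp add: natural(3)[symmetric] Braid_unit_unit)
qed simp_all

section \<open>Projections, pairings and the universal property of the product\<close>

definition pr1 where "pr1 A B = \<rr> (Car A) \<cdot> (\<iota> (Car A) \<otimes> Counit B)"
definition pr2 where "pr2 A B = \<ll> (Car B) \<cdot> (Counit A \<otimes> \<iota> (Car B))"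
text \<open>On comonoid morphisms this is the pairing into the product. The formula also makes sense
  for arbitrary arrows, and is so used while the antipode is not yet known to be a comonoid
  morphism.\<close>

definition pair where "pair C f g = (f \<otimes> g) \<cdot> Comul C"

lemma pr_arr [simp]:
  assumes "coc_comonoid A" "coc_comonoid B"
  shows "pr1 A B \<in> Arr M" "Dom M (pr1 A B) = Car A \<boxtimes> Car B" "Cod M (pr1 A B) = Car A"
    "pr2 A B \<in> Arr M" "Dom M (pr2 A B) = Car A \<boxtimes> Car B" "Cod M (pr2 A B) = Car B"
  using assms by (simp_all add: pr1_def pr2_def)

lemma pair_arr [simp]:
  assumes "coc_comonoid C" "f \<in> Arr M" "g \<in> Arr M" "Dom M f = Car C" "Dom M g = Car C"
  shows "pair C f g \<in> Arr M" "Dom M (pair C f g) = Car C" "Cod M (pair C f g) = Cod M f \<boxtimes> Cod M g"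
  using assms by (simp_all add: pair_def)

lemma pr1_comon_hom:
  assumes [simp]: "coc_comonoid A" "coc_comonoid B"
  shows "comon_hom (A \<odot> B) A (pr1 A B)"
proof (rule comon_homI)
  let ?X = "Car A" and ?Y = "Car B" and ?d = "Comul A" and ?e = "Comul B" and ?u = "Counit A" and ?v = "Counit B"
  let ?t = "\<tau> ?X ?X ?Y ?Y"
  have "(pr1 A B \<otimes> pr1 A B) \<cdot> Comul (A \<odot> B) = (\<rr> ?X \<otimes> \<rr> ?X) \<cdot> (((\<iota> ?X \<otimes> ?v) \<otimes> (\<iota> ?X \<otimes> ?v)) \<cdot> ?t) \<cdot> (?d \<otimes> ?e)"
    by (simp add: pr1_def)
  also have "\<dots> = ((\<rr> ?X \<otimes> \<rr> ?X) \<cdot> \<tau> ?X ?X \<I> \<I>) \<cdot> (\<iota> (?X \<boxtimes> ?X) \<otimes> (?v \<otimes> ?v)) \<cdot> (?d \<otimes> ?e)"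
    by (subst interchange_natural[symmetric, where W' = ?X and X' = ?X and Y' = "\<I>" and Z' = "\<I>"]) simp_all
  also have "\<dots> = \<rr> (?X \<boxtimes> ?X) \<cdot> (?d \<otimes> (\<ll> \<I> \<cdot> (?v \<otimes> ?v) \<cdot> ?e))"
    by (subst Runit_interchange) simp_all
  also have "\<dots> = (\<rr> (?X \<boxtimes> ?X) \<cdot> (?d \<otimes> \<iota> \<I>)) \<cdot> (\<iota> ?X \<otimes> ?v)"
    by (simp add: Counit_Counit)
  also have "\<dots> = ?d \<cdot> pr1 A B"
    by (subst natural(2)[where X = ?X]) (simp_all add: pr1_def)
  finally show "Comul A \<cdot> pr1 A B = (pr1 A B \<otimes> pr1 A B) \<cdot> Comul (A \<odot> B)" ..
  have "?u \<cdot> pr1 A B = (\<rr> \<I> \<cdot> (?u \<otimes> \<iota> \<I>)) \<cdot> (\<iota> ?X \<otimes> ?v)"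
    by (subst natural(2)[where X = ?X]) (simp_all add: pr1_def)
  then show "?u \<cdot> pr1 A B = Counit (A \<odot> B)"
    by (simp add: Lunit_Runit_unit)
qed simp_all

lemma pr2_Braid:
  assumes [simp]: "coc_comonoid A" "coc_comonoid B"
  shows "pr2 A B = pr1 B A \<cdot> \<sigma> (Car A) (Car B)"
proof -
  have "pr1 B A \<cdot> \<sigma> (Car A) (Car B) = \<rr> (Car B) \<cdot> \<sigma> \<I> (Car B) \<cdot> (Counit A \<otimes> \<iota> (Car B))"
    by (simp add: pr1_def natural)
  then show ?thesis
    by (simp add: pr2_def Runit_Braid flip: Comp_assoc')
qed

lemma pr2_comon_hom: "coc_comonoid A \<Longrightarrow> coc_comonoid B \<Longrightarrow> comon_hom (A \<odot> B) B (pr2 A B)"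
  unfolding pr2_Braid by (rule comon_hom_comp[OF _ _ _ Braid_comon_hom pr1_comon_hom]) simp_all

lemma pair_comon_hom:
  assumes [simp]: "coc_comonoid A" "coc_comonoid B" "coc_comonoid C" and "comon_hom C A f" "comon_hom C B g"
  shows "comon_hom C (A \<odot> B) (pair C f g)"
proof (rule comon_homI)
  let ?X = "Car A" and ?Y = "Car B" and ?Z = "Car C" and ?d = "Comul C"
  note [simp] = comon_hom_arr(1-3)[OF assms(4)] comon_hom_arr(1-3)[OF assms(5)]
  note f = comon_hom_arr(4,5)[OF assms(4)] and g = comon_hom_arr(4,5)[OF assms(5)]
  have "Comul (A \<odot> B) \<cdot> pair C f g = (\<tau> ?X ?X ?Y ?Y \<cdot> ((f \<otimes> f) \<otimes> (g \<otimes> g))) \<cdot> (?d \<otimes> ?d) \<cdot> ?d"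
    by (simp add: pair_def f g)
  also have "\<dots> = ((f \<otimes> g) \<otimes> (f \<otimes> g)) \<cdot> (\<tau> ?Z ?Z ?Z ?Z \<cdot> (?d \<otimes> ?d) \<cdot> ?d)"
    by (subst interchange_natural[where W = ?Z and X = ?Z and Y = ?Z and Z = ?Z]) simp_all
  also have "\<dots> = (pair C f g \<otimes> pair C f g) \<cdot> ?d"
    by (subst Comul_Comul_interchange) (simp_all add: pair_def)
  finally show "Comul (A \<odot> B) \<cdot> pair C f g = (pair C f g \<otimes> pair C f g) \<cdot> ?d" .
  show "Counit (A \<odot> B) \<cdot> pair C f g = Counit C"
    by (simp add: pair_def f g Counit_Counit)
qed (use comon_hom_arr(1-3)[OF assms(4)] comon_hom_arr(1-3)[OF assms(5)] in simp_all)

lemma pr_pair: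
  assumes [simp]: "coc_comonoid A" "coc_comonoid B" "coc_comonoid C" and "comon_hom C A f" "comon_hom C B g"
  shows "pr1 A B \<cdot> pair C f g = f" "pr2 A B \<cdot> pair C f g = g"
proof -
  note [simp] = comon_hom_arr(1-3)[OF assms(4)] comon_hom_arr(1-3)[OF assms(5)]
  note f = comon_hom_arr(4,5)[OF assms(4)] and g = comon_hom_arr(4,5)[OF assms(5)]
  have "pr1 A B \<cdot> pair C f g = (\<rr> (Car A) \<cdot> (f \<otimes> \<iota> \<I>)) \<cdot> (\<iota> (Car C) \<otimes> Counit C) \<cdot> Comul C"
    by (simp add: pr1_def pair_def g)
  also have "\<dots> = f"
    by (subst natural(2)[where X = "Car C"]) (simp_all add: coc_comonoid_eq)
  finally show "pr1 A B \<cdot> pair C f g = f" .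
  have "pr2 A B \<cdot> pair C f g = (\<ll> (Car B) \<cdot> (\<iota> \<I> \<otimes> g)) \<cdot> (Counit C \<otimes> \<iota> (Car C)) \<cdot> Comul C"
    by (simp add: pr2_def pair_def f)
  also have "\<dots> = g"
    by (subst natural(1)[where X = "Car C"]) (simp_all add: coc_comonoid_eq)
  finally show "pr2 A B \<cdot> pair C f g = g" .
qed

text \<open>The uniqueness half of the universal property. Comultiplication produces both factors
  twice, and the projections erase one copy of each; moving the counits in front of the interchange
  leaves it exchanging two unit factors.\<close>

lemma pair_pr:
  assumes [simp]: "coc_comonoid A" "coc_comonoid B"
  shows "pair (A \<odot> B) (pr1 A B) (pr2 A B) = \<iota> (Car A \<boxtimes> Car B)"
proof -
  let ?X = "Car A" and ?Y = "Car B" and ?d = "Comul A" and ?e = "Comul B" and ?u = "Counit A" and ?v = "Counit B"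
  have "pair (A \<odot> B) (pr1 A B) (pr2 A B) = (\<rr> ?X \<otimes> \<ll> ?Y) \<cdot> (((\<iota> ?X \<otimes> ?v) \<otimes> (?u \<otimes> \<iota> ?Y)) \<cdot> \<tau> ?X ?X ?Y ?Y) \<cdot> (?d \<otimes> ?e)"
    by (simp add: pair_def pr1_def pr2_def)
  also have "\<dots> = ((\<rr> ?X \<otimes> \<ll> ?Y) \<cdot> \<tau> ?X \<I> \<I> ?Y) \<cdot> ((\<iota> ?X \<otimes> ?u) \<otimes> (?v \<otimes> \<iota> ?Y)) \<cdot> (?d \<otimes> ?e)"
    by (subst interchange_natural[symmetric, where W' = ?X and X' = "\<I>" and Y' = "\<I>" and Z' = ?Y]) simp_all
  also have "\<dots> = \<iota> (?X \<boxtimes> ?Y)"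
    by (subst Runit_Lunit_interchange) (simp_all add: coc_comonoid_eq)
  finally show ?thesis .
qed

lemma pair_comp:
  assumes "coc_comonoid C" "coc_comonoid D" "comon_hom D C h" "f \<in> Arr M" "g \<in> Arr M" "Dom M f = Car C" "Dom M g = Car C"
  shows "pair C f g \<cdot> h = pair D (f \<cdot> h) (g \<cdot> h)"
  using assms comon_hom_arr[OF assms(3)] by (simp add: pair_def)

lemma tensor_pair:
  assumes "coc_comonoid C" "x \<in> Arr M" "y \<in> Arr M" "f \<in> Arr M" "g \<in> Arr M" "Dom M x = Car C" "Dom M y = Car C"
    "Dom M f = Cod M x" "Dom M g = Cod M y"
  shows "(f \<otimes> g) \<cdot> pair C x y = pair C (f \<cdot> x) (g \<cdot> y)"
  using assms by (simp add: pair_def)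

lemma pair_eta:
  assumes "coc_comonoid A" "coc_comonoid B" "coc_comonoid C" "comon_hom C (A \<odot> B) h"
  shows "pair C (pr1 A B \<cdot> h) (pr2 A B \<cdot> h) = h"
  using pair_comp[of "A \<odot> B" C h "pr1 A B" "pr2 A B"] assms comon_hom_arr[OF assms(4)] by (simp add: pair_pr)

text \<open>Coassociativity of \<open>C\<close>, transported along the naturality of the associator.
  Together with \<open>Braid_pair\<close> and \<open>unit_pair\<close> it replaces structure arrows
  by a rearrangement of components.\<close>

lemma Assoc_pair:
  assumes [simp]: "coc_comonoid C" "x \<in> Arr M" "y \<in> Arr M" "z \<in> Arr M" "Dom M x = Car C" "Dom M y = Car C" "Dom M z = Car C"
    "Cod M x = X" "Cod M y = Y" "Cod M z = Z"
  shows "\<alpha> X Y Z \<cdot> pair C (pair C x y) z = pair C x (pair C y z)"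
proof -
  have "\<alpha> X Y Z \<cdot> pair C (pair C x y) z = (\<alpha> X Y Z \<cdot> ((x \<otimes> y) \<otimes> z)) \<cdot> (Comul C \<otimes> \<iota> (Car C)) \<cdot> Comul C"
    using Dom_Cod_Obj(2)[of x] Dom_Cod_Obj(2)[of y] Dom_Cod_Obj(2)[of z] by (simp add: pair_def)
  also have "\<dots> = (x \<otimes> (y \<otimes> z)) \<cdot> (\<alpha> (Car C) (Car C) (Car C) \<cdot> (Comul C \<otimes> \<iota> (Car C)) \<cdot> Comul C)"
    by (subst natural(4)[where X = "Car C" and Y = "Car C" and Z = "Car C"]) simp_all
  also have "\<dots> = pair C x (pair C y z)"
    by (subst coc_comonoid_eq) (simp_all add: pair_def)
  finally show ?thesis .
qed

lemma Braid_pair: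
  assumes [simp]: "coc_comonoid C" "x \<in> Arr M" "y \<in> Arr M" "Dom M x = Car C" "Dom M y = Car C" "Cod M x = X" "Cod M y = Y"
  shows "\<sigma> X Y \<cdot> pair C x y = pair C y x"
proof -
  have [simp]: "X \<in> Obj M" "Y \<in> Obj M"
    using Dom_Cod_Obj(2)[of x] Dom_Cod_Obj(2)[of y] by simp_all
  have "\<sigma> X Y \<cdot> pair C x y = (\<sigma> X Y \<cdot> (x \<otimes> y)) \<cdot> Comul C"
    by (simp add: pair_def)
  also have "\<dots> = (y \<otimes> x) \<cdot> (\<sigma> (Car C) (Car C) \<cdot> Comul C)"
    by (subst natural(3)[where X = "Car C" and Y = "Car C"]) simp_all
  also have "\<dots> = pair C y x"
    by (simp add: pair_def coc_comonoid_eq)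
  finally show ?thesis .
qed

lemma unit_pair:
  assumes [simp]: "coc_comonoid C" "x \<in> Arr M" "Dom M x = Car C" "Cod M x = X"
  shows "\<ll> X \<cdot> pair C (Counit C) x = x" "\<rr> X \<cdot> pair C x (Counit C) = x"
proof -
  have [simp]: "X \<in> Obj M"
    using Dom_Cod_Obj(2)[of x] by simp
  have "\<ll> X \<cdot> pair C (Counit C) x = (\<ll> X \<cdot> (\<iota> \<I> \<otimes> x)) \<cdot> (Counit C \<otimes> \<iota> (Car C)) \<cdot> Comul C"
    by (simp add: pair_def)
  also have "\<dots> = x"
    by (subst natural(1)[where X = "Car C"]) (simp_all add: coc_comonoid_eq)
  finally show "\<ll> X \<cdot> pair C (Counit C) x = x" .
  have "\<rr> X \<cdot> pair C x (Counit C) = (\<rr> X \<cdot> (x \<otimes> \<iota> \<I>)) \<cdot> (\<iota> (Car C) \<otimes> Counit C) \<cdot> Comul C"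
    by (simp add: pair_def)
  also have "\<dots> = x"
    by (subst natural(2)[where X = "Car C"]) (simp_all add: coc_comonoid_eq)
  finally show "\<rr> X \<cdot> pair C x (Counit C) = x" .
qed

section \<open>Convolution groups and the antipode\<close>

lemma Comul_pair:
  assumes "coc_comonoid A" "coc_comonoid C" "comon_hom C A x"
  shows "Comul A \<cdot> x = pair C x x"
  using comon_hom_arr(4)[OF assms(3)] by (simp add: pair_def)

text \<open>The second projection only applies a counit to the first component, so \<open>y\<close>
  may be any arrow. This allows the antipode to be read off from a pair.\<close>

lemma pr2_pair_arr:
  assumes [simp]: "coc_comonoid A" "coc_comonoid B" "coc_comonoid C" and x: "comon_hom C A x" and [simp]: "y \<in> Arr M" "Dom M y = Car C" "Cod M y = Car B"
  shows "pr2 A B \<cdot> pair C x y = y"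
proof -
  note [simp] = comon_hom_arr(1-3)[OF x]
  have "pr2 A B \<cdot> pair C x y = \<ll> (Car B) \<cdot> pair C (Counit A \<cdot> x) y"
    by (simp add: pr2_def tensor_pair)
  then show ?thesis
    by (simp add: comon_hom_arr(5)[OF x] unit_pair)
qed

lemma Counit_comon_hom [simp]:
  assumes [simp]: "coc_comonoid C"
  shows "comon_hom C unit_comonoid (Counit C)"
proof (rule comon_homI)
  have "inverse_arrow M (\<ll> \<I>) \<cdot> Counit C = inverse_arrow M (\<ll> \<I>) \<cdot> (\<ll> \<I> \<cdot> (Counit C \<otimes> Counit C) \<cdot> Comul C)"
    by (simp only: Counit_Counit assms)
  also have "\<dots> = (Counit C \<otimes> Counit C) \<cdot> Comul C"
    by (simp flip: Comp_assoc'[of _ "\<ll> \<I>"])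
  finally show "Comul unit_comonoid \<cdot> Counit C = (Counit C \<otimes> Counit C) \<cdot> Comul C"
    by simp
qed simp_all

lemma comon_hom_unit_unique: "comon_hom C unit_comonoid f \<Longrightarrow> f = Counit C"
  using comon_hom_arr[of C unit_comonoid f] by simp

lemma comon_hom_inverse:
  assumes "coc_comonoid A" "coc_comonoid B" "comon_hom A B f" "g \<in> Arr M" "Dom M g = Car B" "Cod M g = Car A"
    "g \<cdot> f = \<iota> (Car A)" "f \<cdot> g = \<iota> (Car B)"
  shows "comon_hom B A g"
proof (rule comon_homI)
  note [simp] = assms(1,2,4-8) comon_hom_arr(1-3)[OF assms(3)]
  have "(g \<otimes> g) \<cdot> Comul B = (g \<otimes> g) \<cdot> (Comul B \<cdot> f) \<cdot> g"
    by simp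
  also have "\<dots> = Comul A \<cdot> g"
    unfolding comon_hom_arr(4)[OF assms(3)] by simp
  finally show "Comul A \<cdot> g = (g \<otimes> g) \<cdot> Comul B" ..
  have "Counit A \<cdot> g = (Counit B \<cdot> f) \<cdot> g"
    by (simp only: comon_hom_arr(5)[OF assms(3)])
  then show "Counit A \<cdot> g = Counit B"
    by simp
qed (use assms in simp_all)

definition hopf :: "('o, 'm, 'y) hopf_data_scheme \<Rightarrow> bool" where
  "hopf H \<longleftrightarrow> is_hopf_monoid M H \<and> cocommutative M H"

lemma hopf_coc_comonoid [simp]: "hopf H \<Longrightarrow> coc_comonoid H"
  by (simp add: hopf_def coc_comonoid_def is_hopf_monoid_def is_bimonoid_def)

lemma hopf_arr [simp]:
  assumes "hopf H"
  shows "Mul H \<in> Arr M" "Dom M (Mul H) = Car H \<boxtimes> Car H" "Cod M (Mul H) = Car H"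
    "Unt H \<in> Arr M" "Dom M (Unt H) = \<I>" "Cod M (Unt H) = Car H"
    "Antipode H \<in> Arr M" "Dom M (Antipode H) = Car H" "Cod M (Antipode H) = Car H"
  using assms by (auto simp: hopf_def is_hopf_monoid_def is_bimonoid_def is_monoid_def Let_def Hom_iff)

text \<open>Exactly the bimonoid axioms relating \<open>Mul\<close> to \<open>Comul\<close> and
  \<open>Counit\<close>, because the comonoid \<open>H \<odot> H\<close> is built with the same
  interchange.\<close>

lemma Mul_comon_hom [simp]: "hopf H \<Longrightarrow> comon_hom (H \<odot> H) H (Mul H)"
  by (rule comon_homI) (auto simp: hopf_def is_hopf_monoid_def is_bimonoid_def Let_def)

lemma Unt_comon_hom [simp]: "hopf H \<Longrightarrow> comon_hom unit_comonoid H (Unt H)"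
  by (rule comon_homI) (auto simp: hopf_def is_hopf_monoid_def is_bimonoid_def Let_def)

definition conv where "conv H C x y = Mul H \<cdot> pair C x y"
definition conv_one where "conv_one H C = Unt H \<cdot> Counit C"

lemma conv_arr [simp]:
  assumes "hopf H" "coc_comonoid C"
  shows "conv_one H C \<in> Arr M" "Dom M (conv_one H C) = Car C" "Cod M (conv_one H C) = Car H"
    "\<lbrakk>x \<in> Arr M; y \<in> Arr M; Dom M x = Car C; Dom M y = Car C; Cod M x = Car H; Cod M y = Car H\<rbrakk>
      \<Longrightarrow> conv H C x y \<in> Arr M \<and> Dom M (conv H C x y) = Car C \<and> Cod M (conv H C x y) = Car H"
  using assms by (simp_all add: conv_one_def conv_def)

lemma conv_assoc:
  assumes H [simp]: "hopf H" and [simp]: "coc_comonoid C" "x \<in> Arr M" "y \<in> Arr M" "z \<in> Arr M"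
    "Dom M x = Car C" "Dom M y = Car C" "Dom M z = Car C"
    "Cod M x = Car H" "Cod M y = Car H" "Cod M z = Car H"
  shows "conv H C (conv H C x y) z = conv H C x (conv H C y z)"
proof -
  let ?X = "Car H"
  have "Mul H \<cdot> (Mul H \<otimes> \<iota> ?X) = Mul H \<cdot> (\<iota> ?X \<otimes> Mul H) \<cdot> \<alpha> ?X ?X ?X"
    using H by (simp add: hopf_def is_hopf_monoid_def is_bimonoid_def is_monoid_def Let_def)
  then have "(Mul H \<cdot> (Mul H \<otimes> \<iota> ?X)) \<cdot> pair C (pair C x y) z = (Mul H \<cdot> (\<iota> ?X \<otimes> Mul H) \<cdot> \<alpha> ?X ?X ?X) \<cdot> pair C (pair C x y) z"
    by simp
  then show ?thesis
    by (simp add: Assoc_pair tensor_pair conv_def)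
qed

lemma conv_one [simp]:
  assumes H [simp]: "hopf H" and [simp]: "coc_comonoid C" "x \<in> Arr M" "Dom M x = Car C" "Cod M x = Car H"
  shows "conv H C (conv_one H C) x = x" "conv H C x (conv_one H C) = x"
proof -
  let ?X = "Car H"
  have u: "Mul H \<cdot> (Unt H \<otimes> \<iota> ?X) = \<ll> ?X" "Mul H \<cdot> (\<iota> ?X \<otimes> Unt H) = \<rr> ?X"
    using H by (simp_all add: hopf_def is_hopf_monoid_def is_bimonoid_def is_monoid_def Let_def)
  have "conv H C (conv_one H C) x = (Mul H \<cdot> (Unt H \<otimes> \<iota> ?X)) \<cdot> pair C (Counit C) x"
    by (simp add: conv_def conv_one_def tensor_pair)
  then show "conv H C (conv_one H C) x = x"
    by (simp only: u) (simp add: unit_pair)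
  have "conv H C x (conv_one H C) = (Mul H \<cdot> (\<iota> ?X \<otimes> Unt H)) \<cdot> pair C x (Counit C)"
    by (simp add: conv_def conv_one_def tensor_pair)
  then show "conv H C x (conv_one H C) = x"
    by (simp only: u) (simp add: unit_pair)
qed

text \<open>The antipode axioms composed with \<open>x\<close>. That \<open>x\<close> is a comonoid
  morphism is what turns \<open>Comul H \<cdot> x\<close> into the pair of \<open>x\<close> with
  itself.\<close>

lemma conv_antipode:
  assumes H [simp]: "hopf H" and [simp]: "coc_comonoid C" and x: "comon_hom C H x"
  shows "conv H C (Antipode H \<cdot> x) x = conv_one H C" "conv H C x (Antipode H \<cdot> x) = conv_one H C"
proof -
  note [simp] = comon_hom_arr(1-3)[OF x]
  have s: "Mul H \<cdot> (Antipode H \<otimes> \<iota> (Car H)) \<cdot> Comul H = Unt H \<cdot> Counit H"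
    "Mul H \<cdot> (\<iota> (Car H) \<otimes> Antipode H) \<cdot> Comul H = Unt H \<cdot> Counit H"
    using H by (simp_all add: hopf_def is_hopf_monoid_def)
  have one: "(Unt H \<cdot> Counit H) \<cdot> x = conv_one H C"
    by (simp add: conv_one_def comon_hom_arr(5)[OF x])
  have "conv H C (Antipode H \<cdot> x) x = (Mul H \<cdot> (Antipode H \<otimes> \<iota> (Car H)) \<cdot> Comul H) \<cdot> x"
    by (simp add: conv_def tensor_pair Comul_pair[OF _ _ x])
  then show "conv H C (Antipode H \<cdot> x) x = conv_one H C"
    unfolding s one .
  have "conv H C x (Antipode H \<cdot> x) = (Mul H \<cdot> (\<iota> (Car H) \<otimes> Antipode H) \<cdot> Comul H) \<cdot> x"
    by (simp add: conv_def tensor_pair Comul_pair[OF _ _ x])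
  then show "conv H C x (Antipode H \<cdot> x) = conv_one H C"
    unfolding s one .
qed

lemma conv_comp:
  assumes "hopf H" "coc_comonoid C" "coc_comonoid D" "comon_hom D C h" "x \<in> Arr M" "y \<in> Arr M" "Dom M x = Car C" "Dom M y = Car C"
    "Cod M x = Car H" "Cod M y = Car H"
  shows "conv H C x y \<cdot> h = conv H D (x \<cdot> h) (y \<cdot> h)"
  using assms comon_hom_arr(1-3)[OF assms(4)] by (simp add: conv_def flip: pair_comp[OF _ _ assms(4)])

lemma conv_one_comp:
  assumes "hopf H" "coc_comonoid C" "coc_comonoid D" "comon_hom D C h"
  shows "conv_one H C \<cdot> h = conv_one H D"
  using assms comon_hom_arr[OF assms(4)] by (simp add: conv_one_def)

text \<open>In terms of elements, \<open>shear H f\<close> sends \<open>(a, b)\<close> to \<open>(a, f(a) b)\<close>. Since \<open>f \<mapsto> shear H f\<close> turns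
  convolution into composition, \<open>shear H (Antipode H)\<close> is the inverse of the comonoid isomorphism
  \<open>shear H (\<iota> (Car H))\<close>, and this makes the antipode a comonoid morphism.\<close>

definition shear where
  "shear H f = (\<iota> (Car H) \<otimes> (Mul H \<cdot> (f \<otimes> \<iota> (Car H)))) \<cdot> \<alpha> (Car H) (Car H) (Car H) \<cdot> (Comul H \<otimes> \<iota> (Car H))"

lemma shear_arr [simp]:
  assumes "hopf H" "f \<in> Arr M" "Dom M f = Car H" "Cod M f = Car H"
  shows "shear H f \<in> Arr M" "Dom M (shear H f) = Car H \<boxtimes> Car H" "Cod M (shear H f) = Car H \<boxtimes> Car H"
  using assms by (simp_all add: shear_def)

lemma shear_pair:
  assumes "hopf H" "coc_comonoid C" "comon_hom C H x" "y \<in> Arr M" "Dom M y = Car C" "Cod M y = Car H"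
    "f \<in> Arr M" "Dom M f = Car H" "Cod M f = Car H"
  shows "shear H f \<cdot> pair C x y = pair C x (conv H C (f \<cdot> x) y)"
  using assms comon_hom_arr(1-3)[OF assms(3)] by (simp add: shear_def tensor_pair Comul_pair Assoc_pair conv_def)

lemma shear_eq:
  assumes [simp]: "hopf H" "f \<in> Arr M" "Dom M f = Car H" "Cod M f = Car H"
  shows "shear H f = pair (H \<odot> H) (pr1 H H) (conv H (H \<odot> H) (f \<cdot> pr1 H H) (pr2 H H))"
  using shear_pair[of H "H \<odot> H" "pr1 H H" "pr2 H H" f] by (simp add: pair_pr pr1_comon_hom)

text \<open>On elements, (a, b) goes to (a, g(a) b) and then to (a, f(a) (g(a) b)), so the claim is
  associativity of convolution. The first component has to be a comonoid morphism, but
  \<open>f\<close> and \<open>g\<close> need not be.\<close>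

lemma shear_shear:
  assumes [simp]: "hopf H" "f \<in> Arr M" "Dom M f = Car H" "Cod M f = Car H" "g \<in> Arr M" "Dom M g = Car H" "Cod M g = Car H"
  shows "shear H f \<cdot> shear H g = shear H (conv H H f g)"
  by (simp add: shear_eq[of H g] shear_eq[of H "conv H H f g"] shear_pair pr1_comon_hom conv_comp[OF _ _ _ pr1_comon_hom] conv_assoc)

lemma shear_one [simp]:
  assumes [simp]: "hopf H"
  shows "shear H (conv_one H H) = \<iota> (Car H \<boxtimes> Car H)"
  using conv_one_comp[of H H "H \<odot> H" "pr1 H H"] by (simp add: shear_eq pr1_comon_hom pair_pr)

lemma conv_comon_hom [simp]:
  assumes "hopf H" "coc_comonoid C" "comon_hom C H x" "comon_hom C H y"
  shows "comon_hom C H (conv H C x y)"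
  unfolding conv_def using assms by (intro comon_hom_comp[of C "H \<odot> H"] pair_comon_hom) simp_all

lemma conv_one_comon_hom [simp]: "hopf H \<Longrightarrow> coc_comonoid C \<Longrightarrow> comon_hom C H (conv_one H C)"
  unfolding conv_one_def by (rule comon_hom_comp[of C unit_comonoid]) simp_all

lemma Antipode_comon_hom [simp]:
  assumes [simp]: "hopf H"
  shows "comon_hom H H (Antipode H)"
proof -
  \<comment> \<open>\<open>?j\<close> is the element (a, 1) at the generic a. The shear by the
    antipode sends it to (a, S(a)), whose second component is the antipode.\<close>
  let ?S = "Antipode H" and ?i = "\<iota> (Car H)" and ?j = "pair H (\<iota> (Car H)) (conv_one H H)"
  have s: "conv H H ?S ?i = conv_one H H" "conv H H ?i ?S = conv_one H H"
    using conv_antipode[of H H ?i] by simp_all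
  \<comment> \<open>This is (a, b) |-> (a, a b), assembled from projections and multiplication,
    which are already known to be comonoid morphisms.\<close>
  have "comon_hom (H \<odot> H) (H \<odot> H) (shear H ?i)"
    by (simp add: shear_eq) (intro pair_comon_hom conv_comon_hom; simp add: pr1_comon_hom pr2_comon_hom)
  then have "comon_hom (H \<odot> H) (H \<odot> H) (shear H ?S)"
    by (rule comon_hom_inverse[rotated 2]) (simp_all add: shear_shear s)
  then have "comon_hom H H (pr2 H H \<cdot> (shear H ?S \<cdot> ?j))"
    by (intro comon_hom_comp[of H "H \<odot> H" H] comon_hom_comp[of H "H \<odot> H" "H \<odot> H"] pair_comon_hom pr2_comon_hom) simp_all
  then show ?thesis
    by (simp add: shear_pair pr2_pair_arr)
qed

section \<open>Groups of elements, and Hopf monoids from group laws on elements\<close>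

definition elements where
  "elements C H = \<lparr>carrier = {x. comon_hom C H x}, monoid.mult = conv H C, one = conv_one H C\<rparr>"

lemma elements_sel [simp]:
  "carrier (elements C H) = {x. comon_hom C H x}" "monoid.mult (elements C H) = conv H C" "one (elements C H) = conv_one H C"
  by (simp_all add: elements_def)

lemma Antipode_comp_comon_hom [simp]: "hopf H \<Longrightarrow> coc_comonoid C \<Longrightarrow> comon_hom C H x \<Longrightarrow> comon_hom C H (Antipode H \<cdot> x)"
  by (rule comon_hom_comp[of C H]) simp_all

lemma group_elements:
  assumes "hopf H" "coc_comonoid C"
  shows "group (elements C H)"
proof (rule groupI)
  fix x assume x: "x \<in> carrier (elements C H)"
  then show "\<exists>y \<in> carrier (elements C H). monoid.mult (elements C H) y x = one (elements C H)"
    using assms by (intro bexI[of _ "Antipode H \<cdot> x"]) (simp_all add: conv_antipode)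
qed (use assms in \<open>auto simp: conv_assoc comon_hom_arr(1-3)\<close>)

text \<open>The Yoneda argument: laws that hold for the elements at every \<open>C\<close> hold for
  the generic ones, and there they are the axioms between arrows. The assumptions on
  \<open>Mul\<close> and \<open>Unt\<close> as comonoid morphisms supply the bimonoid
  compatibilities.\<close>

lemma hopfI:
  fixes P :: "('o, 'm, 'y) hopf_data_scheme"
  assumes [simp]: "coc_comonoid P" "comon_hom (P \<odot> P) P (Mul P)" "comon_hom unit_comonoid P (Unt P)" "comon_hom P P (Antipode P)"
    and assoc: "\<And>C :: ('o, 'm) comonoid_data. \<And>x y z. \<lbrakk>coc_comonoid C; comon_hom C P x; comon_hom C P y; comon_hom C P z\<rbrakk>
      \<Longrightarrow> conv P C (conv P C x y) z = conv P C x (conv P C y z)"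
    and one: "\<And>C :: ('o, 'm) comonoid_data. \<And>x. \<lbrakk>coc_comonoid C; comon_hom C P x\<rbrakk>
      \<Longrightarrow> conv P C (conv_one P C) x = x \<and> conv P C x (conv_one P C) = x"
    and antipode: "\<And>C :: ('o, 'm) comonoid_data. \<And>x. \<lbrakk>coc_comonoid C; comon_hom C P x\<rbrakk>
      \<Longrightarrow> conv P C (Antipode P \<cdot> x) x = conv_one P C \<and> conv P C x (Antipode P \<cdot> x) = conv_one P C"
  shows "hopf P"
proof -
  let ?X = "Car P" and ?m = "Mul P" and ?u = "Unt P"
  note m = comon_hom_arr[OF assms(2)] and u = comon_hom_arr[OF assms(3)] and S = comon_hom_arr[OF assms(4)]
  note [simp] = m(1,2,3)[simplified] u(1,2,3)[simplified] S(1-3)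
  have 1: "?m \<cdot> (?m \<otimes> \<iota> ?X) = ?m \<cdot> (\<iota> ?X \<otimes> ?m) \<cdot> \<alpha> ?X ?X ?X"
  proof -
    let ?C = "(P \<odot> P) \<odot> P"
    let ?p = "pr1 (P \<odot> P) P" and ?z = "pr2 (P \<odot> P) P"
    let ?x = "pr1 P P \<cdot> ?p" and ?y = "pr2 P P \<cdot> ?p"
    have p: "comon_hom ?C (P \<odot> P) ?p" and [simp]: "comon_hom ?C P ?z"
      by (simp_all add: pr1_comon_hom pr2_comon_hom)
    have [simp]: "comon_hom ?C P ?x" "comon_hom ?C P ?y"
      by (rule comon_hom_comp[OF _ _ _ p]; simp add: pr1_comon_hom pr2_comon_hom)+
    \<comment> \<open>\<open>?x\<close>, \<open>?y\<close>, \<open>?z\<close> form the generic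
      triple: assembled again, they give the identity, so evaluating an arrow at them returns the
      arrow.\<close>
    have id: "pair ?C (pair ?C ?x ?y) ?z = \<iota> ((?X \<boxtimes> ?X) \<boxtimes> ?X)"
      by (subst pair_eta[OF _ _ _ p]) (simp_all add: pair_pr)
    have "?m \<cdot> (?m \<otimes> \<iota> ?X) = ?m \<cdot> (?m \<otimes> \<iota> ?X) \<cdot> pair ?C (pair ?C ?x ?y) ?z"
      by (simp add: id)
    also have "\<dots> = conv P ?C (conv P ?C ?x ?y) ?z"
      by (simp add: conv_def tensor_pair)
    also have "\<dots> = conv P ?C ?x (conv P ?C ?y ?z)"
      by (rule assoc) simp_all
    also have "\<dots> = (?m \<cdot> (\<iota> ?X \<otimes> ?m) \<cdot> \<alpha> ?X ?X ?X) \<cdot> pair ?C (pair ?C ?x ?y) ?z"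
      by (simp add: conv_def tensor_pair Assoc_pair)
    also have "\<dots> = ?m \<cdot> (\<iota> ?X \<otimes> ?m) \<cdot> \<alpha> ?X ?X ?X"
      by (simp add: id)
    finally show ?thesis .
  qed
  have 2: "?m \<cdot> (?u \<otimes> \<iota> ?X) = \<ll> ?X"
  proof -
    let ?C = "unit_comonoid \<odot> P"
    have "?m \<cdot> (?u \<otimes> \<iota> ?X) = ?m \<cdot> (?u \<otimes> \<iota> ?X) \<cdot> pair ?C (pr1 unit_comonoid P) (pr2 unit_comonoid P)"
      by (simp add: pair_pr)
    also have "\<dots> = conv P ?C (?u \<cdot> pr1 unit_comonoid P) (pr2 unit_comonoid P)"
      by (simp add: conv_def tensor_pair)
    \<comment> \<open>The unit comonoid is terminal, so this projection is the counit, and composing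
      it with \<open>Unt P\<close> gives the neutral element at \<open>?C\<close>.\<close>
    also have "pr1 unit_comonoid P = Counit ?C"
      by (rule comon_hom_unit_unique) (simp add: pr1_comon_hom)
    also have "conv P ?C (?u \<cdot> Counit ?C) (pr2 unit_comonoid P) = pr2 unit_comonoid P"
      using one[of ?C] by (simp add: pr2_comon_hom conv_one_def)
    finally show ?thesis
      by (simp add: pr2_def)
  qed
  have 3: "?m \<cdot> (\<iota> ?X \<otimes> ?u) = \<rr> ?X"
  proof -
    let ?C = "P \<odot> unit_comonoid"
    have "?m \<cdot> (\<iota> ?X \<otimes> ?u) = ?m \<cdot> (\<iota> ?X \<otimes> ?u) \<cdot> pair ?C (pr1 P unit_comonoid) (pr2 P unit_comonoid)"
      by (simp add: pair_pr)
    also have "\<dots> = conv P ?C (pr1 P unit_comonoid) (?u \<cdot> pr2 P unit_comonoid)"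
      by (simp add: conv_def tensor_pair)
    also have "pr2 P unit_comonoid = Counit ?C"
      by (rule comon_hom_unit_unique) (simp add: pr2_comon_hom)
    also have "conv P ?C (pr1 P unit_comonoid) (?u \<cdot> Counit ?C) = pr1 P unit_comonoid"
      using one[of ?C] by (simp add: pr1_comon_hom conv_one_def)
    finally show ?thesis
      by (simp add: pr1_def)
  qed
  \<comment> \<open>The laws are assumed only for \<open>C\<close> a plain
    \<open>comonoid_data\<close>, so the antipode law is evaluated at the identity of the underlying
    comonoid of \<open>P\<close>, which carries the same data.\<close>
  let ?C = "comonoid_data.truncate P"
  have C: "Car ?C = Car P" "Comul ?C = Comul P" "Counit ?C = Counit P"
    by (simp_all add: comonoid_data.truncate_def)
  have "coc_comonoid ?C"
    using assms(1) unfolding coc_comonoid_def is_comonoid_def cocommutative_def C .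
  moreover have "comon_hom ?C P (\<iota> ?X)"
    using comon_hom_Id[OF assms(1)] unfolding comonoid_morphism_def C .
  ultimately have 4: "conv P ?C (Antipode P) (\<iota> ?X) = conv_one P ?C" "conv P ?C (\<iota> ?X) (Antipode P) = conv_one P ?C"
    using antipode[of ?C "\<iota> ?X"] by simp_all
  have 5: "?m \<cdot> (Antipode P \<otimes> \<iota> ?X) \<cdot> Comul P = ?u \<cdot> Counit P" "?m \<cdot> (\<iota> ?X \<otimes> Antipode P) \<cdot> Comul P = ?u \<cdot> Counit P"
    using 4 by (simp_all add: conv_def conv_one_def pair_def C)
  show ?thesis
    using assms(1) m u S 1 2 3 5
    by (simp add: hopf_def is_hopf_monoid_def is_bimonoid_def is_monoid_def coc_comonoid_def Let_def Hom_iff)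
qed

section \<open>Tensor products and morphisms of Hopf monoids\<close>

definition unit_hopf :: "('o, 'm) hopf_data" where
  "unit_hopf = \<lparr>Car = \<I>, Comul = inverse_arrow M (\<ll> \<I>), Counit = \<iota> \<I>, Mul = \<ll> \<I>, Unt = \<iota> \<I>, Antipode = \<iota> \<I>\<rparr>"

lemma unit_hopf_sel [simp]:
  "Car unit_hopf = \<I>" "Comul unit_hopf = inverse_arrow M (\<ll> \<I>)" "Counit unit_hopf = \<iota> \<I>"
  "Mul unit_hopf = \<ll> \<I>" "Unt unit_hopf = \<iota> \<I>" "Antipode unit_hopf = \<iota> \<I>"
  by (simp_all add: unit_hopf_def)

lemma unit_hopf_comonoid [simp]:
  "coc_comonoid unit_hopf" "comon_hom A unit_hopf f \<longleftrightarrow> comon_hom A unit_comonoid f" "comon_hom unit_hopf A f \<longleftrightarrow> comon_hom unit_comonoid A f"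
  "unit_hopf \<odot> unit_hopf = unit_comonoid \<odot> unit_comonoid"
  using coc_comonoid_unit unfolding coc_comonoid_def is_comonoid_def cocommutative_def
  by (simp_all add: comonoid_morphism_def tensor_comonoid_def)

text \<open>The unit comonoid is terminal, so each \<open>C\<close> has exactly one element in it
  and the group laws hold trivially.\<close>

lemma hopf_unit [simp]: "hopf unit_hopf"
proof (rule hopfI)
  have m: "comon_hom (unit_comonoid \<odot> unit_comonoid) unit_comonoid (\<ll> \<I>)"
    using pr2_comon_hom[of unit_comonoid unit_comonoid] by (simp add: pr2_def)
  then show "comon_hom (unit_hopf \<odot> unit_hopf) unit_hopf (Mul unit_hopf)"
    by simp
  show "comon_hom unit_comonoid unit_hopf (Unt unit_hopf)" "comon_hom unit_hopf unit_hopf (Antipode unit_hopf)"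
    using comon_hom_Id[of unit_comonoid] by simp_all
  fix C :: "('o, 'm) comonoid_data" and x y z
  assume [simp]: "coc_comonoid C"
  have conv: "conv unit_hopf C f g = Counit C" if "comon_hom C unit_comonoid f" "comon_hom C unit_comonoid g" for f g
    unfolding conv_def using that m
    by (intro comon_hom_unit_unique) (auto intro!: comon_hom_comp[of C "unit_comonoid \<odot> unit_comonoid"] pair_comon_hom)
  have one: "conv_one unit_hopf C = Counit C"
    by (simp add: conv_one_def)
  show "conv unit_hopf C (conv_one unit_hopf C) x = x \<and> conv unit_hopf C x (conv_one unit_hopf C) = x" if "comon_hom C unit_hopf x"
    using that by (auto simp: conv one dest: comon_hom_unit_unique)
  show "conv unit_hopf C (Antipode unit_hopf \<cdot> x) x = conv_one unit_hopf C \<and> conv unit_hopf C x (Antipode unit_hopf \<cdot> x) = conv_one unit_hopf C"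
    if "comon_hom C unit_hopf x"
    using that comon_hom_arr(1-3)[OF that] by (simp add: conv one)
  show "conv unit_hopf C (conv unit_hopf C x y) z = conv unit_hopf C x (conv unit_hopf C y z)"
    if "comon_hom C unit_hopf x" "comon_hom C unit_hopf y" "comon_hom C unit_hopf z"
    using that by (simp add: conv)
qed simp_all

text \<open>The product of two group objects. The operations are given by their components instead
  of through \<open>interchange\<close>, so that the group laws on elements reduce to those of the
  factors.\<close>

definition tensor_hopf :: "('o, 'm) hopf_data \<Rightarrow> ('o, 'm) hopf_data \<Rightarrow> ('o, 'm) hopf_data" (infixl "\<boxdot>" 70) where
  "A \<boxdot> B = (let P = A \<odot> B; PP = P \<odot> P in
    \<lparr>Car = Car P, Comul = Comul P, Counit = Counit P,
      Mul = pair PP (conv A PP (pr1 A B \<cdot> pr1 P P) (pr1 A B \<cdot> pr2 P P)) (conv B PP (pr2 A B \<cdot> pr1 P P) (pr2 A B \<cdot> pr2 P P)),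
      Unt = pair unit_comonoid (Unt A) (Unt B),
      Antipode = pair P (Antipode A \<cdot> pr1 A B) (Antipode B \<cdot> pr2 A B)\<rparr>)"

lemma tensor_hopf_sel:
  "Car (A \<boxdot> B) = Car (A \<odot> B)" "Comul (A \<boxdot> B) = Comul (A \<odot> B)" "Counit (A \<boxdot> B) = Counit (A \<odot> B)"
  "Unt (A \<boxdot> B) = pair unit_comonoid (Unt A) (Unt B)"
  "Antipode (A \<boxdot> B) = pair (A \<odot> B) (Antipode A \<cdot> pr1 A B) (Antipode B \<cdot> pr2 A B)"
  by (simp_all add: tensor_hopf_def Let_def)

lemma Mul_tensor_hopf:
  "Mul (A \<boxdot> B) = pair ((A \<odot> B) \<odot> (A \<odot> B))
    (conv A ((A \<odot> B) \<odot> (A \<odot> B)) (pr1 A B \<cdot> pr1 (A \<odot> B) (A \<odot> B)) (pr1 A B \<cdot> pr2 (A \<odot> B) (A \<odot> B)))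
    (conv B ((A \<odot> B) \<odot> (A \<odot> B)) (pr2 A B \<cdot> pr1 (A \<odot> B) (A \<odot> B)) (pr2 A B \<cdot> pr2 (A \<odot> B) (A \<odot> B)))"
  by (simp add: tensor_hopf_def Let_def)

lemma tensor_hopf_Car [simp]: "Car (A \<boxdot> B) = Car A \<boxtimes> Car B"
  by (simp add: tensor_hopf_sel)

lemma tensor_hopf_comonoid [simp]:
  "coc_comonoid (A \<boxdot> B) \<longleftrightarrow> coc_comonoid (A \<odot> B)" "comon_hom C (A \<boxdot> B) f \<longleftrightarrow> comon_hom C (A \<odot> B) f" "comon_hom (A \<boxdot> B) C f \<longleftrightarrow> comon_hom (A \<odot> B) C f"
  "(A \<boxdot> B) \<odot> D = (A \<odot> B) \<odot> D" "D \<odot> (A \<boxdot> B) = D \<odot> (A \<odot> B)"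
  "pr1 (A \<boxdot> B) D = pr1 (A \<odot> B) D" "pr2 (A \<boxdot> B) D = pr2 (A \<odot> B) D"
  "pr1 D (A \<boxdot> B) = pr1 D (A \<odot> B)" "pr2 D (A \<boxdot> B) = pr2 D (A \<odot> B)"
  "pair (A \<boxdot> B) = pair (A \<odot> B)" "conv H (A \<boxdot> B) = conv H (A \<odot> B)" "conv_one H (A \<boxdot> B) = conv_one H (A \<odot> B)"
  by (simp_all only: coc_comonoid_def is_comonoid_def cocommutative_def comonoid_morphism_def tensor_comonoid_def tensor_hopf_sel
      pr1_def pr2_def pair_def conv_def conv_one_def fun_eq_iff simp_thms)

lemma pr_comon_hom [simp]:
  "coc_comonoid A \<Longrightarrow> coc_comonoid B \<Longrightarrow> comon_hom (A \<odot> B) A (pr1 A B)" "coc_comonoid A \<Longrightarrow> coc_comonoid B \<Longrightarrow> comon_hom (A \<odot> B) B (pr2 A B)"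
  by (simp_all add: pr1_comon_hom pr2_comon_hom)

lemma pr_comp_comon_hom [simp]:
  assumes "coc_comonoid A" "coc_comonoid B" "coc_comonoid C" "comon_hom C (A \<odot> B) x"
  shows "comon_hom C A (pr1 A B \<cdot> x)" "comon_hom C B (pr2 A B \<cdot> x)"
  using assms by (auto intro: comon_hom_comp[of C "A \<odot> B"])

text \<open>\<open>Mul (A \<boxdot> B)\<close> is the componentwise product of the generic pair, and
  substituting \<open>pair C x y\<close> commutes with pairing and convolution.\<close>

lemma conv_tensor:
  assumes [simp]: "hopf A" "hopf B" "coc_comonoid C" and x [simp]: "comon_hom C (A \<odot> B) x" and y [simp]: "comon_hom C (A \<odot> B) y"
  shows "conv (A \<boxdot> B) C x y = pair C (conv A C (pr1 A B \<cdot> x) (pr1 A B \<cdot> y)) (conv B C (pr2 A B \<cdot> x) (pr2 A B \<cdot> y))"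
proof -
  let ?P = "A \<odot> B"
  let ?PP = "?P \<odot> ?P"
  have xy: "comon_hom C ?PP (pair C x y)"
    by (intro pair_comon_hom) simp_all
  note [simp] = comon_hom_arr(1-3)[OF xy] comon_hom_arr(1-3)[OF x] comon_hom_arr(1-3)[OF y]
  have "conv (A \<boxdot> B) C x y = pair C (conv A ?PP (pr1 A B \<cdot> pr1 ?P ?P) (pr1 A B \<cdot> pr2 ?P ?P) \<cdot> pair C x y)
      (conv B ?PP (pr2 A B \<cdot> pr1 ?P ?P) (pr2 A B \<cdot> pr2 ?P ?P) \<cdot> pair C x y)"
    by (simp add: conv_def[of "A \<boxdot> B"] Mul_tensor_hopf pair_comp[OF _ _ xy])
  then show ?thesis
    by (simp add: conv_comp[OF _ _ _ xy] pr_pair)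
qed

lemma Unt_tensor_comon_hom: "hopf A \<Longrightarrow> hopf B \<Longrightarrow> comon_hom unit_comonoid (A \<odot> B) (Unt (A \<boxdot> B))"
  by (simp add: tensor_hopf_sel pair_comon_hom)

lemma conv_one_tensor:
  assumes [simp]: "hopf A" "hopf B" "coc_comonoid C"
  shows "conv_one (A \<boxdot> B) C = pair C (conv_one A C) (conv_one B C)"
  by (simp add: conv_one_def tensor_hopf_sel pair_comp[OF _ _ Counit_comon_hom])

lemma hopf_tensor [simp]:
  assumes [simp]: "hopf A" "hopf B"
  shows "hopf (A \<boxdot> B)"
proof (rule hopfI)
  let ?P = "A \<odot> B"
  let ?PP = "?P \<odot> ?P"
  have "Mul (A \<boxdot> B) = conv (A \<boxdot> B) ?PP (pr1 ?P ?P) (pr2 ?P ?P)"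
    by (simp add: conv_tensor Mul_tensor_hopf)
  then show "comon_hom ((A \<boxdot> B) \<odot> (A \<boxdot> B)) (A \<boxdot> B) (Mul (A \<boxdot> B))"
    by (simp add: conv_tensor pair_comon_hom)
  show "comon_hom unit_comonoid (A \<boxdot> B) (Unt (A \<boxdot> B))"
    by (simp add: Unt_tensor_comon_hom)
  show "comon_hom (A \<boxdot> B) (A \<boxdot> B) (Antipode (A \<boxdot> B))"
    by (simp add: tensor_hopf_sel pair_comon_hom)
  fix C :: "('o, 'm) comonoid_data" and x y z
  assume [simp]: "coc_comonoid C"
  show "conv (A \<boxdot> B) C (conv (A \<boxdot> B) C x y) z = conv (A \<boxdot> B) C x (conv (A \<boxdot> B) C y z)"
    if "comon_hom C (A \<boxdot> B) x" "comon_hom C (A \<boxdot> B) y" "comon_hom C (A \<boxdot> B) z"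
    using that comon_hom_arr(1-3)[of C "A \<boxdot> B" x] comon_hom_arr(1-3)[of C "A \<boxdot> B" y] comon_hom_arr(1-3)[of C "A \<boxdot> B" z]
    by (simp add: conv_tensor pr_pair pair_comon_hom conv_assoc)
  assume "comon_hom C (A \<boxdot> B) x"
  then have x [simp]: "comon_hom C ?P x"
    by simp
  note [simp] = comon_hom_arr(1-3)[OF x]
  show "conv (A \<boxdot> B) C (conv_one (A \<boxdot> B) C) x = x \<and> conv (A \<boxdot> B) C x (conv_one (A \<boxdot> B) C) = x"
    by (simp add: conv_one_tensor conv_tensor pair_comon_hom pr_pair pair_eta)
  have S: "Antipode (A \<boxdot> B) \<cdot> x = pair C (Antipode A \<cdot> pr1 A B \<cdot> x) (Antipode B \<cdot> pr2 A B \<cdot> x)"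
    by (simp add: tensor_hopf_sel pair_comp[OF _ _ x])
  show "conv (A \<boxdot> B) C (Antipode (A \<boxdot> B) \<cdot> x) x = conv_one (A \<boxdot> B) C \<and> conv (A \<boxdot> B) C x (Antipode (A \<boxdot> B) \<cdot> x) = conv_one (A \<boxdot> B) C"
    by (simp add: S conv_one_tensor conv_tensor pair_comon_hom pr_pair conv_antipode)
qed simp_all

section \<open>Morphisms of Hopf monoids\<close>

definition hopf_hom where "hopf_hom A B f \<longleftrightarrow> monoid_morphism M A B f \<and> comonoid_morphism M A B f"

lemma hopf_hom_comon_hom: "hopf_hom A B f \<Longrightarrow> comon_hom A B f"
  by (simp add: hopf_hom_def)

lemma conv_pr: "hopf H \<Longrightarrow> conv H (H \<odot> H) (pr1 H H) (pr2 H H) = Mul H"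
  by (simp add: conv_def pair_pr)

text \<open>It suffices to respect the product of the generic pair. The unit is then respected as
  well, since group homomorphisms preserve neutral elements.\<close>

lemma hopf_homI:
  assumes [simp]: "hopf A" "hopf B" and f: "comon_hom A B f"
    and mul: "f \<cdot> Mul A = conv B (A \<odot> A) (f \<cdot> pr1 A A) (f \<cdot> pr2 A A)"
  shows "hopf_hom A B f"
proof -
  note [simp] = comon_hom_arr(1-3)[OF f]
  have m: "f \<cdot> Mul A = Mul B \<cdot> (f \<otimes> f)"
  proof -
    have "Mul B \<cdot> (f \<otimes> f) = Mul B \<cdot> (f \<otimes> f) \<cdot> pair (A \<odot> A) (pr1 A A) (pr2 A A)"
      by (simp add: pair_pr)
    also have "\<dots> = conv B (A \<odot> A) (f \<cdot> pr1 A A) (f \<cdot> pr2 A A)"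
      by (simp add: tensor_pair conv_def)
    finally show ?thesis
      by (simp add: mul)
  qed
  \<comment> \<open>\<open>?e\<close> will be idempotent in the group of elements of
    \<open>B\<close> at the unit comonoid, hence neutral there.\<close>
  let ?e = "f \<cdot> Unt A"
  have e [simp]: "comon_hom unit_comonoid B ?e"
    using f by (auto intro: comon_hom_comp[of _ A])
  have "conv B unit_comonoid ?e ?e = (Mul B \<cdot> (f \<otimes> f)) \<cdot> pair unit_comonoid (Unt A) (Unt A)"
    by (simp add: conv_def tensor_pair)
  also have "\<dots> = f \<cdot> conv A unit_comonoid (Unt A) (Unt A)"
    unfolding m[symmetric] by (simp add: conv_def)
  also have "conv A unit_comonoid (Unt A) (Unt A) = Unt A"
    using conv_one(1)[of A unit_comonoid "Unt A"] by (simp add: conv_one_def)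
  finally have "?e = conv_one B unit_comonoid"
    using group.l_cancel_one[OF group_elements[of B unit_comonoid], of ?e ?e] by simp
  then have "?e = Unt B"
    by (simp add: conv_one_def)
  with m f show ?thesis
    by (simp add: hopf_hom_def monoid_morphism_def Hom_iff)
qed

lemma hopf_hom_conv:
  assumes "hopf_hom A B f" "hopf A" "hopf B" "coc_comonoid C" "x \<in> Arr M" "y \<in> Arr M" "Dom M x = Car C" "Dom M y = Car C"
    "Cod M x = Car A" "Cod M y = Car A"
  shows "f \<cdot> conv A C x y = conv B C (f \<cdot> x) (f \<cdot> y)"
proof -
  note [simp] = assms(2-) comon_hom_arr(1-3)[OF hopf_hom_comon_hom[OF assms(1)]]
  have "f \<cdot> conv A C x y = (f \<cdot> Mul A) \<cdot> pair C x y"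
    by (simp add: conv_def)
  also have "f \<cdot> Mul A = Mul B \<cdot> (f \<otimes> f)"
    using assms(1) by (simp add: hopf_hom_def monoid_morphism_def)
  finally show ?thesis
    by (simp add: conv_def tensor_pair)
qed

lemma hopf_hom_Mul:
  assumes "hopf_hom A B f" "hopf A" "hopf B"
  shows "f \<cdot> Mul A = conv B (A \<odot> A) (f \<cdot> pr1 A A) (f \<cdot> pr2 A A)"
  using hopf_hom_conv[OF assms, of "A \<odot> A" "pr1 A A" "pr2 A A"] assms by (simp add: conv_pr)

lemma hopf_hom_Unt: "hopf_hom A B f \<Longrightarrow> f \<cdot> Unt A = Unt B"
  by (simp add: hopf_hom_def monoid_morphism_def)

lemma hopf_hom_comp:
  assumes "hopf A" "hopf B" "hopf C" and f: "hopf_hom A B f" and g: "hopf_hom B C g"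
  shows "hopf_hom A C (g \<cdot> f)"
proof -
  note [simp] = assms(1-3) comon_hom_arr(1-3)[OF hopf_hom_comon_hom[OF f]] comon_hom_arr(1-3)[OF hopf_hom_comon_hom[OF g]]
  show ?thesis
    using hopf_hom_comon_hom[OF f] hopf_hom_comon_hom[OF g]
    by (intro hopf_homI) (auto intro: comon_hom_comp[of A B C] simp: hopf_hom_Mul[OF f] hopf_hom_conv[OF g])
qed

lemma hopf_hom_Id [simp]: "hopf A \<Longrightarrow> hopf_hom A A (\<iota> (Car A))"
  by (rule hopf_homI) (simp_all add: conv_pr)

lemma hopf_hom_Counit [simp]:
  assumes [simp]: "hopf A"
  shows "hopf_hom A unit_hopf (Counit A)"
proof (rule hopf_homI)
  have "comon_hom (A \<odot> A) unit_comonoid (Counit A \<cdot> Mul A)"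
    by (rule comon_hom_comp[of _ A]) simp_all
  moreover have "comon_hom (A \<odot> A) unit_hopf (conv unit_hopf (A \<odot> A) (Counit A \<cdot> pr1 A A) (Counit A \<cdot> pr2 A A))"
    by (intro conv_comon_hom) (auto intro: comon_hom_comp[of _ A])
  ultimately show "Counit A \<cdot> Mul A = conv unit_hopf (A \<odot> A) (Counit A \<cdot> pr1 A A) (Counit A \<cdot> pr2 A A)"
    by (metis comon_hom_unit_unique unit_hopf_comonoid(2))
qed simp_all

lemma hopf_hom_Unt_Id [simp]:
  assumes [simp]: "hopf A"
  shows "hopf_hom unit_hopf A (Unt A)"
proof (rule hopf_homI)
  let ?UU = "unit_comonoid \<odot> unit_comonoid"
  have [simp]: "pr1 unit_hopf unit_hopf = Counit ?UU" "pr2 unit_hopf unit_hopf = Counit ?UU" "Mul unit_hopf = Counit ?UU"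
    by (simp_all add: pr1_def pr2_def Lunit_Runit_unit)
  have "conv A ?UU (conv_one A ?UU) (conv_one A ?UU) = conv_one A ?UU"
    by simp
  then show "Unt A \<cdot> Mul unit_hopf = conv A (unit_hopf \<odot> unit_hopf) (Unt A \<cdot> pr1 unit_hopf unit_hopf) (Unt A \<cdot> pr2 unit_hopf unit_hopf)"
    by (simp add: conv_one_def)
qed simp_all

lemma hopf_hom_pr [simp]:
  assumes [simp]: "hopf A" "hopf B"
  shows "hopf_hom (A \<boxdot> B) A (pr1 A B)" "hopf_hom (A \<boxdot> B) B (pr2 A B)"
proof -
  have "Mul (A \<boxdot> B) = conv (A \<boxdot> B) ((A \<odot> B) \<odot> (A \<odot> B)) (pr1 (A \<odot> B) (A \<odot> B)) (pr2 (A \<odot> B) (A \<odot> B))"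
    using conv_pr[of "A \<boxdot> B"] by simp
  then show "hopf_hom (A \<boxdot> B) A (pr1 A B)" "hopf_hom (A \<boxdot> B) B (pr2 A B)"
    by (auto intro!: hopf_homI simp: conv_tensor pr_pair)
qed

lemma hopf_hom_pair:
  assumes [simp]: "hopf A" "hopf B" "hopf Z" and f: "hopf_hom Z A f" and g: "hopf_hom Z B g"
  shows "hopf_hom Z (A \<boxdot> B) (pair Z f g)"
proof (rule hopf_homI)
  note [simp] = comon_hom_arr(1-3)[OF hopf_hom_comon_hom[OF f]] comon_hom_arr(1-3)[OF hopf_hom_comon_hom[OF g]] hopf_hom_comon_hom[OF f] hopf_hom_comon_hom[OF g]
  have c [simp]: "comon_hom Z (A \<odot> B) (pair Z f g)"
    by (rule pair_comon_hom) simp_all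
  have [simp]: "comon_hom (Z \<odot> Z) (A \<odot> B) (pair Z f g \<cdot> pr1 Z Z)" "comon_hom (Z \<odot> Z) (A \<odot> B) (pair Z f g \<cdot> pr2 Z Z)"
    by (rule comon_hom_comp[of _ Z]; simp)+
  have "pair Z f g \<cdot> Mul Z = pair (Z \<odot> Z) (f \<cdot> Mul Z) (g \<cdot> Mul Z)"
    by (subst pair_comp[where D = "Z \<odot> Z"]) simp_all
  also have "\<dots> = conv (A \<boxdot> B) (Z \<odot> Z) (pair Z f g \<cdot> pr1 Z Z) (pair Z f g \<cdot> pr2 Z Z)"
    by (simp add: conv_tensor hopf_hom_Mul[OF f] hopf_hom_Mul[OF g] Comp_reassoc[OF pr_pair(1)] Comp_reassoc[OF pr_pair(2)])
  finally show "pair Z f g \<cdot> Mul Z = conv (A \<boxdot> B) (Z \<odot> Z) (pair Z f g \<cdot> pr1 Z Z) (pair Z f g \<cdot> pr2 Z Z)" .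
  show "comon_hom Z (A \<boxdot> B) (pair Z f g)"
    by simp
qed simp_all

section \<open>Abelian objects\<close>

lemma Hopf_coc_Obj [simp]: "A \<in> Obj (Hopf_coc M) \<longleftrightarrow> hopf A"
  by (simp add: Hopf_coc_def structured_category_def hopf_def)

lemma Hopf_coc_Hom: "F \<in> Hom (Hopf_coc M) A B \<longleftrightarrow> (\<exists>f. F = (A, B, f) \<and> hopf A \<and> hopf B \<and> hopf_hom A B f)"
  by (auto simp: Hopf_coc_def structured_category_def Hom_iff hopf_def hopf_hom_def comonoid_morphism_def)

lemma Hopf_coc_HomI [simp]: "(A, B, f) \<in> Hom (Hopf_coc M) A' B' \<longleftrightarrow> A' = A \<and> B' = B \<and> hopf A \<and> hopf B \<and> hopf_hom A B f"
  by (auto simp: Hopf_coc_Hom)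

lemma Hopf_coc_sel [simp]:
  "Dom (Hopf_coc M) (A, B, f) = A" "Cod (Hopf_coc M) (A, B, f) = B"
  "Comp (Hopf_coc M) (B', D, g) (A, B, f) = (A, D, g \<cdot> f)" "Id (Hopf_coc M) A = (A, A, \<iota> (Car A))"
  by (simp_all add: Hopf_coc_def structured_category_def)

lemma hopf_hom_unit_unique: "hopf_hom A unit_hopf f \<Longrightarrow> f = Counit A"
  using hopf_hom_comon_hom[of A unit_hopf f] comon_hom_unit_unique[of A f] by simp

lemma terminal_unit: "terminal (Hopf_coc M) unit_hopf"
proof -
  have "\<exists>!f. f \<in> Hom (Hopf_coc M) A unit_hopf" if "hopf A" for A
    using that hopf_hom_unit_unique[of A] by (intro ex1I[of _ "(A, unit_hopf, Counit A)"]) (auto simp: Hopf_coc_Hom)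
  then show ?thesis
    by (simp add: terminal_def)
qed

lemma to_terminal_unit:
  assumes "hopf A"
  shows "to_terminal (Hopf_coc M) unit_hopf A = (A, unit_hopf, Counit A)"
  unfolding to_terminal_def using assms hopf_hom_unit_unique[of A] by (intro the_equality) (auto simp: Hopf_coc_Hom)

lemma hopf_hom_pair_eta [simp]:
  "\<lbrakk>hopf A; hopf B; hopf Z; hopf_hom Z (A \<boxdot> B) h\<rbrakk> \<Longrightarrow> pair Z (pr1 A B \<cdot> h) (pr2 A B \<cdot> h) = h"
  using pair_eta[of A B Z h] hopf_hom_comon_hom[of Z "A \<boxdot> B" h] by simp

lemma is_product_tensor:
  assumes [simp]: "hopf A" "hopf B"
  shows "is_product (Hopf_coc M) A B (A \<boxdot> B) (A \<boxdot> B, A, pr1 A B) (A \<boxdot> B, B, pr2 A B)"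
  unfolding is_product_def
proof (intro conjI allI ballI)
  fix Z F G
  assume "F \<in> Hom (Hopf_coc M) Z A" "G \<in> Hom (Hopf_coc M) Z B"
  then obtain f g where [simp]: "F = (Z, A, f)" "G = (Z, B, g)" "hopf Z" and fg: "hopf_hom Z A f" "hopf_hom Z B g"
    by (auto simp: Hopf_coc_Hom)
  then show "\<exists>!h. h \<in> Hom (Hopf_coc M) Z (A \<boxdot> B) \<and> Comp (Hopf_coc M) (A \<boxdot> B, A, pr1 A B) h = F
      \<and> Comp (Hopf_coc M) (A \<boxdot> B, B, pr2 A B) h = G"
    by (intro ex1I[of _ "(Z, A \<boxdot> B, pair Z f g)"])
      (auto simp: Hopf_coc_Hom pr_pair hopf_hom_comon_hom intro: hopf_hom_pair)
qed simp_all

lemma pairing_tensor: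
  assumes [simp]: "hopf A" "hopf B" "hopf Z" and fg: "hopf_hom Z A f" "hopf_hom Z B g"
  shows "pairing (Hopf_coc M) (A \<boxdot> B) (A \<boxdot> B, A, pr1 A B) (A \<boxdot> B, B, pr2 A B) (Z, A, f) (Z, B, g)
    = (Z, A \<boxdot> B, pair Z f g)"
  unfolding pairing_def
  by (rule the_equality) (auto simp: Hopf_coc_Hom pr_pair hopf_hom_comon_hom fg intro: hopf_hom_pair fg)

section \<open>Commutative Hopf monoids are abelian objects\<close>

lemma conv_commute:
  assumes "hopf H" "commutative M H" "coc_comonoid C" "x \<in> Arr M" "y \<in> Arr M" "Dom M x = Car C" "Dom M y = Car C"
    "Cod M x = Car H" "Cod M y = Car H"
  shows "conv H C x y = conv H C y x"
proof -
  note [simp] = assms(1,3-)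
  have "conv H C x y = (Mul H \<cdot> \<sigma> (Car H) (Car H)) \<cdot> pair C x y"
    using assms(2) by (simp add: conv_def commutative_def)
  then show ?thesis
    by (simp add: Braid_pair conv_def)
qed

lemma comm_group_elements:
  assumes "hopf H" "commutative M H" "coc_comonoid C"
  shows "comm_group (elements C H)"
  using assms by (intro group.group_comm_groupI[OF group_elements]) (auto intro: conv_commute simp: comon_hom_arr(1-3))

lemma inv_elements:
  assumes "hopf H" "coc_comonoid C" "comon_hom C H x"
  shows "m_inv (elements C H) x = Antipode H \<cdot> x"
  using assms group.inv_equality[OF group_elements[of H C], of "Antipode H \<cdot> x" x] by (simp add: conv_antipode)

lemma Mul_conv:
  assumes "hopf H" "coc_comonoid C" "comon_hom C (H \<odot> H) x"
  shows "Mul H \<cdot> x = conv H C (pr1 H H \<cdot> x) (pr2 H H \<cdot> x)"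
  using assms by (simp add: conv_def pair_eta)

text \<open>In a commutative group, (a c)(b d) = (a b)(c d); this is evaluated at the generic pair
  of elements of \<open>H \<boxdot> H\<close>.\<close>

lemma Mul_hopf_hom:
  assumes [simp]: "hopf H" and comm: "commutative M H"
  shows "hopf_hom (H \<boxdot> H) H (Mul H)"
proof (rule hopf_homI)
  let ?P = "H \<odot> H"
  let ?C = "?P \<odot> ?P"
  let ?x = "pr1 ?P ?P" and ?y = "pr2 ?P ?P"
  interpret comm_group "elements ?C H"
    by (rule comm_group_elements) (simp_all add: comm)
  \<comment> \<open>The coordinates of that generic pair: \<open>?x\<close> is (a, b) and
    \<open>?y\<close> is (c, d), with product (a c, b d).\<close>
  let ?a = "pr1 H H \<cdot> ?x" and ?b = "pr2 H H \<cdot> ?x" and ?c = "pr1 H H \<cdot> ?y" and ?d = "pr2 H H \<cdot> ?y"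
  have "Mul H \<cdot> Mul (H \<boxdot> H) = conv H ?C (conv H ?C ?a ?c) (conv H ?C ?b ?d)"
    by (simp add: Mul_tensor_hopf conv_def[of H ?C "conv H ?C ?a ?c"])
  also have "\<dots> = conv H ?C (conv H ?C ?a ?b) (conv H ?C ?c ?d)"
    using m_assoc[of ?a ?c "conv H ?C ?b ?d"] m_assoc[of ?a ?b "conv H ?C ?c ?d"]
      m_lcomm[of ?c ?b ?d] by simp
  finally show "Mul H \<cdot> Mul (H \<boxdot> H) = conv H ((H \<boxdot> H) \<odot> (H \<boxdot> H)) (Mul H \<cdot> pr1 (H \<boxdot> H) (H \<boxdot> H)) (Mul H \<cdot> pr2 (H \<boxdot> H) (H \<boxdot> H))"
    by (simp add: Mul_conv[of H ?C ?x] Mul_conv[of H ?C ?y])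
qed simp_all

text \<open>Composing with the antipode is inversion in the groups of elements, and inversion is a
  homomorphism when the group is commutative.\<close>

lemma Antipode_hopf_hom:
  assumes [simp]: "hopf H" and comm: "commutative M H"
  shows "hopf_hom H H (Antipode H)"
proof (rule hopf_homI)
  let ?C = "H \<odot> H"
  interpret comm_group "elements ?C H"
    by (rule comm_group_elements) (simp_all add: comm)
  have "Antipode H \<cdot> Mul H = m_inv (elements ?C H) (conv H ?C (pr1 H H) (pr2 H H))"
    by (simp add: conv_pr inv_elements)
  also have "\<dots> = conv H ?C (Antipode H \<cdot> pr1 H H) (Antipode H \<cdot> pr2 H H)"
    using inv_mult[of "pr1 H H" "pr2 H H"] by (simp add: inv_elements)
  finally show "Antipode H \<cdot> Mul H = conv H (H \<odot> H) (Antipode H \<cdot> pr1 H H) (Antipode H \<cdot> pr2 H H)" .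
qed simp_all

lemma abelian_object_if_commutative:
  assumes X [simp]: "hopf X" and comm: "commutative M X"
  shows "abelian_object (Hopf_coc M) X"
proof -
  let ?C = "Hopf_coc M" and ?P = "X \<boxdot> X"
  let ?R = "?P \<boxdot> X"
  let ?p = "(?P, X, pr1 X X)" and ?q = "(?P, X, pr2 X X)" and ?r = "(?R, ?P, pr1 ?P X)" and ?s = "(?R, X, pr2 ?P X)"
  let ?m = "(?P, X, Mul X)" and ?e = "(unit_hopf, X, Unt X)" and ?n = "(X, X, Antipode X)"
  let ?pr = "pairing ?C ?P ?p ?q"
  note [simp] = Mul_hopf_hom[OF X comm] Antipode_hopf_hom[OF X comm]
  have r [simp]: "hopf_hom ?R X (pr2 (X \<odot> X) X)" "hopf_hom ?R ?P (pr1 (X \<odot> X) X)"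
    using hopf_hom_pr[of ?P X] by simp_all
  have [simp]: "hopf_hom ?R X (Mul X \<cdot> pr1 (X \<odot> X) X)" "hopf_hom ?R X (pr1 X X \<cdot> pr1 (X \<odot> X) X)" "hopf_hom ?R X (pr2 X X \<cdot> pr1 (X \<odot> X) X)"
    by (rule hopf_hom_comp[where B = ?P]; simp)+
  have [simp]: "hopf_hom X X (Unt X \<cdot> Counit X)"
    by (rule hopf_hom_comp[where B = unit_hopf]) simp_all
  have [simp]: "hopf_hom ?R ?P (pair ((X \<odot> X) \<odot> X) (pr2 X X \<cdot> pr1 (X \<odot> X) X) (pr2 (X \<odot> X) X))"
    using hopf_hom_pair[of X X ?R "pr2 X X \<cdot> pr1 (X \<odot> X) X" "pr2 (X \<odot> X) X"] by simp
  have [simp]: "hopf_hom ?R X (Mul X \<cdot> pair ((X \<odot> X) \<odot> X) (pr2 X X \<cdot> pr1 (X \<odot> X) X) (pr2 (X \<odot> X) X))"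
    by (rule hopf_hom_comp[where B = ?P]) simp_all
  have "internal_abelian_group ?C X unit_hopf ?P ?p ?q ?R ?r ?s ?m ?e ?n"
    unfolding internal_abelian_group_def Let_def
  proof (intro conjI)
    let ?D = "(X \<odot> X) \<odot> X"
    \<comment> \<open>The three projections of the triple product; the internal associativity law is
      associativity of convolution at these elements.\<close>
    let ?x = "pr1 X X \<cdot> pr1 (X \<odot> X) X" and ?y = "pr2 X X \<cdot> pr1 (X \<odot> X) X" and ?z = "pr2 (X \<odot> X) X"
    have "Mul X \<cdot> pair ?D (Mul X \<cdot> pr1 (X \<odot> X) X) ?z = Mul X \<cdot> pair ?D ?x (Mul X \<cdot> pair ?D ?y ?z)"
      using conv_assoc[of X ?D ?x ?y ?z] by (simp add: Mul_conv[of X ?D "pr1 (X \<odot> X) X"] conv_def)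
    then show "Comp ?C ?m (?pr (Comp ?C ?m ?r) ?s)
      = Comp ?C ?m (?pr (Comp ?C ?p ?r) (Comp ?C ?m (?pr (Comp ?C ?q ?r) ?s)))"
      by (simp add: pairing_tensor)
    show "Comp ?C ?m (?pr (Comp ?C ?e (to_terminal ?C unit_hopf X)) (Id ?C X)) = Id ?C X"
      "Comp ?C ?m (?pr (Id ?C X) (Comp ?C ?e (to_terminal ?C unit_hopf X))) = Id ?C X"
      using conv_one[of X X "\<iota> (Car X)"] by (simp_all add: pairing_tensor to_terminal_unit conv_def conv_one_def)
    show "Comp ?C ?m (?pr ?n (Id ?C X)) = Comp ?C ?e (to_terminal ?C unit_hopf X)"
      "Comp ?C ?m (?pr (Id ?C X) ?n) = Comp ?C ?e (to_terminal ?C unit_hopf X)"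
      using conv_antipode[of X X "\<iota> (Car X)"] by (simp_all add: pairing_tensor to_terminal_unit conv_def conv_one_def)
    show "Comp ?C ?m (?pr ?q ?p) = ?m"
      using conv_commute[OF X comm, of "X \<odot> X" "pr2 X X" "pr1 X X"] by (simp add: pairing_tensor conv_pr) (simp add: conv_def)
    show "is_product ?C X X ?P ?p ?q" "is_product ?C ?P X ?R ?r ?s"
      by (rule is_product_tensor; simp)+
  qed (simp_all add: terminal_unit)
  then show ?thesis
    unfolding abelian_object_def by blast
qed

text \<open>The Eckmann--Hilton argument: transported along the comparison morphism from \<open>X \<boxdot> X\<close>, the group
  operation is a Hopf monoid morphism \<open>k\<close> with \<open>k(a, 1) = a = k(1, a)\<close>, so it sends both products of
  \<open>(a, 1)\<close> and \<open>(1, b)\<close>, which coincide, to \<open>a b\<close> and \<open>b a\<close> respectively.\<close>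

lemma commutative_if_unital_morphism:
  assumes X [simp]: "hopf X" and k: "hopf_hom (X \<boxdot> X) X k"
    and k1: "k \<cdot> pair X (\<iota> (Car X)) (conv_one X X) = \<iota> (Car X)"
    and k2: "k \<cdot> pair X (conv_one X X) (\<iota> (Car X)) = \<iota> (Car X)"
  shows "commutative M X"
proof -
  let ?P = "X \<odot> X" and ?j1 = "pair X (\<iota> (Car X)) (conv_one X X)" and ?j2 = "pair X (conv_one X X) (\<iota> (Car X))"
  \<comment> \<open>At the generic pair (a, b), these are the elements (a, 1) and (1, b) of
    \<open>X \<boxdot> X\<close>, and \<open>?o\<close> is the neutral element.\<close>
  let ?a = "?j1 \<cdot> pr1 X X" and ?b = "?j2 \<cdot> pr2 X X" and ?o = "conv_one X ?P"
  note k' [simp] = comon_hom_arr(1-3)[OF hopf_hom_comon_hom[OF k], simplified]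
  have j [simp]: "comon_hom X ?P ?j1" "comon_hom X ?P ?j2"
    by (auto intro: pair_comon_hom)
  have ab [simp]: "comon_hom ?P ?P ?a" "comon_hom ?P ?P ?b"
    by (rule comon_hom_comp[of _ X]; simp)+
  note [simp] = comon_hom_arr(1-3)[OF ab(1), simplified] comon_hom_arr(1-3)[OF ab(2), simplified]
  have a: "?a = pair ?P (pr1 X X) ?o"
    by (subst pair_comp[where D = ?P]) (simp_all add: conv_one_comp[where D = ?P])
  have b: "?b = pair ?P ?o (pr2 X X)"
    by (subst pair_comp[where D = ?P]) (simp_all add: conv_one_comp[where D = ?P])
  \<comment> \<open>Products in \<open>X \<boxdot> X\<close> are componentwise, and each component
    has a neutral factor, so both orders give (a, b).\<close>
  have "conv (X \<boxdot> X) ?P ?a ?b = conv (X \<boxdot> X) ?P ?b ?a"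
    by (simp only: conv_tensor[OF X X coc_comonoid_tensor[OF hopf_coc_comonoid[OF X] hopf_coc_comonoid[OF X]] ab(1) ab(2)]
      conv_tensor[OF X X coc_comonoid_tensor[OF hopf_coc_comonoid[OF X] hopf_coc_comonoid[OF X]] ab(2) ab(1)]) (simp add: a b pr_pair)
  then have "k \<cdot> conv (X \<boxdot> X) ?P ?a ?b = k \<cdot> conv (X \<boxdot> X) ?P ?b ?a"
    by simp
  then have "conv X ?P (k \<cdot> ?a) (k \<cdot> ?b) = conv X ?P (k \<cdot> ?b) (k \<cdot> ?a)"
    by (simp add: hopf_hom_conv[OF k] del: Comp_assoc')
  moreover have "k \<cdot> ?a = pr1 X X"
    using k1 by (subst Comp_assoc'[symmetric]) simp_all
  moreover have "k \<cdot> ?b = pr2 X X"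
    using k2 by (subst Comp_assoc'[symmetric]) simp_all
  ultimately have "conv X ?P (pr1 X X) (pr2 X X) = conv X ?P (pr2 X X) (pr1 X X)"
    by simp
  also have "\<dots> = Mul X \<cdot> (\<sigma> (Car X) (Car X) \<cdot> pair ?P (pr1 X X) (pr2 X X))"
    by (simp add: Braid_pair conv_def)
  finally show ?thesis
    by (simp add: commutative_def conv_pr pair_pr)
qed

text \<open>The given structure lives on some product \<open>P\<close> and some terminal object
  \<open>T\<close>. The comparison \<open>h\<close> from \<open>X \<boxdot> X\<close> to
  \<open>P\<close> carries its multiplication to a morphism out of the tensor product, and its unit
  laws become the two hypotheses of \<open>commutative_if_unital_morphism\<close>.\<close>

lemma commutative_if_abelian_object:
  assumes X [simp]: "hopf X" and "abelian_object (Hopf_coc M) X"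
  shows "commutative M X"
proof -
  let ?C = "Hopf_coc M" and ?H = "X \<boxdot> X"
  let ?p0 = "(?H, X, pr1 X X)" and ?q0 = "(?H, X, pr2 X X)"
  obtain T P p q R r s mul e neg where ab: "internal_abelian_group ?C X T P p q R r s mul e neg"
    using assms(2) by (auto simp: abelian_object_def)
  let ?t = "to_terminal ?C T X"
  have T: "terminal ?C T" and prod: "is_product ?C X X P p q" and mul: "mul \<in> Hom ?C P X" and e: "e \<in> Hom ?C T X"
    and one: "Comp ?C mul (pairing ?C P p q (Comp ?C e ?t) (Id ?C X)) = Id ?C X"
      "Comp ?C mul (pairing ?C P p q (Id ?C X) (Comp ?C e ?t)) = Id ?C X"
    using ab by (simp_all add: internal_abelian_group_def Let_def)
  have [simp]: "hopf T"
    using T by (simp add: terminal_def)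
  obtain m' where m: "mul = (P, X, m')" "hopf_hom P X m'" and [simp]: "hopf P"
    using mul by (auto simp: Hopf_coc_Hom)
  obtain e' where e': "e = (T, X, e')" "hopf_hom T X e'"
    using e by (auto simp: Hopf_coc_Hom)
  obtain p' q' where pq: "p = (P, X, p')" "q = (P, X, q')" "hopf_hom P X p'" "hopf_hom P X q'"
    using prod by (auto simp: is_product_def Hopf_coc_Hom)
  have ex1: "\<exists>!f. f \<in> Hom ?C A T" if "hopf A" for A
    using T that by (simp add: terminal_def)
  have "?t \<in> Hom ?C X T"
    unfolding to_terminal_def using ex1[OF X] by (rule theI')
  \<comment> \<open>The trivial morphism, through \<open>unit_hopf\<close>. As \<open>T\<close> is
    terminal, it must be the canonical arrow.\<close>
  moreover have "(X, T, Unt T \<cdot> Counit X) \<in> Hom ?C X T"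
    by (auto intro: hopf_hom_comp[of X unit_hopf T])
  ultimately have t: "?t = (X, T, Unt T \<cdot> Counit X)"
    using ex1[OF X] by blast
  \<comment> \<open>Morphisms of Hopf monoids preserve units, so whatever \<open>e\<close> is, the
    constant morphism it induces on \<open>X\<close> is the neutral element.\<close>
  have et: "Comp ?C e ?t = (X, X, conv_one X X)"
    using comon_hom_arr(1-3)[OF hopf_hom_comon_hom[OF e'(2)]] by (simp add: e' t conv_one_def Comp_reassoc[OF hopf_hom_Unt[OF e'(2)]])
  have ex1_pair: "\<exists>!h. h \<in> Hom ?C Z P \<and> Comp ?C p h = F \<and> Comp ?C q h = G"
    if "F \<in> Hom ?C Z X" "G \<in> Hom ?C Z X" for Z F G
    using prod that by (simp add: is_product_def)
  have "\<exists>h. h \<in> Hom ?C ?H P \<and> Comp ?C p h = ?p0 \<and> Comp ?C q h = ?q0"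
    by (rule ex1_implies_ex[OF ex1_pair]) simp_all
  then obtain h where h: "hopf_hom ?H P h" "p' \<cdot> h = pr1 X X" "q' \<cdot> h = pr2 X X"
    by (auto simp: Hopf_coc_Hom pq)
  \<comment> \<open>Pairings into \<open>P\<close> factor through the comparison \<open>h\<close>,
    by uniqueness in the universal property of \<open>P\<close>.\<close>
  have pr: "pairing ?C P p q (X, X, f) (X, X, g) = (X, P, h \<cdot> pair X f g)" if f: "hopf_hom X X f" and g: "hopf_hom X X g" for f g
    unfolding pairing_def
  proof (rule the1_equality)
    show "\<exists>!h. h \<in> Hom ?C (Dom ?C (X, X, f)) P \<and> Comp ?C p h = (X, X, f) \<and> Comp ?C q h = (X, X, g)"
      by (rule ex1_pair) (simp_all add: f g)
    have *: "hopf_hom X ?H (pair X f g)"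
      using f g by (simp add: hopf_hom_pair)
    note [simp] = comon_hom_arr(1-3)[OF hopf_hom_comon_hom[OF h(1)], simplified] comon_hom_arr(1-3)[OF hopf_hom_comon_hom[OF *], simplified]
      comon_hom_arr(1-3)[OF hopf_hom_comon_hom[OF pq(3)]] comon_hom_arr(1-3)[OF hopf_hom_comon_hom[OF pq(4)]]
    have "hopf_hom X P (h \<cdot> pair X f g)"
      using * h(1) by (auto intro: hopf_hom_comp[of X ?H P])
    moreover have "p' \<cdot> h \<cdot> pair X f g = f" "q' \<cdot> h \<cdot> pair X f g = g"
      by (simp_all add: Comp_reassoc[OF h(2)] Comp_reassoc[OF h(3)] pr_pair hopf_hom_comon_hom f g)
    ultimately show "(X, P, h \<cdot> pair X f g) \<in> Hom ?C (Dom ?C (X, X, f)) P \<and> Comp ?C p (X, P, h \<cdot> pair X f g) = (X, X, f)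
      \<and> Comp ?C q (X, P, h \<cdot> pair X f g) = (X, X, g)"
      by (simp add: pq)
  qed
  have [simp]: "hopf_hom X X (conv_one X X)"
    unfolding conv_one_def by (rule hopf_hom_comp[of X unit_hopf X]) simp_all
  note [simp] = comon_hom_arr(1-3)[OF hopf_hom_comon_hom[OF h(1)], simplified] comon_hom_arr(1-3)[OF hopf_hom_comon_hom[OF m(2)]]
  show ?thesis
  proof (rule commutative_if_unital_morphism)
    show "hopf_hom ?H X (m' \<cdot> h)"
      using h(1) m(2) by (auto intro: hopf_hom_comp[of ?H P X])
    show "(m' \<cdot> h) \<cdot> pair X (\<iota> (Car X)) (conv_one X X) = \<iota> (Car X)"
      "(m' \<cdot> h) \<cdot> pair X (conv_one X X) (\<iota> (Car X)) = \<iota> (Car X)"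
      using one by (simp_all add: et pr m)
  qed simp
qed

lemma abelian_object_iff_commutative:
  "hopf X \<Longrightarrow> abelian_object (Hopf_coc M) X \<longleftrightarrow> commutative M X"
  using abelian_object_if_commutative commutative_if_abelian_object by blast

end

theorem proposition8p9:
  fixes M :: "('o, 'm) symmetric_monoidal_cat"
  assumes "abelian_symmetric_monoidal_category M"
    and "faithful_coflatness M"
    and "faithful_flatness M"
    and "has_binary_coproducts (Hopf_coc M)"
  shows "Ab (Hopf_coc M) = Hopf_coc_com M"
proof -
  interpret abelian_symmetric_monoidal_category M
    by (rule assms(1))
  \<comment> \<open>Both sides are full subcategories of one category, so only the conditions on
    objects and on endpoints of arrows are to be compared. The equivalence of these conditions is
    available for Hopf monoids, and endpoints are such.\<close>
  have "hopf (Dom (Hopf_coc M) F) \<and> hopf (Cod (Hopf_coc M) F)" if "F \<in> Arr (Hopf_coc M)" for F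
    using that Hopf_coc_Hom[of F "Dom (Hopf_coc M) F" "Cod (Hopf_coc M) F"] by (auto simp: Hom_iff)
  then have "{F \<in> Arr (Hopf_coc M). abelian_object (Hopf_coc M) (Dom (Hopf_coc M) F) \<and> abelian_object (Hopf_coc M) (Cod (Hopf_coc M) F)}
    = {F \<in> Arr (Hopf_coc M). commutative M (Dom (Hopf_coc M) F) \<and> commutative M (Cod (Hopf_coc M) F)}"
    by (auto simp: abelian_object_iff_commutative)
  moreover have "Obj (Hopf_coc M) \<inter> {X. abelian_object (Hopf_coc M) X} = Obj (Hopf_coc M) \<inter> {A. commutative M A}"
    by (auto simp: abelian_object_iff_commutative)
  ultimately show ?thesis
    by (simp add: Ab_def Hopf_coc_com_def full_subcategory_def)
qed

end
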